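(* Let $n\geq 3$ be odd and let $q\in\mathbb{K}^*$ be not a root of unity. The quantum cluster algebra $Q_q$ of the quiver $P_{n+1}^{(1)}$ is generated, as a $\mathbb{K}$-algebra, by $w_0,w_1,x_1,x_2,\dots,x_n$ and, indeed, by $w_1,x_1,x_2,\dots,x_n$.
   Context: $\mathbb{K}$ is an algebraically closed field, $\mathbb{K}^*=\mathbb{K}\setminus\{0\}$, $q^{1/2}$ is a fixed square root of $q$. Quantum cluster algebras (no frozen variables, over $\mathbb{K}$). Let $B=(b_{ij})$ and $\Lambda=(\lambda_{ij})$ be skew-symmetric integer matrices indexed by $\{0,1,\dots,n\}$ with $B^T\Lambda=dI$, $d$ a positive integer. Let $T_q$ be the quantum torus generated by $w_0^{\pm1},\dots,w_n^{\pm1}$ with $w_iw_j=q^{\lambda_{ij}}w_jw_i$, and $D_q$ its division ring of fractions. For a seed with cluster $(X_0,\dots,X_n)$ and matrices $B,\Lambda$, and for $c\in\mathbb{Z}^{n+1}$, put $M(c)=q^{-\frac12\sum_{i<j}c_ic_j\lambda_{ij}}X_0^{c_0}\cdots X_n^{c_n}$. With $e_0,\dots,e_n$ the standard basis and $[a]_+=\max(a,0)$, mutation in direction $k$ replaces $X_k$ by $X_k'=M\big(-e_k+\sum_i[b_{ik}]_+e_i\big)+M\big(-e_k+\sum_i[-b_{ik}]_+e_i\big)\in D_q$, leaves the other $X_i$ unchanged, replaces $B$ by the usual matrix mutation $\mu_k(B)$ and $\Lambda$ by $E^T\Lambda E$, where $E$ agrees with the identity outside column $k$, $E_{kk}=-1$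 and $E_{ik}=[-b_{ik}]_+$ for $i\neq k$. The quantum cluster algebra is the $\mathbb{K}$-subalgebra of $D_q$ generated by all elements of all clusters obtained from the initial seed by finite sequences of mutations; it is contained in $T_q$. $Q_q$ is the quantum cluster algebra with initial seed $((w_0,\dots,w_n),B,\Lambda)$, where: $B$ is the adjacency matrix of the quiver $P_{n+1}^{(1)}$, i.e. $b_{ij}=1$ if $0\leq i\leq n-1$ and $j=i+1$, or $i=0$ and $j=n$; $b_{ij}=-1$ if $1\leq i\leq n$ and $j=i-1$, or $i=n$ and $j=0$; $b_{ij}=0$ otherwise; and $\lambda_{ij}=0$ if $i+j$ is even, $\lambda_{ij}=1$ if $i<j$ and $i+j$ is odd, $\lambda_{ij}=-1$ if $i>j$ and $i+j$ is odd. (Here $B^T\Lambda=2I_{n+1}$.) In $Q_q$, $w_{n+1}=w_0^{-1}(1+qw_1w_n)$ is the cluster variable obtained by mutating the initial seed at $w_0$, and, for $1\leq i\leq n$, $x_i=w_i^{-1}(q^{-\frac12}w_{i-1}+q^{\frac12}w_{i+1})$, which is a cluster variable. *)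

theory Defs
  imports
    "HOL-Computational_Algebra.Polynomial"
    "HOL-Library.Poly_Mapping"
begin

section \<open>The quantum torus and its division ring of fractions\<close>

text \<open>
  An exponent vector in $\mathbb{Z}^{n+1}$ is a finitely supported function \<open>a :: nat \<Rightarrow>\<^sub>0 int\<close> with
  \<open>keys a \<subseteq> {..n}\<close>. An element of the quantum torus is written in the basis of ordered monomials
  $w^a = w_0^{a_0} \cdots w_n^{a_n}$. Since $w_j w_i = q^{\lambda_{ji}} w_i w_j$, we have
  $w^a w^b = q^{\sum_{i<j} a_j b_i \lambda_{ji}} w^{a+b}$. The multiplication of the torus is
  \<open>torus_mult\<close>; it is not the untwisted convolution product that \<open>poly_mapping\<close> carries as a type
  class instance. The zero, the sum and the unit are those of \<open>poly_mapping\<close>.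
\<close>

definition torus_carrier :: "nat \<Rightarrow> ((nat \<Rightarrow>\<^sub>0 int) \<Rightarrow>\<^sub>0 'k::field) set" where
  "torus_carrier n = {f. \<forall>a\<in>Poly_Mapping.keys f. Poly_Mapping.keys a \<subseteq> {..n}}"

definition torus_twist ::
    "nat \<Rightarrow> (nat \<Rightarrow> nat \<Rightarrow> int) \<Rightarrow> (nat \<Rightarrow>\<^sub>0 int) \<Rightarrow> (nat \<Rightarrow>\<^sub>0 int) \<Rightarrow> int" where
  "torus_twist n L a b =
     (\<Sum>j\<le>n. \<Sum>i<j. Poly_Mapping.lookup a j * Poly_Mapping.lookup b i * L j i)"

definition torus_mult ::
    "nat \<Rightarrow> (nat \<Rightarrow> nat \<Rightarrow> int) \<Rightarrow> 'k::field \<Rightarrow>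
      ((nat \<Rightarrow>\<^sub>0 int) \<Rightarrow>\<^sub>0 'k) \<Rightarrow> ((nat \<Rightarrow>\<^sub>0 int) \<Rightarrow>\<^sub>0 'k) \<Rightarrow> ((nat \<Rightarrow>\<^sub>0 int) \<Rightarrow>\<^sub>0 'k)" where
  "torus_mult n L q f g =
     (\<Sum>a\<in>Poly_Mapping.keys f. \<Sum>b\<in>Poly_Mapping.keys g.
        Poly_Mapping.single (a + b)
          (Poly_Mapping.lookup f a * Poly_Mapping.lookup g b * q powi torus_twist n L a b))"

definition torus_const :: "'k::field \<Rightarrow> ((nat \<Rightarrow>\<^sub>0 int) \<Rightarrow>\<^sub>0 'k)" where
  "torus_const c = Poly_Mapping.single 0 c"

definition torus_gen :: "nat \<Rightarrow> ((nat \<Rightarrow>\<^sub>0 int) \<Rightarrow>\<^sub>0 'k::field)" where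
  "torus_gen i = Poly_Mapping.single (Poly_Mapping.single i 1) 1"

text \<open>
  The division ring of fractions is determined by the torus up to unique isomorphism. We
  take it to be any type \<open>'d\<close> of class \<^class>\<open>division_ring\<close> together with an embedding \<open>h\<close> of the torus
  such that every element of \<open>'d\<close> is a fraction. The values of \<open>h\<close> outside the carrier are irrelevant.
\<close>

locale torus_fractions =
  fixes n :: nat and L :: "nat \<Rightarrow> nat \<Rightarrow> int" and q :: "'k::field"
    and h :: "((nat \<Rightarrow>\<^sub>0 int) \<Rightarrow>\<^sub>0 'k) \<Rightarrow> 'd::division_ring"
  assumes h_one: "h 1 = 1"
    and h_add: "\<lbrakk>f \<in> torus_carrier n; g \<in> torus_carrier n\<rbrakk> \<Longrightarrow> h (f + g) = h f + h g"
    and h_mult: "\<lbrakk>f \<in> torus_carrier n; g \<in> torus_carrier n\<rbrakk> \<Longrightarrow> h (torus_mult n L q f g) = h f * h g"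
    and h_inj: "inj_on h (torus_carrier n)"
    and fraction: "\<exists>f\<in>torus_carrier n. \<exists>g\<in>torus_carrier n - {0}. d = h f * inverse (h g)"

text \<open>
  In what follows \<open>\<iota> :: 'k \<Rightarrow> 'd\<close> is the structure map of the \<open>'k\<close>-algebra \<open>'d\<close>. Closure of a
  subalgebra under negation and scalar multiplication comes from the first conjunct.
\<close>

definition subalgebra :: "('k::field \<Rightarrow> 'd::ring_1) \<Rightarrow> 'd set \<Rightarrow> bool" where
  "subalgebra \<iota> A \<longleftrightarrow>
     range \<iota> \<subseteq> A \<and> (\<forall>x\<in>A. \<forall>y\<in>A. x + y \<in> A) \<and> (\<forall>x\<in>A. \<forall>y\<in>A. x * y \<in> A)"

abbreviation generated_subalgebra :: "('k::field \<Rightarrow> 'd::ring_1) \<Rightarrow> 'd set \<Rightarrow> 'd set" where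
  "generated_subalgebra \<iota> S \<equiv> subalgebra \<iota> hull S"


section \<open>Quantum seeds, mutation and quantum cluster algebras\<close>

text \<open>All indices of a seed range over \<open>{..n}\<close>; entries outside this range play no role.\<close>

record 'd quantum_seed =
  cluster :: "nat \<Rightarrow> 'd"
  exch :: "nat \<Rightarrow> nat \<Rightarrow> int"
  quasi :: "nat \<Rightarrow> nat \<Rightarrow> int"

text \<open>
  Throughout, \<open>s\<close> is the fixed square root of $q$. The list product is taken in increasing order of indices.
\<close>

definition seed_monomial ::
    "nat \<Rightarrow> ('k::field \<Rightarrow> 'd::division_ring) \<Rightarrow> 'k \<Rightarrow> 'd quantum_seed \<Rightarrow> (nat \<Rightarrow> int) \<Rightarrow> 'd" where
  "seed_monomial n \<iota> s S c =
     \<iota> (s powi (- (\<Sum>j\<le>n. \<Sum>i<j. c i * c j * quasi S i j))) *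
     prod_list (map (\<lambda>i. cluster S i powi c i) [0..<Suc n])"

definition unit_vec :: "nat \<Rightarrow> nat \<Rightarrow> int" where
  "unit_vec k j = (if j = k then 1 else 0)"

definition mutate_cluster ::
    "nat \<Rightarrow> ('k::field \<Rightarrow> 'd::division_ring) \<Rightarrow> 'k \<Rightarrow> nat \<Rightarrow> 'd quantum_seed \<Rightarrow> nat \<Rightarrow> 'd" where
  "mutate_cluster n \<iota> s k S =
     (cluster S)(k :=
        seed_monomial n \<iota> s S (\<lambda>j. - unit_vec k j + (\<Sum>i\<le>n. max (exch S i k) 0 * unit_vec i j)) +
        seed_monomial n \<iota> s S (\<lambda>j. - unit_vec k j + (\<Sum>i\<le>n. max (- exch S i k) 0 * unit_vec i j)))"

definition mutate_exch :: "nat \<Rightarrow> (nat \<Rightarrow> nat \<Rightarrow> int) \<Rightarrow> nat \<Rightarrow> nat \<Rightarrow> int" where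
  "mutate_exch k B i j =
     (if i = k \<or> j = k then - B i j
      else B i j + max (B i k) 0 * max (B k j) 0 - max (- B i k) 0 * max (- B k j) 0)"

definition mutation_matrix :: "nat \<Rightarrow> (nat \<Rightarrow> nat \<Rightarrow> int) \<Rightarrow> nat \<Rightarrow> nat \<Rightarrow> int" where
  "mutation_matrix k B i j =
     (if j = k then (if i = k then -1 else max (- B i k) 0) else if i = j then 1 else 0)"

definition mutate_quasi ::
    "nat \<Rightarrow> nat \<Rightarrow> (nat \<Rightarrow> nat \<Rightarrow> int) \<Rightarrow> (nat \<Rightarrow> nat \<Rightarrow> int) \<Rightarrow> nat \<Rightarrow> nat \<Rightarrow> int" where
  "mutate_quasi n k B L i j =
     (\<Sum>a\<le>n. \<Sum>b\<le>n. mutation_matrix k B a i * L a b * mutation_matrix k B b j)"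

definition mutate ::
    "nat \<Rightarrow> ('k::field \<Rightarrow> 'd::division_ring) \<Rightarrow> 'k \<Rightarrow> nat \<Rightarrow> 'd quantum_seed \<Rightarrow> 'd quantum_seed" where
  "mutate n \<iota> s k S =
     \<lparr>cluster = mutate_cluster n \<iota> s k S,
      exch = mutate_exch k (exch S),
      quasi = mutate_quasi n k (exch S) (quasi S)\<rparr>"

inductive_set mutation_class ::
    "nat \<Rightarrow> ('k::field \<Rightarrow> 'd::division_ring) \<Rightarrow> 'k \<Rightarrow> 'd quantum_seed \<Rightarrow> 'd quantum_seed set"
  for n \<iota> s S0 where
  initial: "S0 \<in> mutation_class n \<iota> s S0"
| step: "\<lbrakk>S \<in> mutation_class n \<iota> s S0; k \<le> n\<rbrakk> \<Longrightarrow> mutate n \<iota> s k S \<in> mutation_class n \<iota> s S0"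

definition cluster_variables ::
    "nat \<Rightarrow> ('k::field \<Rightarrow> 'd::division_ring) \<Rightarrow> 'k \<Rightarrow> 'd quantum_seed \<Rightarrow> 'd set" where
  "cluster_variables n \<iota> s S0 = {cluster S i |S i. S \<in> mutation_class n \<iota> s S0 \<and> i \<le> n}"

definition quantum_cluster_algebra ::
    "nat \<Rightarrow> ('k::field \<Rightarrow> 'd::division_ring) \<Rightarrow> 'k \<Rightarrow> 'd quantum_seed \<Rightarrow> 'd set" where
  "quantum_cluster_algebra n \<iota> s S0 = generated_subalgebra \<iota> (cluster_variables n \<iota> s S0)"


section \<open>The quiver $P_{n+1}^{(1)}$\<close>

definition P_exch :: "nat \<Rightarrow> nat \<Rightarrow> nat \<Rightarrow> int" where
  "P_exch n i j =
     (if (i < n \<and> j = i + 1) \<or> (i = 0 \<and> j = n) then 1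
      else if (1 \<le> i \<and> i \<le> n \<and> i = j + 1) \<or> (i = n \<and> j = 0) then -1
      else 0)"

definition P_quasi :: "nat \<Rightarrow> nat \<Rightarrow> int" where
  "P_quasi i j = (if even (i + j) then 0 else if i < j then 1 else -1)"

context
  fixes h :: "((nat \<Rightarrow>\<^sub>0 int) \<Rightarrow>\<^sub>0 'k::field) \<Rightarrow> 'd::division_ring" and n :: nat
begin

definition scal :: "'k \<Rightarrow> 'd" where
  "scal c = h (torus_const c)"

definition P_initial_seed :: "'d quantum_seed" where
  "P_initial_seed = \<lparr>cluster = (\<lambda>i. h (torus_gen i)), exch = P_exch n, quasi = P_quasi\<rparr>"

definition P_cluster_algebra :: "'k \<Rightarrow> 'd set" where
  "P_cluster_algebra s = quantum_cluster_algebra n scal s P_initial_seed"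

text \<open>
  \<open>w_elem q (n + 1)\<close> is the cluster variable obtained by mutating the initial seed at \<open>0\<close>. It
  enters \<open>x_elem q s i\<close> for \<open>i = n\<close>; the elements $x_i$ are meant for \<open>1 \<le> i \<le> n\<close>.
\<close>

definition w_elem :: "'k \<Rightarrow> nat \<Rightarrow> 'd" where
  "w_elem q i =
     (if i = n + 1
      then inverse (h (torus_gen 0)) * (1 + scal q * h (torus_gen 1) * h (torus_gen n))
      else h (torus_gen i))"

definition x_elem :: "'k \<Rightarrow> 'k \<Rightarrow> nat \<Rightarrow> 'd" where
  "x_elem q s i =
     inverse (w_elem q i) * (scal (inverse s) * w_elem q (i - 1) + scal s * w_elem q (i + 1))"

end

end

(*
  The quiver is of affine type: the cluster variables are the arcs of an annulus with n marked points
  on the outer and one on the inner boundary, and the seeds are its triangulations. The bridging arcs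
  form a sequence w_i (i an integer) with w_i w_(i+n+1) = 1 + q w_(i+1) w_(i+n), for which
  x_i = w_i^(-1) (q^(-1/2) w_(i-1) + q^(1/2) w_(i+1)) is periodic in i with period n. The other arcs P(i,k)
  satisfy a three term recursion in k with coefficients x_k. So all arcs lie in every subalgebra that
  contains w_0, w_1 and x_1, ..., x_n, and w_0 is a combination of x_1 w_1 and w_1 x_1, as q is not a
  root of unity.

  That mutations of seeds are flips follows from the Ptolemy relations: the condition B^T Lambda = 2 I
  determines the exchange matrix from the quasi-commutation exponents, so that it suffices to
  check a linear identity between the exponents of the four sides of the flipped quadrilateral.
*)
theory Submission
  imports Defs
begin

section \<open>Quantum tori over a noncommutative division ring\<close>

text \<open>Divided by \<open>w i\<close> and \<open>w k\<close>, the arc \<open>P i k\<close>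
  becomes the sum \<open>U i k\<close> of the horocyclic lengths \<open>u m\<close> at the inner
  marked point, as for Penner's lambda lengths. Lengths of adjacent intervals add up, so for three
  of them, A, B, C, the Ptolemy relation is (A + B)(B + C) = AC + (A + B + C)B with powers of q
  inserted. This view from one lift of the inner point misses the quadrilateral that touches the
  inner boundary; its relation \<open>ptolemy_inner\<close> comes from the exchange relation by
  induction. The vector e_p - e_(r-1) behind \<open>lam\<close> is the exponent of the summand m = r
  - 1 of \<open>P p r\<close>: sums that quasi-commute do so with the exponent of their leading
  monomials. The obstacle is the cut. Two bridging arcs bound the triangle on the inner boundary and
  are sides of the cut polygon. Flipping any other arc leaves the cut alone, but flipping one of
  these two moves it and changes the indices of the arcs. Hence a labelled seed carries a base point
  a besides its labels, and \<open>lam\<close> must be shown invariant under the change of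
  indices.\<close>

locale central_scalars =
  fixes \<iota> :: "'k::field \<Rightarrow> 'd::division_ring" and s :: 'k
  assumes iota_one: "\<iota> 1 = 1"
    and iota_add: "\<iota> (x + y) = \<iota> x + \<iota> y"
    and iota_mult: "\<iota> (x * y) = \<iota> x * \<iota> y"
    and iota_central: "\<iota> x * d = d * \<iota> x"
    and s_nonzero: "s \<noteq> 0"
    and s_powi_eq_1: "s powi m = 1 \<Longrightarrow> m = 0"
begin

text \<open>Exponents count powers of $q^{1/2}$.\<close>

definition sp :: "int \<Rightarrow> 'd" where "sp m = \<iota> (s powi m)"

lemma iota_zero: "\<iota> 0 = 0"
  using iota_add[of 0 0] by simp

lemma sp_0 [simp]: "sp 0 = 1"
  by (simp add: sp_def iota_one)

lemma sp_mult: "sp a * sp b = sp (a + b)"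
  by (simp add: sp_def power_int_add s_nonzero iota_mult)

lemma sp_mult_left: "sp a * (sp b * d) = sp (a + b) * d"
  by (simp add: sp_mult mult.assoc[symmetric])

lemma sp_central: "d * sp a = sp a * d"
  by (simp add: sp_def iota_central)

lemma sp_left_commute: "d * (sp a * e) = sp a * (d * e)"
  by (metis mult.assoc sp_central)

text \<open>\<open>NO_MATCH\<close> keeps the simplifier from swapping two scalars forever;
  \<open>sp_norm\<close> thus gathers all scalars of a product at its left end under one
  exponent.\<close>

lemma sp_pull:
  "NO_MATCH (sp b) d \<Longrightarrow> d * sp a = sp a * d"
  "NO_MATCH (sp b) d \<Longrightarrow> d * (sp a * e) = sp a * (d * e)"
  by (rule sp_central, rule sp_left_commute)

lemmas sp_norm = mult.assoc sp_mult sp_mult_left sp_pull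

lemma sp_nonzero [simp]: "sp a \<noteq> 0"
  by (metis sp_0 sp_mult add.right_inverse mult_zero_left zero_neq_one)

text \<open>Ring homomorphisms from a field to a nonzero ring are injective: a nonzero s^a - 1 would
  be a unit sent to 0.\<close>

lemma sp_eq_1: "sp a = 1 \<Longrightarrow> a = 0"
proof -
  assume *: "sp a = 1"
  have "\<iota> (s powi a - 1) = 0"
    using iota_add[of "s powi a - 1" 1] * by (simp add: sp_def iota_one)
  then have "s powi a - 1 = 0"
    using iota_mult[of "s powi a - 1" "inverse (s powi a - 1)"]
    by (metis iota_one mult_zero_left right_inverse zero_neq_one)
  then show "a = 0" using s_powi_eq_1 by simp
qed

lemma sp_cancel: "sp a * x = sp b * y \<longleftrightarrow> x = sp (b - a) * y"
proof
  assume "sp a * x = sp b * y"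
  then have "sp (-a) * (sp a * x) = sp (-a) * (sp b * y)" by simp
  then show "x = sp (b - a) * y" by (simp add: sp_mult_left)
qed (simp add: sp_mult_left)

lemma sp_inject: "sp a = sp b \<longleftrightarrow> a = b"
  using sp_cancel[of b 1 a 1] sp_eq_1[of "a - b"] by auto

lemma sp_inverse_swap:
  assumes "x * y = sp e * (y * x)" "x \<noteq> 0"
  shows "inverse x * y = sp (- e) * (y * inverse x)"
proof -
  have "inverse x * (x * y) * inverse x = sp e * (inverse x * y)"
    unfolding assms(1) using assms(2) by (simp add: sp_norm)
  then have "y * inverse x = sp e * (inverse x * y)"
    using assms(2) by (simp add: mult.assoc[symmetric])
  then show ?thesis by (simp add: sp_mult_left)
qed

lemma sp_swap_sym: "x * y = sp e * (y * x) \<Longrightarrow> y * x = sp (- e) * (x * y)"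
  by (simp add: sp_mult_left)

lemma sp_swap_left: "x * y = sp e * (y * x) \<Longrightarrow> x * (y * z) = sp e * (y * (x * z))"
  by (metis mult.assoc)

lemma sp_swap_mult:
  assumes "x * y = sp e * (y * x)" "x * z = sp f * (z * x)"
  shows "x * (y * z) = sp (e + f) * (y * z * x)"
proof -
  have "x * (y * z) = sp e * (y * (x * z))" using assms(1) by (metis mult.assoc)
  also have "\<dots> = sp e * (sp f * (y * (z * x)))" by (simp add: assms(2) sp_norm)
  finally show ?thesis by (simp add: sp_norm)
qed

lemma sp_swap_power:
  assumes "x * y = sp e * (y * x)"
  shows "x * y ^ m = sp (int m * e) * (y ^ m * x)"
proof (induction m)
  case (Suc m)
  show ?case
    using sp_swap_mult[OF assms Suc] by (simp add: algebra_simps)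
qed simp

lemma sp_swap_powi:
  assumes "x * y = sp e * (y * x)" "y \<noteq> 0"
  shows "x * y powi m = sp (m * e) * (y powi m * x)"
proof (cases "m \<ge> 0")
  case True
  then show ?thesis using sp_swap_power[OF assms(1), of "nat m"] by (simp add: power_int_def)
next
  case False
  have "x * inverse y = sp (- e) * (inverse y * x)"
    using sp_inverse_swap[OF sp_swap_sym[OF assms(1)] assms(2)]
    by (simp add: sp_mult_left)
  from sp_swap_power[OF this, of "nat (- m)"] False
  show ?thesis by (simp add: power_int_def)
qed

lemma sp_swap_powi2:
  assumes "x * y = sp e * (y * x)" "x \<noteq> 0" "y \<noteq> 0"
  shows "x powi a * y powi b = sp (a * b * e) * (y powi b * x powi a)"
proof -
  have "y powi b * x = sp (- (b * e)) * (x * y powi b)"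
    using sp_swap_sym[OF sp_swap_powi[OF assms(1,3), of b]] by simp
  from sp_swap_sym[OF sp_swap_powi[OF this assms(2), of a]]
  show ?thesis by (simp add: algebra_simps)
qed

end

locale quantum_seeds = central_scalars \<iota> s
  for \<iota> :: "'k::field \<Rightarrow> 'd::division_ring" and s :: 'k +
  fixes n :: nat
begin

definition pairing :: "'d quantum_seed \<Rightarrow> (nat \<Rightarrow> int) \<Rightarrow> (nat \<Rightarrow> int) \<Rightarrow> int" where
  "pairing S c d = (\<Sum>i\<le>n. \<Sum>j\<le>n. c i * d j * quasi S i j)"

definition quasi_commuting :: "'d quantum_seed \<Rightarrow> bool" where
  "quasi_commuting S \<longleftrightarrow>
     (\<forall>i\<le>n. cluster S i \<noteq> 0) \<and>
     (\<forall>i\<le>n. \<forall>j\<le>n. cluster S i * cluster S j = sp (2 * quasi S i j) * (cluster S j * cluster S i)) \<and>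
     (\<forall>i\<le>n. \<forall>j\<le>n. quasi S i j = - quasi S j i)"

definition compatible :: "'d quantum_seed \<Rightarrow> bool" where
  "compatible S \<longleftrightarrow>
     quasi_commuting S \<and>
     (\<forall>i\<le>n. \<forall>j\<le>n. exch S i j = - exch S j i) \<and>
     (\<forall>i\<le>n. \<forall>j\<le>n. (\<Sum>m\<le>n. exch S m i * quasi S m j) = (if i = j then 2 else 0))"

lemma quasi_commutingD:
  assumes "quasi_commuting S" "i \<le> n"
  shows "cluster S i \<noteq> 0"
    and "j \<le> n \<Longrightarrow> cluster S i * cluster S j = sp (2 * quasi S i j) * (cluster S j * cluster S i)"
    and "j \<le> n \<Longrightarrow> quasi S i j = - quasi S j i"
  using assms unfolding quasi_commuting_def by blast+

abbreviation monomial where "monomial S \<equiv> seed_monomial n \<iota> s S"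

text \<open>Partial ordered products, so that reordering can be done by induction on the number of
  factors.\<close>

definition prefix :: "'d quantum_seed \<Rightarrow> nat \<Rightarrow> (nat \<Rightarrow> int) \<Rightarrow> 'd" where
  "prefix S m c = prod_list (map (\<lambda>i. cluster S i powi c i) [0..<m])"

lemma prefix_simps [simp]:
  "prefix S 0 c = 1"
  "prefix S (Suc m) c = prefix S m c * cluster S m powi c m"
  by (simp_all add: prefix_def)

lemma monomial_eq:
  "monomial S c = sp (- (\<Sum>j\<le>n. \<Sum>i<j. c i * c j * quasi S i j)) * prefix S (Suc n) c"
  unfolding seed_monomial_def sp_def prefix_def ..

lemma pairing_add:
  "pairing S (\<lambda>i. c i + c' i) d = pairing S c d + pairing S c' d"
  "pairing S c (\<lambda>i. d i + d' i) = pairing S c d + pairing S c d'"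
  "pairing S (\<lambda>i. - c i) d = - pairing S c d"
  "pairing S c (\<lambda>i. - d i) = - pairing S c d"
  by (simp_all add: pairing_def algebra_simps sum.distrib sum_negf)

lemma pairing_unit_right: "k \<le> n \<Longrightarrow> pairing S c (unit_vec k) = (\<Sum>i\<le>n. c i * quasi S i k)"
proof -
  have "c i * unit_vec k j * quasi S i j = (if j = k then c i * quasi S i j else 0)" for i j
    by (simp add: unit_vec_def)
  then show "k \<le> n \<Longrightarrow> ?thesis" by (simp add: pairing_def)
qed

lemma pairing_unit_left: "k \<le> n \<Longrightarrow> pairing S (unit_vec k) d = (\<Sum>j\<le>n. d j * quasi S k j)"
proof -
  have "unit_vec k i * d j * quasi S i j = (if i = k then d j * quasi S i j else 0)" for i j
    by (simp add: unit_vec_def)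
  then show "k \<le> n \<Longrightarrow> ?thesis" unfolding pairing_def by (subst sum.swap) simp
qed

lemma pairing_skew:
  assumes "quasi_commuting S"
  shows "pairing S c d = - pairing S d c"
proof -
  have "pairing S c d = (\<Sum>j\<le>n. \<Sum>i\<le>n. c i * d j * quasi S i j)"
    unfolding pairing_def by (rule sum.swap)
  also have "\<dots> = (\<Sum>j\<le>n. \<Sum>i\<le>n. - (d j * c i * quasi S j i))"
  proof (intro sum.cong refl)
    fix i j assume "j \<in> {..n}" "i \<in> {..n}"
    then have "quasi S i j = - quasi S j i" using assms unfolding quasi_commuting_def by blast
    then show "c i * d j * quasi S i j = - (d j * c i * quasi S j i)" by simp
  qed
  finally show ?thesis by (simp add: sum_negf pairing_def)
qed

lemma monomial_cong: "(\<And>i. i \<le> n \<Longrightarrow> c i = d i) \<Longrightarrow> monomial S c = monomial S d"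
  unfolding seed_monomial_def
  by (intro arg_cong2[where f="(*)"] arg_cong[where f=\<iota>] arg_cong[where f="\<lambda>m. s powi m"]
      arg_cong[where f=uminus] sum.cong refl arg_cong[where f=prod_list] map_cong) auto

lemma monomial_zero [simp]: "monomial S (\<lambda>_. 0) = 1"
proof -
  have "prefix S m (\<lambda>_. 0) = 1" for m by (induction m) auto
  then show ?thesis by (simp add: monomial_eq del: prefix_simps)
qed

lemma prefix_unit: "k < m \<Longrightarrow> prefix S m (unit_vec k) = cluster S k"
proof (induction m)
  case (Suc m)
  have "j \<le> m \<Longrightarrow> prefix S j (unit_vec m) = 1" for j
    by (induction j) (auto simp: unit_vec_def)
  moreover have "unit_vec k m = (if k = m then 1 else 0)" by (auto simp: unit_vec_def)
  ultimately show ?case using Suc by (cases "k = m") auto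
qed simp

lemma monomial_unit: "k \<le> n \<Longrightarrow> monomial S (unit_vec k) = cluster S k"
proof -
  assume "k \<le> n"
  have "(\<Sum>j\<le>n. \<Sum>i<j. unit_vec k i * unit_vec k j * quasi S i j) = 0"
    by (intro sum.neutral ballI) (auto simp: unit_vec_def)
  then show ?thesis using prefix_unit[of k "Suc n" S] \<open>k \<le> n\<close>
    by (simp add: monomial_eq del: prefix_simps)
qed

lemma sum_triangle_split:
  fixes f :: "nat \<Rightarrow> nat \<Rightarrow> int"
  assumes "\<And>i. i \<le> n \<Longrightarrow> f i i = 0"
  shows "(\<Sum>i\<le>n. \<Sum>j\<le>n. f i j) = (\<Sum>j\<le>n. \<Sum>i<j. f i j + f j i)"
  using assms
proof (induction n)
  case (Suc n)
  have "(\<Sum>i\<le>Suc n. \<Sum>j\<le>Suc n. f i j) = (\<Sum>i\<le>n. \<Sum>j\<le>n. f i j) + (\<Sum>i\<le>n. f i (Suc n)) + (\<Sum>j\<le>n. f (Suc n) j)"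
    using Suc.prems[of "Suc n"] by (simp add: sum.distrib)
  then show ?case using Suc by (simp add: sum.distrib lessThan_Suc_atMost)
qed auto

lemma prefix_swap:
  assumes "quasi_commuting S" "j \<le> n" "m \<le> Suc n"
  shows "prefix S m c * cluster S j powi a = sp (\<Sum>i<m. 2 * c i * a * quasi S i j) * (cluster S j powi a * prefix S m c)"
  using assms(3)
proof (induction m)
  case (Suc m)
  let ?x = "cluster S m powi c m" and ?y = "cluster S j powi a"
  let ?e = "\<Sum>i<m. 2 * c i * a * quasi S i j"
  have m: "m \<le> n" using Suc.prems by simp
  have "c m * a * (2 * quasi S m j) = 2 * c m * a * quasi S m j" by simp
  with sp_swap_powi2[OF quasi_commutingD(2)[OF assms(1) m assms(2)] quasi_commutingD(1)[OF assms(1) m]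
      quasi_commutingD(1)[OF assms(1,2)], of "c m" a]
  have 1: "?x * ?y = sp (2 * c m * a * quasi S m j) * (?y * ?x)" by metis
  have "prefix S (Suc m) c * ?y = prefix S m c * (?x * ?y)" by (simp add: mult.assoc)
  also have "\<dots> = sp (2 * c m * a * quasi S m j) * (prefix S m c * ?y * ?x)"
    unfolding 1 by (simp add: sp_norm)
  also have "\<dots> = sp (2 * c m * a * quasi S m j) * (sp ?e * (?y * prefix S m c * ?x))"
    using Suc by (simp add: mult.assoc)
  also have "\<dots> = sp (2 * c m * a * quasi S m j + ?e) * (?y * prefix S (Suc m) c)"
    by (simp add: sp_norm)
  finally show ?case by (simp add: add.commute)
qed simp

text \<open>The induction step moves the factor \<open>cluster S m powi c m\<close> to the right
  through the first m factors of the second product, which is \<open>prefix_swap\<close>.\<close>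

lemma prefix_mult:
  assumes "quasi_commuting S" "m \<le> Suc n"
  shows "prefix S m c * prefix S m d =
    sp (\<Sum>j<m. \<Sum>i<j. - 2 * d i * c j * quasi S i j) * prefix S m (\<lambda>i. c i + d i)"
  using assms(2)
proof (induction m)
  case (Suc m)
  let ?e = "\<Sum>i<m. - 2 * d i * c m * quasi S i m"
  have nz: "cluster S m \<noteq> 0" using quasi_commutingD(1)[OF assms(1)] Suc.prems by simp
  have "cluster S m powi c m * prefix S m d = sp ?e * (prefix S m d * cluster S m powi c m)"
    using sp_swap_sym[OF prefix_swap[OF assms(1), of m m d "c m"]] Suc.prems
    by (simp add: sum_negf)
  note * = sp_swap_left[OF this]
  have "prefix S (Suc m) c * prefix S (Suc m) d =
      sp ?e * (prefix S m c * prefix S m d * (cluster S m powi c m * cluster S m powi d m))"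
    by (simp add: * sp_norm)
  also have "cluster S m powi c m * cluster S m powi d m = cluster S m powi (c m + d m)"
    using nz by (simp add: power_int_add)
  finally show ?case using Suc by (simp add: mult.assoc sp_mult_left add.commute)
qed simp

text \<open>The power of q in \<open>seed_monomial\<close> is chosen to symmetrise the reordering
  cost of \<open>prefix_mult\<close>: what remains is the full skew form. All exchange relations
  below are computed from this identity.\<close>

lemma monomial_mult:
  assumes "quasi_commuting S"
  shows "monomial S c * monomial S d = sp (pairing S c d) * monomial S (\<lambda>i. c i + d i)"
proof -
  let ?t = "\<lambda>f. \<Sum>j\<le>n. \<Sum>i<j. f i j :: int"
  let ?L = "quasi S"
  have sk: "?L i i = 0" if "i \<le> n" for i
    using quasi_commutingD(3)[OF assms that that] by linarith
  have sk2: "?L j i = - ?L i j" if "i < j" "j \<le> n" for i j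
    using quasi_commutingD(3)[OF assms, of j i] that by simp
  have "pairing S c d = ?t (\<lambda>i j. c i * d j * ?L i j + c j * d i * ?L j i)"
    unfolding pairing_def by (rule sum_triangle_split) (simp add: sk)
  also have "\<dots> = ?t (\<lambda>i j. c i * d j * ?L i j - c j * d i * ?L i j)"
    by (intro sum.cong refl) (simp add: sk2)
  finally have p: "pairing S c d = ?t (\<lambda>i j. c i * d j * ?L i j - c j * d i * ?L i j)" .
  have e: "- ?t (\<lambda>i j. c i * c j * ?L i j) - ?t (\<lambda>i j. d i * d j * ?L i j) + ?t (\<lambda>i j. - 2 * d i * c j * ?L i j)
     = pairing S c d - ?t (\<lambda>i j. (c i + d i) * (c j + d j) * ?L i j)"
    unfolding p sum_negf[symmetric] sum.distrib[symmetric] sum_subtractf[symmetric]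
    by (intro sum.cong refl) (simp add: algebra_simps)
  have "monomial S c * monomial S d =
     sp (- ?t (\<lambda>i j. c i * c j * ?L i j) - ?t (\<lambda>i j. d i * d j * ?L i j)) * (prefix S (Suc n) c * prefix S (Suc n) d)"
    unfolding monomial_eq by (simp add: sp_norm del: prefix_simps)
  also have "\<dots> = sp (pairing S c d) * monomial S (\<lambda>i. c i + d i)"
    unfolding prefix_mult[OF assms order.refl] lessThan_Suc_atMost monomial_eq sp_mult_left e
    by (simp only: add_uminus_conv_diff)
  finally show ?thesis .
qed

lemma monomial_swap:
  assumes "quasi_commuting S"
  shows "monomial S c * monomial S d = sp (2 * pairing S c d) * (monomial S d * monomial S c)"
  using monomial_mult[OF assms, of c d] monomial_mult[OF assms, of d c] pairing_skew[OF assms, of d c]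
  by (simp add: sp_mult_left add.commute)

lemma monomial_nonzero:
  assumes "quasi_commuting S"
  shows "monomial S c \<noteq> 0"
  using monomial_mult[OF assms, of c "\<lambda>i. - c i"] sp_nonzero by auto

end

section \<open>Mutation of compatible seeds\<close>

context quantum_seeds
begin

lemma compatibleD:
  assumes "compatible S"
  shows "quasi_commuting S"
    and "\<lbrakk>i \<le> n; j \<le> n\<rbrakk> \<Longrightarrow> exch S i j = - exch S j i"
    and "\<lbrakk>i \<le> n; j \<le> n\<rbrakk> \<Longrightarrow> (\<Sum>m\<le>n. exch S m i * quasi S m j) = (if i = j then 2 else 0)"
  using assms unfolding compatible_def by blast+

lemma exch_diagonal: "compatible S \<Longrightarrow> i \<le> n \<Longrightarrow> exch S i i = 0"
  using compatibleD(2)[of S i i] by simp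

lemma sum_unit_vec: "j \<le> n \<Longrightarrow> (\<Sum>i\<le>n. unit_vec j i * f i) = f j"
proof -
  have "unit_vec j i * f i = (if i = j then f i else 0)" for i by (simp add: unit_vec_def)
  then show "j \<le> n \<Longrightarrow> ?thesis" by simp
qed

text \<open>Compatibility makes Lambda invertible. If d is the difference of two candidates for
  column k, then d Lambda = 0; as Lambda is skew, Lambda B = -2 I, whence -2 d = 0. A column of B
  can therefore be recognised by its pairings alone, without following matrix mutation.\<close>

lemma exch_column_unique:
  assumes S: "compatible S" and "k \<le> n" "m \<le> n"
    and c: "\<And>j. j \<le> n \<Longrightarrow> (\<Sum>i\<le>n. c i * quasi S i j) = (if j = k then 2 else 0)"
  shows "exch S m k = c m"
proof -
  let ?B = "exch S" and ?L = "quasi S"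
  let ?d = "\<lambda>i. c i - ?B i k"
  have "(\<Sum>j\<le>n. (\<Sum>i\<le>n. ?d i * ?L i j) * ?B j m) = 0"
  proof (intro sum.neutral ballI)
    fix j assume "j \<in> {..n}"
    then have "(\<Sum>i\<le>n. ?d i * ?L i j) = 0"
      using c[of j] compatibleD(3)[OF S \<open>k \<le> n\<close>, of j] by (simp add: left_diff_distrib sum_subtractf)
    then show "(\<Sum>i\<le>n. ?d i * ?L i j) * ?B j m = 0" by simp
  qed
  also have "(\<Sum>j\<le>n. (\<Sum>i\<le>n. ?d i * ?L i j) * ?B j m) = (\<Sum>i\<le>n. \<Sum>j\<le>n. ?d i * ?L i j * ?B j m)"
    unfolding sum_distrib_right by (rule sum.swap)
  also have "\<dots> = (\<Sum>i\<le>n. if i = m then - 2 * ?d i else 0)"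
  proof (intro sum.cong refl)
    fix i assume i: "i \<in> {..n}"
    have "(\<Sum>j\<le>n. ?d i * ?L i j * ?B j m) = (\<Sum>j\<le>n. - ?d i * (?B j m * ?L j i))"
    proof (intro sum.cong refl)
      fix j assume "j \<in> {..n}"
      then have "?L i j = - ?L j i"
        using quasi_commutingD(3)[OF compatibleD(1)[OF S], of i j] i by auto
      then show "?d i * ?L i j * ?B j m = - ?d i * (?B j m * ?L j i)" by (simp add: algebra_simps)
    qed
    also have "\<dots> = - ?d i * (\<Sum>j\<le>n. ?B j m * ?L j i)" by (rule sum_distrib_left[symmetric])
    also have "\<dots> = (if i = m then - 2 * ?d i else 0)"
      using compatibleD(3)[OF S \<open>m \<le> n\<close>, of i] i by auto
    finally show "(\<Sum>j\<le>n. ?d i * ?L i j * ?B j m) = (if i = m then - 2 * ?d i else 0)" .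
  qed
  finally show ?thesis using \<open>m \<le> n\<close> by simp
qed

definition pos_part :: "'d quantum_seed \<Rightarrow> nat \<Rightarrow> nat \<Rightarrow> int" where
  "pos_part S k j = max (exch S j k) 0"

definition neg_part :: "'d quantum_seed \<Rightarrow> nat \<Rightarrow> nat \<Rightarrow> int" where
  "neg_part S k j = max (- exch S j k) 0"

lemma pos_part_minus_neg_part: "pos_part S k j - neg_part S k j = exch S j k"
  by (auto simp: pos_part_def neg_part_def)

lemma mutated_variable:
  "cluster (mutate n \<iota> s k S) k =
     monomial S (\<lambda>j. - unit_vec k j + pos_part S k j) + monomial S (\<lambda>j. - unit_vec k j + neg_part S k j)"
proof -
  have "(\<Sum>i\<le>n. f i * unit_vec i j) = f j" if "j \<le> n" for f :: "nat \<Rightarrow> int" and j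
  proof -
    have "f i * unit_vec i j = (if i = j then f i else 0)" for i by (simp add: unit_vec_def)
    with that show ?thesis by simp
  qed
  then show ?thesis
    by (simp add: mutate_def mutate_cluster_def pos_part_def neg_part_def cong: monomial_cong)
qed

lemma mutate_other: "i \<noteq> k \<Longrightarrow> cluster (mutate n \<iota> s k S) i = cluster S i"
  by (simp add: mutate_def mutate_cluster_def)

lemma pairing_exch:
  assumes "compatible S" "k \<le> n" "j \<le> n"
  shows "pairing S (pos_part S k) (unit_vec j) - pairing S (neg_part S k) (unit_vec j) = (if j = k then 2 else 0)"
  using compatibleD(3)[OF assms] assms
  by (simp add: pairing_unit_right sum_subtractf[symmetric] left_diff_distrib[symmetric] pos_part_minus_neg_part)

lemma monomial_times_unit:
  assumes "quasi_commuting S" "k \<le> n"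
  shows "cluster S k * monomial S (\<lambda>j. - unit_vec k j + c j) = sp (pairing S (unit_vec k) c) * monomial S c"
    and "monomial S (\<lambda>j. - unit_vec k j + c j) * cluster S k = sp (- pairing S (unit_vec k) c) * monomial S c"
proof -
  have 0: "pairing S (unit_vec k) (unit_vec k) = 0"
    using pairing_skew[OF assms(1), of "unit_vec k" "unit_vec k"] by linarith
  have 1: "pairing S (unit_vec k) (\<lambda>j. - unit_vec k j + c j) = pairing S (unit_vec k) c"
    by (simp only: pairing_add 0 minus_zero add_0)
  have 1: "pairing S (unit_vec k) (\<lambda>j. c j - unit_vec k j) = pairing S (unit_vec k) c"
    using 1 by simp
  show "cluster S k * monomial S (\<lambda>j. - unit_vec k j + c j) = sp (pairing S (unit_vec k) c) * monomial S c"
    using monomial_mult[OF assms(1), of "unit_vec k" "\<lambda>j. - unit_vec k j + c j"] assms(2)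
    by (simp add: monomial_unit 1)
  have 2: "pairing S (\<lambda>j. c j - unit_vec k j) (unit_vec k) = - pairing S (unit_vec k) c"
    using pairing_skew[OF assms(1), of "\<lambda>j. c j - unit_vec k j" "unit_vec k"] 1 by simp
  show "monomial S (\<lambda>j. - unit_vec k j + c j) * cluster S k = sp (- pairing S (unit_vec k) c) * monomial S c"
    using monomial_mult[OF assms(1), of "\<lambda>j. - unit_vec k j + c j" "unit_vec k"] assms(2)
    by (simp add: monomial_unit 2)
qed

lemma exchange_relation:
  assumes "compatible S" "k \<le> n"
  shows "cluster S k * cluster (mutate n \<iota> s k S) k =
      sp (pairing S (unit_vec k) (pos_part S k)) * monomial S (pos_part S k) +
      sp (pairing S (unit_vec k) (neg_part S k)) * monomial S (neg_part S k)"
    and "cluster (mutate n \<iota> s k S) k * cluster S k =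
      sp (- pairing S (unit_vec k) (pos_part S k)) * monomial S (pos_part S k) +
      sp (- pairing S (unit_vec k) (neg_part S k)) * monomial S (neg_part S k)"
  unfolding mutated_variable distrib_left distrib_right
  using monomial_times_unit[OF compatibleD(1)[OF assms(1)] assms(2)] by simp_all

lemma sum_mutation_matrix_right:
  assumes "k \<le> n" "j \<le> n"
  shows "(\<Sum>b\<le>n. f b * mutation_matrix k B b j) =
    (if j = k then - f k + (\<Sum>b\<in>{..n} - {k}. f b * max (- B b k) 0) else f j)"
proof (cases "j = k")
  case True
  have "(\<Sum>b\<le>n. f b * mutation_matrix k B b j) =
      f k * mutation_matrix k B k j + (\<Sum>b\<in>{..n} - {k}. f b * mutation_matrix k B b j)"
    using assms(1) by (intro sum.remove) auto
  also have "(\<Sum>b\<in>{..n} - {k}. f b * mutation_matrix k B b j) = (\<Sum>b\<in>{..n} - {k}. f b * max (- B b k) 0)"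
    using True by (intro sum.cong refl) (auto simp: mutation_matrix_def)
  finally show ?thesis using True by (simp add: mutation_matrix_def)
next
  case False
  have "f b * mutation_matrix k B b j = (if b = j then f b else 0)" for b
    using False by (simp add: mutation_matrix_def)
  with False assms(2) show ?thesis by simp
qed

lemma sum_mutation_matrix_left:
  assumes "k \<le> n" "i \<le> n"
  shows "(\<Sum>b\<le>n. mutation_matrix k B i b * f b) =
    (if i = k then - f k else f i + max (- B i k) 0 * f k)"
proof (cases "i = k")
  case True
  have "mutation_matrix k B i b * f b = (if b = k then - f b else 0)" for b
    using True by (auto simp: mutation_matrix_def)
  with True assms show ?thesis by simp
next
  case False
  have "mutation_matrix k B i b * f b = (if b = i then f b else 0) + (if b = k then max (- B i k) 0 * f b else 0)" for b
    using False by (auto simp: mutation_matrix_def)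
  with False assms show ?thesis by (simp add: sum.distrib)
qed

lemma mutate_quasi_unchanged:
  assumes "k \<le> n" "i \<le> n" "j \<le> n" "i \<noteq> k" "j \<noteq> k"
  shows "quasi (mutate n \<iota> s k S) i j = quasi S i j"
proof -
  have "quasi (mutate n \<iota> s k S) i j = (\<Sum>a\<le>n. mutation_matrix k (exch S) a i * quasi S a j)"
    using assms by (simp add: mutate_def mutate_quasi_def sum_mutation_matrix_right)
  also have "\<dots> = (\<Sum>a\<le>n. quasi S a j * mutation_matrix k (exch S) a i)"
    by (simp add: mult.commute)
  finally show ?thesis using assms by (simp add: sum_mutation_matrix_right)
qed

text \<open>Column k of E carries the entries [-b_ik]_+, so only the negative part of the exchange
  column enters. Since b_kk = 0, the sum may run over all indices.\<close>

lemma mutate_quasi_row: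
  assumes "compatible S" "k \<le> n" "j \<le> n" "j \<noteq> k"
  shows "quasi (mutate n \<iota> s k S) k j = - quasi S k j + (\<Sum>i\<le>n. neg_part S k i * quasi S i j)"
proof -
  have "quasi (mutate n \<iota> s k S) k j = (\<Sum>a\<le>n. mutation_matrix k (exch S) a k * quasi S a j)"
    using assms by (simp add: mutate_def mutate_quasi_def sum_mutation_matrix_right)
  also have "\<dots> = (\<Sum>a\<le>n. quasi S a j * mutation_matrix k (exch S) a k)"
    by (simp add: mult.commute)
  also have "\<dots> = - quasi S k j + (\<Sum>b\<in>{..n} - {k}. quasi S b j * neg_part S k b)"
    using assms by (simp add: sum_mutation_matrix_right neg_part_def)
  also have "(\<Sum>b\<in>{..n} - {k}. quasi S b j * neg_part S k b) = (\<Sum>b\<le>n. quasi S b j * neg_part S k b)"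
    using assms exch_diagonal[OF assms(1,2)] by (simp add: sum.remove[of "{..n}" k] neg_part_def)
  finally show ?thesis by (simp add: mult.commute)
qed

lemma mutate_quasi_skew:
  assumes "quasi_commuting S"
  shows "quasi (mutate n \<iota> s k S) i j = - quasi (mutate n \<iota> s k S) j i"
proof -
  let ?E = "mutation_matrix k (exch S)"
  have "quasi (mutate n \<iota> s k S) i j = (\<Sum>b\<le>n. \<Sum>a\<le>n. ?E a i * quasi S a b * ?E b j)"
    unfolding mutate_def mutate_quasi_def by (simp, rule sum.swap)
  also have "\<dots> = (\<Sum>b\<le>n. \<Sum>a\<le>n. - (?E b j * quasi S b a * ?E a i))"
  proof (intro sum.cong refl)
    fix a b assume "a \<in> {..n}" "b \<in> {..n}"
    then have "quasi S a b = - quasi S b a" using quasi_commutingD(3)[OF assms, of a b] by auto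
    then show "?E a i * quasi S a b * ?E b j = - (?E b j * quasi S b a * ?E a i)" by simp
  qed
  finally show ?thesis by (simp add: mutate_def mutate_quasi_def sum_negf)
qed

lemma mutation_matrix_involution:
  assumes "compatible S" "k \<le> n" "i \<le> n" "j \<le> n"
  shows "(\<Sum>m\<le>n. mutation_matrix k (exch S) i m * mutation_matrix k (exch S) m j) = (if i = j then 1 else 0)"
  unfolding sum_mutation_matrix_left[OF assms(2,3)]
  using assms exch_diagonal[OF assms(1,2)] by (auto simp: mutation_matrix_def)

text \<open>In matrix form this is \<open>E B' = B E\<^sup>T\<close> with \<open>B' = E B E\<^sup>T\<close> and \<open>E\<^sup>2 = 1\<close>.\<close>

lemma mutation_matrix_exch:
  assumes "compatible S" "k \<le> n" "i \<le> n" "a \<le> n"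
  shows "(\<Sum>m\<le>n. mutation_matrix k (exch S) a m * exch (mutate n \<iota> s k S) m i) =
    (\<Sum>c\<le>n. exch S a c * mutation_matrix k (exch S) i c)"
proof -
  let ?B = "exch S"
  have d: "?B k k = 0" by (rule exch_diagonal) fact+
  have ik: "?B i k = - ?B k i" by (rule compatibleD(2)) fact+
  have "(\<Sum>c\<le>n. ?B a c * mutation_matrix k ?B i c) = (\<Sum>c\<le>n. mutation_matrix k ?B i c * ?B a c)"
    by (simp add: mult.commute)
  also have "\<dots> = (if i = k then - ?B a k else ?B a i + max (?B k i) 0 * ?B a k)"
    using assms by (simp add: sum_mutation_matrix_left ik)
  finally have r: "(\<Sum>c\<le>n. ?B a c * mutation_matrix k ?B i c) = (if i = k then - ?B a k else ?B a i + max (?B k i) 0 * ?B a k)" .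
  have id: "x = max x 0 - max (- x) 0" for x :: int by auto
  have alg: "max x 0 * max y 0 - max (- x) 0 * max (- y) 0 - max (- x) 0 * y = max y 0 * x" for x y :: int
    by (auto simp: max_def)
  show ?thesis
    unfolding r using assms(2,4) d alg[of "?B a k" "?B k i"]
    by (simp add: sum_mutation_matrix_left mutate_def mutate_exch_def) 
qed

text \<open>The matrix computation is B'^T Lambda' = (E B')^T Lambda E = (B E^T)^T Lambda E = E (B^T
  Lambda) E = 2 E^2 = 2 I. The remaining work is that the new variable is nonzero and quasi-commutes
  with the others.\<close>

lemma compatible_mutate:
  assumes S: "compatible S" and k: "k \<le> n"
  shows "compatible (mutate n \<iota> s k S)"
proof -
  let ?S = "mutate n \<iota> s k S" and ?B = "exch S" and ?L = "quasi S" and ?E = "mutation_matrix k (exch S)"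
  have qS: "quasi_commuting S" by (rule compatibleD(1)) fact
  let ?Mp = "monomial S (\<lambda>j. - unit_vec k j + pos_part S k j)"
  let ?Mn = "monomial S (\<lambda>j. - unit_vec k j + neg_part S k j)"
  \<comment> \<open>Both summands of the new variable have the same pairing with e_j, since their
    exponents differ by column k of B, which pairs to 0 with e_j for j different from k.\<close>
  have row: "pairing S (\<lambda>j. - unit_vec k j + pos_part S k j) (unit_vec j) = quasi ?S k j"
    "pairing S (\<lambda>j. - unit_vec k j + neg_part S k j) (unit_vec j) = quasi ?S k j"
    if "j \<le> n" "j \<noteq> k" for j
  proof -
    have "pairing S (unit_vec k) (unit_vec j) = quasi S k j"
      using that k by (simp add: pairing_unit_left sum_unit_vec)
    then show 1: "pairing S (\<lambda>j. - unit_vec k j + neg_part S k j) (unit_vec j) = quasi ?S k j"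
      using that mutate_quasi_row[OF S k that] by (simp only: pairing_add) (simp add: pairing_unit_right)
    show "pairing S (\<lambda>j. - unit_vec k j + pos_part S k j) (unit_vec j) = quasi ?S k j"
      using 1 pairing_exch[OF S k that(1)] that by (simp only: pairing_add) simp
  qed
  \<comment> \<open>The two monomials quasi-commute with the old variable by powers of q that differ
    by the factor q^2, so neither can be the negative of the other.\<close>
  have "?Mp + ?Mn \<noteq> 0"
  proof
    assume "?Mp + ?Mn = 0"
    then have "?Mp = - ?Mn" by (simp add: add_eq_0_iff)
    have "pairing S (unit_vec k) (pos_part S k) - pairing S (unit_vec k) (neg_part S k) = - 2"
      using pairing_exch[OF S k k] pairing_skew[OF qS, of "unit_vec k"] by simp
    moreover have "sp (2 * pairing S (unit_vec k) (pos_part S k)) * (?Mp * cluster S k) =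
        sp (2 * pairing S (unit_vec k) (neg_part S k)) * (?Mp * cluster S k)"
    proof -
      have "sp (2 * pairing S (unit_vec k) c) * (monomial S (\<lambda>j. - unit_vec k j + c j) * cluster S k) =
          cluster S k * monomial S (\<lambda>j. - unit_vec k j + c j)" for c
        using monomial_times_unit[OF qS k, of c] by (simp add: sp_mult_left)
      from this[of "pos_part S k"] this[of "neg_part S k"] show ?thesis
        unfolding \<open>?Mp = - ?Mn\<close> by simp
    qed
    ultimately show False
      using monomial_nonzero[OF qS] quasi_commutingD(1)[OF qS k] by (auto simp: sp_inject)
  qed
  then have nz: "cluster ?S k \<noteq> 0" by (simp add: mutated_variable)
  have swap: "cluster ?S k * cluster ?S j = sp (2 * quasi ?S k j) * (cluster ?S j * cluster ?S k)"
    if "j \<le> n" "j \<noteq> k" for j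
    using monomial_swap[OF qS, of "\<lambda>j. - unit_vec k j + pos_part S k j" "unit_vec j"]
      monomial_swap[OF qS, of "\<lambda>j. - unit_vec k j + neg_part S k j" "unit_vec j"] row[OF that] that
    by (simp add: mutated_variable mutate_other monomial_unit distrib_left distrib_right)
  have sk: "quasi ?S i j = - quasi ?S j i" for i j by (rule mutate_quasi_skew[OF qS])
  have "quasi_commuting ?S"
    unfolding quasi_commuting_def
  proof (intro conjI allI impI)
    fix i assume i: "i \<le> n"
    show "cluster ?S i \<noteq> 0"
      using nz quasi_commutingD(1)[OF qS i] by (cases "i = k") (auto simp: mutate_other)
    fix j assume j: "j \<le> n"
    show "quasi ?S i j = - quasi ?S j i" by (rule sk)
    consider "i = k" "j = k" | "i = k" "j \<noteq> k" | "i \<noteq> k" "j = k" | "i \<noteq> k" "j \<noteq> k" by blast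
    then show "cluster ?S i * cluster ?S j = sp (2 * quasi ?S i j) * (cluster ?S j * cluster ?S i)"
    proof cases
      case 1
      then show ?thesis using sk[of k k] by simp
    next
      case 2
      then show ?thesis using swap[OF j] by simp
    next
      case 3
      then show ?thesis using sp_swap_sym[OF swap[OF i]] sk[of i k] by simp
    next
      case 4
      then show ?thesis
        using quasi_commutingD(2)[OF qS i j] mutate_quasi_unchanged[OF k i j, of S]
        by (simp only: mutate_other not_False_eq_True)
    qed
  qed
  moreover have "exch ?S i j = - exch ?S j i" if "i \<le> n" "j \<le> n" for i j
    using compatibleD(2)[OF S that] compatibleD(2)[OF S k that(1)] compatibleD(2)[OF S k that(2)]
      compatibleD(2)[OF S that(1) k] compatibleD(2)[OF S that(2) k]
    by (simp add: mutate_def mutate_exch_def max_def)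
  moreover have "(\<Sum>m\<le>n. exch ?S m i * quasi ?S m j) = (if i = j then 2 else 0)" if ij: "i \<le> n" "j \<le> n" for i j
  proof -
    have "(\<Sum>m\<le>n. exch ?S m i * quasi ?S m j) =
        (\<Sum>m\<le>n. \<Sum>a\<le>n. \<Sum>b\<le>n. ?E a m * exch ?S m i * ?L a b * ?E b j)"
      by (simp add: mutate_def mutate_quasi_def sum_distrib_left algebra_simps)
    also have "\<dots> = (\<Sum>a\<le>n. \<Sum>b\<le>n. \<Sum>m\<le>n. ?E a m * exch ?S m i * ?L a b * ?E b j)"
      by (rule trans[OF sum.swap], rule sum.cong[OF refl], rule sum.swap)
    also have "\<dots> = (\<Sum>a\<le>n. \<Sum>b\<le>n. (\<Sum>c\<le>n. ?B a c * ?E i c) * ?L a b * ?E b j)"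
      by (simp add: sum_distrib_right[symmetric] mutation_matrix_exch[OF S k ij(1)])
    also have "\<dots> = (\<Sum>b\<le>n. \<Sum>a\<le>n. \<Sum>c\<le>n. ?E i c * ?E b j * (?B a c * ?L a b))"
      by (subst sum.swap) (simp add: sum_distrib_left sum_distrib_right algebra_simps)
    also have "\<dots> = (\<Sum>b\<le>n. \<Sum>c\<le>n. \<Sum>a\<le>n. ?E i c * ?E b j * (?B a c * ?L a b))"
      by (rule sum.cong[OF refl], rule sum.swap)
    also have "\<dots> = (\<Sum>b\<le>n. \<Sum>c\<le>n. if c = b then 2 * (?E i c * ?E b j) else 0)"
      by (intro sum.cong refl) (simp add: sum_distrib_left[symmetric] compatibleD(3)[OF S])
    also have "\<dots> = 2 * (\<Sum>b\<le>n. ?E i b * ?E b j)"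
      by (simp add: sum_distrib_left)
    finally show ?thesis using mutation_matrix_involution[OF S k ij] by simp
  qed
  ultimately show ?thesis unfolding compatible_def by blast
qed

end

section \<open>Arcs of the annulus and their Ptolemy relations\<close>

definition par :: "int \<Rightarrow> int \<Rightarrow> int" where "par i j = (i + j) mod 2"

lemma par_simps [simp]: "par i i = 0" "par i (i + 1) = 1" "par (i + 1) i = 1" "par (i - 1) i = 1" "par i (i - 1) = 1"
  "par (i - 1) (i + 1) = 0" "par (i + 1 - 1) i = 0"
  unfolding par_def by presburger+

lemma par_commute: "par i j = par j i"
  by (simp add: par_def add.commute)

lemma par_step: "par i (m + 1) = 1 - par i m" "par i (m - 1) = 1 - par i m" "par (m + 1) i = 1 - par m i"
  "par (m - 1) i = 1 - par m i"
  unfolding par_def by presburger+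

lemma (in central_scalars) sp_swap_inverse_right:
  assumes "x * y = sp e * (y * x)" "y \<noteq> 0"
  shows "x * inverse y = sp (- e) * (inverse y * x)"
  using sp_inverse_swap[OF sp_swap_sym[OF assms(1)] assms(2)] by (simp add: sp_mult_left)

text \<open>\<open>w i\<close> is the arc from the outer marked point \<open>i\<close> of the universal cover to a fixed lift of the inner one.\<close>

locale annulus = central_scalars \<iota> s
  for \<iota> :: "'k::field \<Rightarrow> 'd::division_ring" and s :: 'k +
  fixes n :: nat and w :: "int \<Rightarrow> 'd"
  assumes n_odd: "odd n" and n_ge: "n \<ge> 2"
    and w_nonzero: "w i \<noteq> 0"
    and w_swap: "\<lbrakk>i < j; j \<le> i + int n\<rbrakk> \<Longrightarrow> w i * w j = sp (2 * par i j) * (w j * w i)"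
    and w_exchange: "w i * w (i + int n + 1) = 1 + sp 2 * (w (i + 1) * w (i + int n))"
begin

lemma par_shift [simp]: "par (i + int n) (j + int n) = par i j" "par (i + int n) j = 1 - par i j" "par i (j + int n) = 1 - par i j"
  unfolding par_def using n_odd by presburger+

text \<open>The normalised inverse of \<open>w m\<close> times \<open>w (m + 1)\<close>. As boundary
  edges have length 1, this is the horocyclic length cut out at the inner point by the triangle over
  the edge (m, m + 1).\<close>

definition u :: "int \<Rightarrow> 'd" where
  "u m = sp (-1) * (inverse (w m) * inverse (w (m + 1)))"

lemma w_swap': "\<lbrakk>i \<le> j; j \<le> i + int n\<rbrakk> \<Longrightarrow> w i * w j = sp (2 * par i j) * (w j * w i)"
  using w_swap[of i j] by (cases "i = j") auto

text \<open>The parities against m and m + 1 add up to 1, so the exponent is independent of l as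
  long as l stays on one side of the edge; \<open>w_u_high\<close> is the other side, with the
  opposite sign.\<close>

lemma w_u_low:
  assumes "l \<le> m" "m + 1 \<le> l + int n"
  shows "w l * u m = sp (- 2) * (u m * w l)"
proof -
  have "w l * inverse (w m) = sp (- (2 * par l m)) * (inverse (w m) * w l)"
    "w l * inverse (w (m + 1)) = sp (- (2 * par l (m + 1))) * (inverse (w (m + 1)) * w l)"
    using assms by (intro sp_swap_inverse_right w_swap' w_nonzero; linarith)+
  from sp_swap_mult[OF this] have "w l * (inverse (w m) * inverse (w (m + 1))) =
      sp (-2) * (inverse (w m) * inverse (w (m + 1)) * w l)"
    by (simp add: par_step)
  then show ?thesis by (simp add: u_def sp_norm)
qed

lemma w_u_high:
  assumes "m < l" "l \<le> m + int n"
  shows "w l * u m = sp 2 * (u m * w l)"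
proof -
  have "w l * w m = sp (- (2 * par m l)) * (w m * w l)"
    "w l * w (m + 1) = sp (- (2 * par (m + 1) l)) * (w (m + 1) * w l)"
    using assms by (intro sp_swap_sym w_swap'; linarith)+
  then have "w l * inverse (w m) = sp (2 * par m l) * (inverse (w m) * w l)"
    "w l * inverse (w (m + 1)) = sp (2 * par (m + 1) l) * (inverse (w (m + 1)) * w l)"
    using sp_swap_inverse_right[OF _ w_nonzero] by fastforce+
  from sp_swap_mult[OF this] have "w l * (inverse (w m) * inverse (w (m + 1))) =
      sp 2 * (inverse (w m) * inverse (w (m + 1)) * w l)"
    by (simp add: par_step)
  then show ?thesis by (simp add: u_def sp_norm)
qed

lemma u_u:
  assumes "m < p" "p + 1 \<le> m + int n"
  shows "u p * u m = sp (- 4) * (u m * u p)"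
proof -
  have "u m * inverse (w p) = sp 2 * (inverse (w p) * u m)"
    "u m * inverse (w (p + 1)) = sp 2 * (inverse (w (p + 1)) * u m)"
    using assms sp_swap_inverse_right[OF sp_swap_sym[OF w_u_high] w_nonzero] by simp_all
  from sp_swap_mult[OF this] have "u m * u p = sp 4 * (u p * u m)"
    by (simp add: u_def[of p] sp_norm)
  then show ?thesis by (simp add: sp_norm)
qed

definition U :: "int \<Rightarrow> int \<Rightarrow> 'd" where "U i k = sum u {i..<k}"

lemma U_simps [simp]: "U i i = 0" "U i (i + 1) = u i"
proof -
  have "{i..<i + 1} = {i}" by auto
  then show "U i (i + 1) = u i" by (simp add: U_def)
qed (simp add: U_def)

lemma U_split: "\<lbrakk>i \<le> j; j \<le> k\<rbrakk> \<Longrightarrow> U i k = U i j + U j k"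
  unfolding U_def by (subst sum.union_disjoint[symmetric]) (auto intro!: sum.cong)

lemma U_w_low:
  assumes "l \<le> i" "k \<le> l + int n"
  shows "U i k * w l = sp 2 * (w l * U i k)"
proof -
  have "u m * w l = sp 2 * (w l * u m)" if "m \<in> {i..<k}" for m
    using sp_swap_sym[OF w_u_low[of l m]] that assms by simp
  then show ?thesis by (simp add: U_def sum_distrib_left sum_distrib_right)
qed

lemma U_w_high:
  assumes "k \<le> l" "l \<le> i + int n"
  shows "U i k * w l = sp (- 2) * (w l * U i k)"
proof -
  have "u m * w l = sp (- 2) * (w l * u m)" if "m \<in> {i..<k}" for m
    using sp_swap_sym[OF w_u_high[of m l]] that assms by simp
  then show ?thesis by (simp add: U_def sum_distrib_left sum_distrib_right)
qed

lemma U_U: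
  assumes "k \<le> i'" "k' \<le> i + int n"
  shows "U i' k' * U i k = sp (- 4) * (U i k * U i' k')"
proof -
  have "u p * u m = sp (- 4) * (u m * u p)" if "m \<in> {i..<k}" "p \<in> {i'..<k'}" for m p
    using u_u[of m p] that assms by simp
  then show ?thesis
    by (simp add: U_def sum_distrib_left sum_distrib_right sum.swap[of _ "{i..<k}"] cong: sum.cong)
      (simp add: sum.swap[of _ "{i'..<k'}" "{i..<k}"])
qed

text \<open>The class of the arc joining the outer marked points \<open>i\<close> and \<open>k\<close>: this is the sum of the
  normalized monomials \<open>w\<^sub>i w\<^sub>k / (w\<^sub>m w\<^sub>m\<^sub>+\<^sub>1)\<close> with \<open>i \<le> m < k\<close>.\<close>

definition P :: "int \<Rightarrow> int \<Rightarrow> 'd" where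
  "P i k = sp (2 - par i k) * (w i * (U i k * w k))"

lemma P_diag [simp]: "P i i = 0"
  by (simp add: P_def)

lemma P_edge [simp]: "P i (i + 1) = 1"
proof -
  have "w i * (u i * w (i + 1)) = sp (- 1)"
    using w_nonzero[of i] w_nonzero[of "i + 1"]
    by (simp add: u_def sp_norm)
  then show ?thesis by (simp add: P_def sp_norm)
qed

text \<open>With A, B, C the lengths over [i, j], [j, k], [k, l], the products are (A + B)(B + C),
  AC and (A + B + C)B. Once every product is brought into the order w_i w_j X w_k w_l, only powers
  of q have to be compared.\<close>

lemma ptolemy_arcs:
  assumes "i \<le> j" "j \<le> k" "k \<le> l" "l \<le> i + int n"
  shows "P i k * P j l =
    sp (par i j + par k l - par i k - par j l - 2 * par j k) * (P i j * P k l) +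
    sp (par i l + par j l + 2 * par k l - par i k - par j k) * (P i l * P j k)"
proof -
  let ?A = "U i j" and ?B = "U j k" and ?C = "U k l"
  have ik: "U i k = ?A + ?B" and jl: "U j l = ?B + ?C" and il: "U i l = ?A + (?B + ?C)"
    using U_split assms by (metis order.trans)+
  have ww: "w k * w j = sp (- (2 * par j k)) * (w j * w k)" "w l * w j = sp (- (2 * par j l)) * (w j * w l)"
    "w l * w k = sp (- (2 * par k l)) * (w k * w l)"
    using assms by (intro sp_swap_sym w_swap'; linarith)+
  have Uw: "?A * w j = sp (- 2) * (w j * ?A)" "?B * w j = sp 2 * (w j * ?B)" "?C * w j = sp 2 * (w j * ?C)"
    using assms by (intro U_w_high U_w_low; linarith)+
  have "?B * w k = sp (- 2) * (w k * ?B)" "?C * w k = sp 2 * (w k * ?C)" "?B * w l = sp (- 2) * (w l * ?B)"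
    using assms by (intro U_w_high U_w_low; linarith)+
  then have wU: "w k * ?B = sp 2 * (?B * w k)" "w k * ?C = sp (- 2) * (?C * w k)" "w l * ?B = sp 2 * (?B * w l)"
    by (simp_all add: sp_norm)
  have UU: "?C * ?B = sp (- 4) * (?B * ?C)"
    using assms by (intro U_U; linarith)+
  have BA: "?B * ?A = sp (- 4) * (?A * ?B)"
    using assms by (intro U_U; linarith)+
  note rules = ww Uw wU UU
  note rules = rules rules[THEN sp_swap_left]
  let ?T = "\<lambda>X. w i * (w j * (X * (w k * w l)))"
  have 1: "P i k * P j l = sp (4 - par i k - par j l - 2 * par j k) *
      (sp (- 4) * ?T (?A * ?C) + ?T (?A * ?B) + sp 4 * ?T (?B * ?B) + ?T (?B * ?C))"
    unfolding P_def ik jl by (simp add: rules sp_norm distrib_left distrib_right algebra_simps)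
  have 2: "P i j * P k l = sp (- par i j - par k l) * ?T (?A * ?C)"
    unfolding P_def by (simp add: rules sp_norm distrib_left distrib_right algebra_simps)
  have 3: "P i l * P j k = sp (4 - par i l - par j k - 2 * par j l - 2 * par k l) *
      (?T (?A * ?B) + sp 4 * ?T (?B * ?B) + ?T (?B * ?C))"
    unfolding P_def il by (simp add: rules sp_norm distrib_left distrib_right algebra_simps)
  show ?thesis
    unfolding 1 2 3 by (simp add: sp_norm distrib_left algebra_simps)
qed

text \<open>The Ptolemy relation with the inner point as fourth vertex; here additivity A + B is all
  that is used.\<close>

lemma ptolemy_bridge:
  assumes "i \<le> j" "j \<le> k" "k \<le> i + int n"
  shows "P i k * w j = sp (par i j - par i k - 2 * par j k) * (P i j * w k) +
    sp (2 - par i k - par j k) * (w i * P j k)"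
proof -
  let ?A = "U i j" and ?B = "U j k"
  have ik: "U i k = ?A + ?B"
    using U_split assms by blast
  have ww: "w k * w j = sp (- (2 * par j k)) * (w j * w k)"
    using assms by (intro sp_swap_sym w_swap'; linarith)+
  have "?B * w j = sp 2 * (w j * ?B)"
    using assms by (intro U_w_high U_w_low; linarith)+
  then have wU: "w j * ?B = sp (- 2) * (?B * w j)"
    by (simp_all add: sp_norm)
  note rules = ww wU
  note rules = rules rules[THEN sp_swap_left]
  show ?thesis
    unfolding P_def ik by (simp add: rules sp_norm distrib_left distrib_right algebra_simps)
qed

text \<open>The arc that cuts off the single outer point i. The formula of the theorem for x_i is
  recovered from \<open>w_x\<close>.\<close>

definition x :: "int \<Rightarrow> 'd" where "x i = P (i - 1) (i + 1)"

lemma x_w: "x i * w i = sp 1 * w (i - 1) + sp (- 1) * w (i + 1)"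
  using ptolemy_bridge[of "i - 1" i "i + 1"] P_edge[of "i - 1"] n_ge by (simp add: x_def)

text \<open>Obtained from \<open>x_w\<close> by moving \<open>w i\<close> past its two neighbours
  and cancelling it. The powers of q trade places between \<open>x_w\<close> and \<open>w_x\<close>;
  this asymmetry is what later separates \<open>w 0\<close> from \<open>w 2\<close>.\<close>

lemma w_x: "w i * x i = sp (- 1) * w (i - 1) + sp 1 * w (i + 1)"
proof -
  have 1: "w i * w (i + 1) = sp 2 * (w (i + 1) * w i)"
    using w_swap[of i "i + 1"] n_ge by simp
  have 2: "w i * w (i - 1) = sp (- 2) * (w (i - 1) * w i)"
    using sp_swap_sym[OF w_swap[of "i - 1" i]] n_ge by simp
  have "w i * x i * w i = w i * (x i * w i)" by (simp add: mult.assoc)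
  also have "\<dots> = (sp (- 1) * w (i - 1) + sp 1 * w (i + 1)) * w i"
    unfolding x_w by (simp add: distrib_left distrib_right 1 2 sp_norm)
  finally show ?thesis using w_nonzero by simp
qed

lemma w_exchange': "w (i + int n + 1) * w i = 1 + sp (- 2) * (w (i + 1) * w (i + int n))"
proof -
  have 1: "w i * w (i + 1) = sp 2 * (w (i + 1) * w i)"
    using w_swap[of i "i + 1"] n_ge by simp
  have 2: "w i * w (i + int n) = sp 2 * (w (i + int n) * w i)"
    using w_swap[of i "i + int n"] n_ge by simp
  have "w i * (w (i + int n + 1) * w i) = (1 + sp 2 * (w (i + 1) * w (i + int n))) * w i"
    using w_exchange[of i] by (simp add: mult.assoc[symmetric])
  also have "\<dots> = w i * (1 + sp (- 2) * (w (i + 1) * w (i + int n)))"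
    by (simp add: distrib_left distrib_right sp_norm sp_swap_left[OF 1] 2)
  finally show ?thesis using w_nonzero by simp
qed

text \<open>After multiplication by w_(i+n) w_i on the right, the exchange relations for the pairs
  (i - 1, i + n) and (i, i + n + 1) turn one side into the other.\<close>

lemma x_periodic: "x (i + int n) = x i"
proof -
  let ?N = "int n"
  have 1: "w (i + ?N) * w i = sp (- 2) * (w i * w (i + ?N))"
    using sp_swap_sym[OF w_swap[of i "i + ?N"]] n_ge by simp
  have 2: "w (i + ?N - 1) * w i = w i * w (i + ?N - 1)"
    using w_swap[of i "i + ?N - 1"] n_ge par_shift(3)[of i "i - 1"] by (simp add: algebra_simps)
  have 3: "w (i - 1) * w (i + ?N) = 1 + sp 2 * (w i * w (i + ?N - 1))"
    using w_exchange[of "i - 1"] by (simp add: algebra_simps)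
  have "x (i + ?N) * w (i + ?N) * w i = sp 1 * (w i * w (i + ?N - 1)) + sp (- 1) * (w (i + ?N + 1) * w i)"
    unfolding x_w by (simp add: distrib_right mult.assoc 2)
  also have "\<dots> = sp (- 2) * (sp 1 * w (i - 1) + sp (- 1) * w (i + 1)) * w (i + ?N)"
    by (simp add: w_exchange' distrib_left distrib_right sp_norm 3)
  also have "\<dots> = sp (- 2) * (x i * w i * w (i + ?N))"
    by (simp add: x_w mult.assoc)
  also have "\<dots> = x i * w (i + ?N) * w i"
    by (simp add: mult.assoc 1 sp_norm)
  finally show ?thesis using w_nonzero by simp
qed

text \<open>Ptolemy in the quadrilateral i, b - 1, b, b + 1, two sides of which are boundary edges
  and contribute 1.\<close>

lemma P_rec:
  assumes "i < b" "b < i + int n"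
  shows "P i b * x b = sp (- 2 * par i b) * P i (b - 1) + sp (2 - 2 * par i b) * P i (b + 1)"
proof -
  have 1: "par i (b - 1) + par b (b + 1) - par i b - par (b - 1) (b + 1) - 2 * par (b - 1) b = - 2 * par i b"
    "par i (b + 1) + par (b - 1) (b + 1) + 2 * par b (b + 1) - par i b - par (b - 1) b = 2 - 2 * par i b"
    by (simp_all add: par_step)
  show ?thesis
    using ptolemy_arcs[of i "b - 1" b "b + 1", unfolded 1] assms P_edge[of "b - 1"] by (simp add: x_def)
qed

lemma P_next:
  assumes "i < b" "b < i + int n"
  shows "P i (b + 1) = sp (2 * par i b - 2) * (P i b * x b - sp (- 2 * par i b) * P i (b - 1))"
  unfolding P_rec[OF assms] by (simp add: sp_norm)

lemma P_induct:
  assumes "i \<le> k" "k \<le> i + int n"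
    and "Q i" "Q (i + 1)"
    and "\<And>b. \<lbrakk>i < b; b < i + int n; Q b; Q (b - 1)\<rbrakk> \<Longrightarrow> Q (b + 1)"
  shows "Q (k::int)"
proof -
  have main: "m < i + int n \<longrightarrow> Q m \<and> Q (m + 1)" if "i \<le> m" for m
    using that
  proof (induction m rule: int_ge_induct)
    case (step b)
    then show ?case using assms(5)[of "b + 1"] by auto
  qed (use assms(3,4) in auto)
  show ?thesis
  proof (cases "k < i + int n")
    case True
    with main assms(1) show ?thesis by blast
  next
    case False
    with main[of "k - 1"] assms(2) n_ge show ?thesis by simp
  qed
qed

text \<open>The factors w_i in \<open>P\<close> are not periodic, so the definition gives no reason;
  but the recursion has the periodic coefficients x_b and the same initial values 0 and 1.\<close>

lemma P_periodic:
  assumes "i \<le> k" "k \<le> i + int n"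
  shows "P (i + int n) (k + int n) = P i k"
  using assms
proof (rule P_induct)
  have "i + 1 + int n = i + int n + 1" by simp
  then show "P (i + int n) (i + 1 + int n) = P i (i + 1)" by (simp only: P_edge)
next
  fix b assume b: "i < b" "b < i + int n" and IH: "P (i + int n) (b + int n) = P i b"
    "P (i + int n) (b - 1 + int n) = P i (b - 1)"
  show "P (i + int n) (b + 1 + int n) = P i (b + 1)"
    using P_next[of "i + int n" "b + int n"] P_next[OF b] b IH x_periodic[of b]
    by (simp add: algebra_simps) (metis add_right_cancel)
qed simp

text \<open>Both terms of x_b w_b, namely w_(b-1) and w_(b+1), have the same parity and thus the
  same exponent against w_(i+n); the factor w_b is then cancelled.\<close>

lemma x_w_far:
  assumes "i < b" "b < i + int n"
  shows "w (i + int n) * x b = sp (2 - 4 * par i b) * (x b * w (i + int n))"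
proof -
  let ?N = "int n"
  have 1: "w (i + ?N) * w (b - 1) = sp (- 2 * par (b - 1) (i + ?N)) * (w (b - 1) * w (i + ?N))"
    using sp_swap_sym[OF w_swap'[of "b - 1" "i + ?N"]] assms by simp
  have 2: "w (i + ?N) * w (b + 1) = sp (- 2 * par (b + 1) (i + ?N)) * (w (b + 1) * w (i + ?N))"
    using sp_swap_sym[OF w_swap'[of "b + 1" "i + ?N"]] assms by simp
  have 3: "w b * w (i + ?N) = sp (2 * par b (i + ?N)) * (w (i + ?N) * w b)"
    using w_swap'[of b "i + ?N"] assms by simp
  have "w (i + ?N) * x b * w b = sp (- 2 * par i b) * ((sp 1 * w (b - 1) + sp (- 1) * w (b + 1)) * w (i + ?N))"
    by (simp add: x_w mult.assoc distrib_left distrib_right sp_norm 1 2 par_step par_commute[of b i] sp_inject)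
  also have "\<dots> = sp (- 2 * par i b) * (x b * (w b * w (i + ?N)))"
    by (simp add: x_w[symmetric] mult.assoc)
  also have "\<dots> = sp (2 - 4 * par i b) * (x b * w (i + ?N)) * w b"
    by (simp add: 3 sp_norm par_commute[of b i])
  finally show ?thesis using w_nonzero by simp
qed

text \<open>Seen as an arc from a, w_(a+n) ends at the neighbouring lift of the inner point. The
  relation is Ptolemy for the quadrilateral formed by a, b and these two lifts, whose fourth side is
  the inner boundary and contributes 1. The case b = a + 1 is the exchange relation.\<close>

lemma ptolemy_inner:
  assumes "a \<le> b" "b \<le> a + int n"
  shows "w a * w (b + int n) = sp (2 * par a b) * (w b * w (a + int n)) + sp (par a b - 1) * P a b"
  using assms
proof (rule P_induct)
  show "w a * w (a + 1 + int n) = sp (2 * par a (a + 1)) * (w (a + 1) * w (a + int n)) + sp (par a (a + 1) - 1) * P a (a + 1)"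
    using w_exchange[of a] by (simp add: add.assoc add.commute[of 1])
next
  fix b
  let ?N = "int n" and ?t = "par a b"
  assume b: "a < b" "b < a + int n"
    and IH: "w a * w (b + ?N) = sp (2 * par a b) * (w b * w (a + ?N)) + sp (par a b - 1) * P a b"
      "w a * w (b - 1 + ?N) = sp (2 * par a (b - 1)) * (w (b - 1) * w (a + ?N)) + sp (par a (b - 1) - 1) * P a (b - 1)"
  \<comment> \<open>By periodicity of x, the sequences w_(b+n), w_b and P a b satisfy three term
    recursions with the same coefficient x_b; the identity propagates from b - 1 and b to b +
    1.\<close>
  have "sp 1 * w (b + 1 + ?N) = w (b + ?N) * x b - sp (- 1) * w (b - 1 + ?N)"
    using w_x[of "b + ?N"] by (simp add: x_periodic algebra_simps)
  then have "sp 1 * (w a * w (b + 1 + ?N)) = w a * (w (b + ?N) * x b - sp (- 1) * w (b - 1 + ?N))"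
    by (metis sp_left_commute)
  also have "\<dots> = w a * w (b + ?N) * x b - sp (- 1) * (w a * w (b - 1 + ?N))"
    by (simp add: right_diff_distrib sp_norm)
  also have "\<dots> = sp (2 * ?t) * (w b * (w (a + ?N) * x b)) + sp (?t - 1) * (P a b * x b)
      - sp (1 - 2 * ?t) * (w (b - 1) * w (a + ?N)) - sp (- 1 - ?t) * P a (b - 1)"
    unfolding IH by (simp add: par_step distrib_right distrib_left sp_norm algebra_simps sp_inject)
  also have "sp (2 * ?t) * (w b * (w (a + ?N) * x b)) = sp (2 - 2 * ?t) * (w b * x b * w (a + ?N))"
    unfolding x_w_far[OF b] by (simp add: sp_norm)
  also have "\<dots> = sp (1 - 2 * ?t) * (w (b - 1) * w (a + ?N)) + sp (3 - 2 * ?t) * (w (b + 1) * w (a + ?N))"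
    unfolding w_x by (simp add: sp_norm distrib_right distrib_left)
  also have "sp (?t - 1) * (P a b * x b) = sp (- 1 - ?t) * P a (b - 1) + sp (1 - ?t) * P a (b + 1)"
    unfolding P_rec[OF b] by (simp add: sp_norm distrib_left sp_inject)
  finally have "sp 1 * (w a * w (b + 1 + ?N)) = sp (3 - 2 * ?t) * (w (b + 1) * w (a + ?N)) + sp (1 - ?t) * P a (b + 1)"
    by simp
  then have "sp (- 1) * (sp 1 * (w a * w (b + 1 + ?N))) =
      sp (- 1) * (sp (3 - 2 * ?t) * (w (b + 1) * w (a + ?N)) + sp (1 - ?t) * P a (b + 1))" by simp
  then show "w a * w (b + 1 + ?N) = sp (2 * par a (b + 1)) * (w (b + 1) * w (a + ?N)) + sp (par a (b + 1) - 1) * P a (b + 1)"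
    by (simp add: sp_norm distrib_left par_step)
qed simp

end

section \<open>Triangulations\<close>

text \<open>The annulus is cut along one bridging arc into a polygon with outer vertices \<open>0, \<dots>, N\<close> and one inner
  vertex, encoded as \<open>N + 2\<close>; the edges \<open>(i, i + 1)\<close> are boundary edges. The gap at \<open>N + 1\<close> makes
  \<open>(N, N + 2)\<close> an arc rather than a boundary edge.\<close>

definition arcs :: "int \<Rightarrow> (int \<times> int) set" where
  "arcs N = {(p, r). 0 \<le> p \<and> p \<le> N \<and> (r = N + 2 \<or> p + 2 \<le> r \<and> r \<le> N)}"

fun crosses :: "int \<times> int \<Rightarrow> int \<times> int \<Rightarrow> bool" where
  "crosses (p, r) (p', r') \<longleftrightarrow> p < p' \<and> p' < r \<and> r < r' \<or> p' < p \<and> p < r' \<and> r' < r"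

text \<open>Maximality is expressed through crossings instead of a count of arcs, since it is used
  to produce the sides of triangles: what crosses nothing is present.\<close>

definition triangulation :: "int \<Rightarrow> (int \<times> int) set \<Rightarrow> bool" where
  "triangulation N T \<longleftrightarrow> T \<subseteq> arcs N \<and> (\<forall>a\<in>T. \<forall>b\<in>T. \<not> crosses a b) \<and>
     (\<forall>a\<in>arcs N. (\<forall>b\<in>T. \<not> crosses a b) \<longrightarrow> a \<in> T)"

definition edge :: "int \<Rightarrow> (int \<times> int) set \<Rightarrow> int \<times> int \<Rightarrow> bool" where
  "edge N T a \<longleftrightarrow> a \<in> T \<or> (\<exists>p. a = (p, p + 1) \<and> 0 \<le> p \<and> p < N)"

lemma triangulationD:
  assumes "triangulation N T"
  shows "(p, r) \<in> T \<Longrightarrow> 0 \<le> p \<and> p \<le> N \<and> (r = N + 2 \<or> p + 2 \<le> r \<and> r \<le> N)"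
    and "\<lbrakk>(p, r) \<in> T; (p', r') \<in> T\<rbrakk> \<Longrightarrow> \<not> (p < p' \<and> p' < r \<and> r < r')"
    and "\<lbrakk>0 \<le> p; p \<le> N; r = N + 2 \<or> p + 2 \<le> r \<and> r \<le> N; \<And>p' r'. (p', r') \<in> T \<Longrightarrow>
      \<not> (p < p' \<and> p' < r \<and> r < r') \<and> \<not> (p' < p \<and> p < r' \<and> r' < r)\<rbrakk> \<Longrightarrow> (p, r) \<in> T"
proof -
  show "(p, r) \<in> T \<Longrightarrow> 0 \<le> p \<and> p \<le> N \<and> (r = N + 2 \<or> p + 2 \<le> r \<and> r \<le> N)"
    using assms by (auto simp: triangulation_def arcs_def)
  show "\<not> (p < p' \<and> p' < r \<and> r < r')" if "(p, r) \<in> T" "(p', r') \<in> T"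
  proof -
    have "\<not> crosses (p, r) (p', r')" using assms that unfolding triangulation_def by blast
    then show ?thesis by simp
  qed
  show "(p, r) \<in> T" if "0 \<le> p" "p \<le> N" "r = N + 2 \<or> p + 2 \<le> r \<and> r \<le> N"
    and "\<And>p' r'. (p', r') \<in> T \<Longrightarrow>
      \<not> (p < p' \<and> p' < r \<and> r < r') \<and> \<not> (p' < p \<and> p < r' \<and> r' < r)"
  proof -
    have "\<forall>b\<in>T. \<not> crosses (p, r) b" using that(4) by auto
    moreover have "(p, r) \<in> arcs N" using that(1-3) by (simp add: arcs_def)
    ultimately show ?thesis using assms unfolding triangulation_def by blast
  qed
qed

text \<open>No arc can cross these two, so maximality puts them in. In the annulus they bound the
  triangle that rests on the inner boundary.\<close>

lemma sides_in_triangulation: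
  assumes "triangulation N T" "N \<ge> 2"
  shows "(0, N + 2) \<in> T" "(N, N + 2) \<in> T"
proof -
  have *: "\<not> (0 < p \<and> p < N + 2 \<and> N + 2 < r) \<and> \<not> (p < 0 \<and> 0 < r \<and> r < N + 2)"
    "\<not> (N < p \<and> p < N + 2 \<and> N + 2 < r) \<and> \<not> (p < N \<and> N < r \<and> r < N + 2)"
    if "(p, r) \<in> T" for p r
    using triangulationD(1)[OF assms(1) that] by auto
  show "(0, N + 2) \<in> T" "(N, N + 2) \<in> T"
    by (rule triangulationD(3)[OF assms(1)]; use * assms(2) in auto)+
qed

lemma edge_bounds:
  assumes "triangulation N T" "edge N T (p, r)"
  shows "0 \<le> p \<and> p \<le> N \<and> (r = N + 2 \<or> r \<le> N) \<and> p < r"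
  using assms triangulationD(1)[OF assms(1), of p r] unfolding edge_def by auto

lemma edge_not_crossing:
  assumes "triangulation N T" "edge N T (p, r)" "(p', r') \<in> T"
  shows "\<not> (p < p' \<and> p' < r \<and> r < r')" "\<not> (p' < p \<and> p < r' \<and> r' < r)"
  using assms triangulationD(2)[OF assms(1), of p r p' r'] triangulationD(2)[OF assms(1), of p' r' p r]
  unfolding edge_def by auto

lemma edgeI:
  assumes "triangulation N T" "0 \<le> p" "p < r" "r \<le> N"
    and "\<And>p' r'. (p', r') \<in> T \<Longrightarrow>
      \<not> (p < p' \<and> p' < r \<and> r < r') \<and> \<not> (p' < p \<and> p < r' \<and> r' < r)"
  shows "edge N T (p, r)"
proof (cases "r = p + 1")
  case False
  then show ?thesis
    unfolding edge_def using assms by (intro disjI1, intro triangulationD(3)[OF assms(1)]) auto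
qed (use assms in \<open>auto simp: edge_def\<close>)

text \<open>The third vertex is the largest m below r that is joined to p. An arc crossing (m, r)
  but neither (p, m) nor (p, r) would start at p and end between m and r, against the choice of m.
  The side with p = N is excluded: below it lies only the inner boundary.\<close>

lemma lower_triangle:
  assumes T: "triangulation N T" and pr: "(p, r) \<in> T" and "p < N"
  shows "\<exists>m. p < m \<and> m < r \<and> m \<le> N \<and> edge N T (p, m) \<and> edge N T (m, r)"
proof -
  have b: "0 \<le> p" "r = N + 2 \<or> p + 2 \<le> r \<and> r \<le> N" using triangulationD(1)[OF T pr] by auto
  let ?M = "{m. p < m \<and> m < r \<and> m \<le> N \<and> edge N T (p, m)}"
  have "finite ?M" by (rule finite_subset[of _ "{p..r}"]) auto
  moreover have "p + 1 \<in> ?M" using b \<open>p < N\<close> by (auto simp: edge_def)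
  moreover define m where "m = Max ?M"
  ultimately have m: "m \<in> ?M" and max: "\<And>m'. m' \<in> ?M \<Longrightarrow> m' \<le> m"
    using Max_in[of ?M] Max_ge[of ?M] by blast+
  have nc: "\<not> (m < c \<and> c < r \<and> r < d) \<and> \<not> (c < m \<and> m < d \<and> d < r)" if cd: "(c, d) \<in> T" for c d
    using edge_not_crossing[OF T _ cd, of p m] m edge_not_crossing[OF T _ cd, of p r] pr
      max[of d] cd triangulationD(1)[OF T cd] b(2) by (auto simp: edge_def)
  have "edge N T (m, r)"
  proof (cases "r = N + 2")
    case True
    then show ?thesis
      unfolding edge_def using nc m b by (intro disjI1, intro triangulationD(3)[OF T]) auto
  next
    case False
    then show ?thesis using nc m b by (intro edgeI[OF T]) auto
  qed
  with m show ?thesis by blast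
qed

text \<open>One triangle at (p, r) is its lower triangle. The other is the lower triangle of the
  shortest arc of T enclosing (p, r): by minimality (p, r) must be one of its two lower
  sides.\<close>

lemma quadrilateral:
  assumes T: "triangulation N T" and "N \<ge> 2" and pr: "(p, r) \<in> T" and "(p, r) \<noteq> (0, N + 2)" "(p, r) \<noteq> (N, N + 2)"
  shows "\<exists>i j k l. i < j \<and> j < k \<and> k < l \<and> k \<le> N \<and>
    edge N T (i, j) \<and> edge N T (j, k) \<and> edge N T (k, l) \<and> edge N T (i, l) \<and> ((p, r) = (i, k) \<or> (p, r) = (j, l))"
proof -
  have b: "0 \<le> p" "p < N" "r = N + 2 \<or> p + 2 \<le> r \<and> r \<le> N"
    using triangulationD(1)[OF T pr] assms(5) by auto
  have side: "(0, N + 2) \<in> T" using sides_in_triangulation[OF T] assms(2) by auto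
  obtain m where m: "p < m" "m < r" "m \<le> N" "edge N T (p, m)" "edge N T (m, r)"
    using lower_triangle[OF T pr b(2)] by blast
  define enc where "enc = (\<lambda>(c, d). (c, d) \<in> T \<and> c \<le> p \<and> r \<le> d \<and> (c, d) \<noteq> (p, r))"
  have "enc (0, N + 2)" using side assms(4) b by (auto simp: enc_def)
  then obtain e where e: "enc e" and min: "\<And>e'. enc e' \<Longrightarrow> nat (snd e - fst e) \<le> nat (snd e' - fst e')"
    using ex_has_least_nat[of enc _ "\<lambda>e. nat (snd e - fst e)"] by blast
  obtain c d where [simp]: "e = (c, d)" by fastforce
  have cd: "(c, d) \<in> T" "c \<le> p" "r \<le> d" "(c, d) \<noteq> (p, r)" using e by (auto simp: enc_def)
  have bcd: "0 \<le> c" "d \<le> N + 2" using triangulationD(1)[OF T cd(1)] by auto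
  obtain v where v: "c < v" "v < d" "v \<le> N" "edge N T (c, v)" "edge N T (v, d)"
    using lower_triangle[OF T cd(1)] cd b by auto
  \<comment> \<open>Otherwise a side from v to c or to d would cross (p, r).\<close>
  have "v \<le> p \<or> r \<le> v"
    using edge_not_crossing[OF T v(4) pr] edge_not_crossing[OF T v(5) pr] cd v by auto
  then show ?thesis
  proof
    assume vp: "v \<le> p"
    have "(v, d) \<in> T" using v(5) vp m cd unfolding edge_def by auto
    have "(v, d) = (p, r)"
    proof (rule ccontr)
      assume "(v, d) \<noteq> (p, r)"
      then have "enc (v, d)" using \<open>(v, d) \<in> T\<close> vp cd by (simp add: enc_def)
      from min[OF this] show False using v by simp
    qed
    then show ?thesis using v m cd unfolding edge_def by blast
  next
    assume rv: "r \<le> v"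
    have "(c, v) \<in> T" using v(4) rv m cd unfolding edge_def by auto
    have "(c, v) = (p, r)"
    proof (rule ccontr)
      assume "(c, v) \<noteq> (p, r)"
      then have "enc (c, v)" using \<open>(c, v) \<in> T\<close> rv cd by (simp add: enc_def)
      from min[OF this] show False using v by simp
    qed
    then show ?thesis using v m cd unfolding edge_def by blast
  qed
qed

text \<open>An arc that enters the quadrilateral across one diagonal cannot leave it through a side,
  so its ends are the vertices of the other diagonal.\<close>

lemma flip_unique:
  assumes "i < j" "j < k" "k < l"
    and s: "\<not> crosses (i, j) (p, r)" "\<not> crosses (j, k) (p, r)" "\<not> crosses (k, l) (p, r)" "\<not> crosses (i, l) (p, r)"
  shows "crosses (j, l) (p, r) \<Longrightarrow> (p, r) = (i, k)"
    and "crosses (i, k) (p, r) \<Longrightarrow> (p, r) = (j, l)"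
proof -
  assume "crosses (j, l) (p, r)"
  then consider "j < p" "p < l" "l < r" | "p < j" "j < r" "r < l" by auto
  then show "(p, r) = (i, k)"
  proof cases
    case 2
    have "i \<le> p" using 2 s(4) assms(1) by simp
    moreover have "p \<le> i" using 2 s(1) by simp
    moreover have "k \<le> r" using 2 s(2) by simp
    moreover have "r \<le> k" using 2 s(3) assms by simp
    ultimately show ?thesis by simp
  qed (use s(4) assms in simp)
next
  assume "crosses (i, k) (p, r)"
  then consider "i < p" "p < k" "k < r" | "p < i" "i < r" "r < k" by auto
  then show "(p, r) = (j, l)"
  proof cases
    case 1
    have "r \<le> l" using 1 s(4) assms by simp
    moreover have "l \<le> r" using 1 s(3) by simp
    moreover have "j \<le> p" using 1 s(1) assms by simp
    moreover have "p \<le> j" using 1 s(2) by simp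
    ultimately show ?thesis by simp
  qed (use s(4) assms in simp)
qed
lemma crosses_commute: "crosses a b \<longleftrightarrow> crosses b a"
  by (cases a; cases b) auto

lemma crosses_self [simp]: "\<not> crosses a a"
  by (cases a) auto

lemma not_crosses_edge: "triangulation N T \<Longrightarrow> edge N T a \<Longrightarrow> b \<in> T \<Longrightarrow> \<not> crosses a b"
  using edge_not_crossing by (cases a; cases b) auto

lemma triangulation_flip:
  assumes T: "triangulation N T" and x: "x \<in> T" and ijkl: "i < j" "j < k" "k < l" "k \<le> N"
    and e: "edge N T (i, j)" "edge N T (j, k)" "edge N T (k, l)" "edge N T (i, l)"
    and xy: "x = (i, k) \<and> y = (j, l) \<or> x = (j, l) \<and> y = (i, k)"
  shows "triangulation N (insert y (T - {x}))"
proof -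
  have bounds: "0 \<le> i" "l = N + 2 \<or> l \<le> N" using edge_bounds[OF T e(4)] by auto
  then have y: "y \<in> arcs N" using xy ijkl by (auto simp: arcs_def)
  have y_nc: "\<not> crosses y z" if "z \<in> T" "z \<noteq> x" for z
  proof -
    obtain c d where z: "z = (c, d)" by fastforce
    show ?thesis
      using flip_unique[OF ijkl(1-3) e[THEN not_crosses_edge[OF T], OF that(1)[unfolded z]]] xy that(2)
      unfolding z by blast
  qed
  have max: "a \<in> insert y (T - {x})" if a: "a \<in> arcs N" and nc: "\<forall>b\<in>insert y (T - {x}). \<not> crosses a b" for a
  proof (cases "crosses x a")
    case True
    have side: "\<not> crosses c a" if c: "edge N T c" "c \<noteq> x" for c
    proof (cases "c \<in> T")
      case True
      then show ?thesis using nc c crosses_commute by blast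
    next
      case False
      then show ?thesis using c by (cases a) (auto simp: edge_def)
    qed
    have "a = y"
      using flip_unique[OF ijkl(1-3), of "fst a" "snd a"] side[OF e(1)] side[OF e(2)] side[OF e(3)] side[OF e(4)]
        True xy ijkl(1-3) by auto
    then show ?thesis by simp
  next
    case False
    then have "\<forall>b\<in>T. \<not> crosses a b" using nc crosses_commute by blast
    then have "a \<in> T" using T a unfolding triangulation_def by blast
    moreover have "crosses x y" using xy ijkl by auto
    then have "a \<noteq> x" using nc by blast
    ultimately show ?thesis by blast
  qed
  show ?thesis
    unfolding triangulation_def
  proof (intro conjI)
    show "insert y (T - {x}) \<subseteq> arcs N" using T y unfolding triangulation_def by blast
    show "\<forall>a\<in>insert y (T - {x}). \<forall>b\<in>insert y (T - {x}). \<not> crosses a b"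
      using y_nc T crosses_commute crosses_self unfolding triangulation_def by (metis Diff_iff insert_iff)
  qed (use max in blast)
qed

text \<open>The common pattern of the two moves of the cut: the side t is traded for the side t', Z
  collects the arcs whose indices are merely rewritten by f, and the last assumption allows
  maximality to be pulled back along f.\<close>

lemma triangulation_transport:
  assumes T: "triangulation N T"
    and Z: "T - {t} \<subseteq> Z" "t \<notin> Z" "Z \<subseteq> arcs N"
    and f: "\<And>a. a \<in> Z \<Longrightarrow> f a \<in> arcs N" "\<And>a b. \<lbrakk>a \<in> Z; b \<in> Z\<rbrakk> \<Longrightarrow> crosses (f a) (f b) \<longleftrightarrow> crosses a b"
    and t: "\<And>a. a \<in> arcs N \<Longrightarrow> \<not> crosses a t"
    and t': "t' \<in> arcs N" "\<And>a. a \<in> arcs N \<Longrightarrow> \<not> crosses a t'"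
    and sur: "\<And>a. \<lbrakk>a \<in> arcs N; a \<noteq> t'; \<And>b. b \<in> T - {t} \<Longrightarrow> \<not> crosses a (f b)\<rbrakk> \<Longrightarrow> a \<in> f ` Z"
  shows "triangulation N (insert t' (f ` (T - {t})))"
  unfolding triangulation_def
proof (intro conjI ballI impI)
  show "insert t' (f ` (T - {t})) \<subseteq> arcs N" using Z f(1) t'(1) by blast
  fix a b assume "a \<in> insert t' (f ` (T - {t}))" "b \<in> insert t' (f ` (T - {t}))"
  moreover have "\<not> crosses (f a) (f b)" if "a \<in> T - {t}" "b \<in> T - {t}" for a b
    using f(2)[of a b] that Z(1) T unfolding triangulation_def by blast
  moreover have "\<not> crosses (f a) t'" "\<not> crosses t' (f a)" if "a \<in> T - {t}" for a
    using t'(2)[of "f a"] crosses_commute f(1) Z(1) that by blast+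
  ultimately show "\<not> crosses a b" using crosses_self by blast
next
  fix a assume a: "a \<in> arcs N" and nc: "\<forall>b\<in>insert t' (f ` (T - {t})). \<not> crosses a b"
  show "a \<in> insert t' (f ` (T - {t}))"
  proof (cases "a = t'")
    case False
    then obtain c where c: "c \<in> Z" "a = f c" using sur[OF a] nc by blast
    have "\<not> crosses c b" if "b \<in> T" for b
    proof (cases "b = t")
      case True
      then show ?thesis using t c Z(3) by blast
    next
      case False
      then show ?thesis using nc f(2)[OF c(1), of b] that Z(1) c(2) by blast
    qed
    then have "c \<in> T" using T c Z(3) unfolding triangulation_def by blast
    then show ?thesis using c Z(2) by blast
  qed simp
qed

section \<open>Moving the cut when a side of the polygon is flipped\<close>

fun rotate_up :: "int \<Rightarrow> int \<Rightarrow> int \<times> int \<Rightarrow> int \<times> int" where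
  "rotate_up N b (p, r) =
     (if r = N + 2 then (p - b, r) else if r \<le> b then (p - b + N, r - b + N) else (p - b, r - b))"

text \<open>The two maps rewrite indices for the base points a + b and a + b - N in place of a.
  Bridging arcs keep their lift of the inner point and are just translated. Arcs between outer
  points have period N, so those on one side of b are shifted by N to land in [0, N] again.\<close>

fun rotate_down :: "int \<Rightarrow> int \<Rightarrow> int \<times> int \<Rightarrow> int \<times> int" where
  "rotate_down N b (p, r) =
     (if r = N + 2 then (p - b + N, r) else if r \<le> b then (p - b + N, r - b + N) else (p - b, r - b))"

text \<open>The neighbour of the side (0, N + 2) in the fan at the inner vertex: 0, b and the inner
  vertex span the triangle at that side. \<open>last_bridge\<close> does the same for the side (N, N
  + 2).\<close>

definition first_bridge :: "int \<Rightarrow> (int \<times> int) set \<Rightarrow> int \<Rightarrow> bool" where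
  "first_bridge N T b \<longleftrightarrow> 0 < b \<and> (b, N + 2) \<in> T \<and> (\<forall>p. (p, N + 2) \<in> T \<longrightarrow> p = 0 \<or> b \<le> p)"

definition last_bridge :: "int \<Rightarrow> (int \<times> int) set \<Rightarrow> int \<Rightarrow> bool" where
  "last_bridge N T b \<longleftrightarrow> b < N \<and> (b, N + 2) \<in> T \<and> (\<forall>p. (p, N + 2) \<in> T \<longrightarrow> p = N \<or> p \<le> b)"

lemma bridges_exist:
  assumes "triangulation N T" "N \<ge> 2"
  shows "\<exists>b. first_bridge N T b" "\<exists>b. last_bridge N T b"
proof -
  have ends: "(0, N + 2) \<in> T" "(N, N + 2) \<in> T" using sides_in_triangulation[OF assms] .
  have fin: "finite {p. (p, N + 2) \<in> T \<and> Q p}" for Q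
  proof (rule finite_subset)
    show "{p. (p, N + 2) \<in> T \<and> Q p} \<subseteq> {0..N}"
    proof
      fix p assume "p \<in> {p. (p, N + 2) \<in> T \<and> Q p}"
      then have "(p, N + 2) \<in> T" by simp
      from triangulationD(1)[OF assms(1) this] show "p \<in> {0..N}" by simp
    qed
  qed simp
  define b where "b = Min {p. (p, N + 2) \<in> T \<and> p \<noteq> 0}"
  have "b \<in> {p. (p, N + 2) \<in> T \<and> p \<noteq> 0}" unfolding b_def using ends assms(2) by (intro Min_in fin) auto
  moreover have "b \<le> p" if "(p, N + 2) \<in> T" "p \<noteq> 0" for p unfolding b_def using that by (intro Min_le fin) auto
  ultimately have "first_bridge N T b"
    using triangulationD(1)[OF assms(1), of b "N + 2"] unfolding first_bridge_def by fastforce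
  then show "\<exists>b. first_bridge N T b" ..
  define c where "c = Max {p. (p, N + 2) \<in> T \<and> p \<noteq> N}"
  have "c \<in> {p. (p, N + 2) \<in> T \<and> p \<noteq> N}" unfolding c_def using ends assms(2) by (intro Max_in fin) auto
  moreover have "p \<le> c" if "(p, N + 2) \<in> T" "p \<noteq> N" for p unfolding c_def using that by (intro Max_ge fin) auto
  ultimately have "last_bridge N T c"
    using triangulationD(1)[OF assms(1), of c "N + 2"] unfolding last_bridge_def by fastforce
  then show "\<exists>b. last_bridge N T b" ..
qed

text \<open>The arcs that do not cross the bridge at b and are not bridges before b; for a first
  bridge these include all of the triangulation except the flipped side.\<close>

definition zone_up :: "int \<Rightarrow> int \<Rightarrow> (int \<times> int) set" where
  "zone_up N b = {(p, r). r = N + 2 \<and> b \<le> p \<and> p \<le> N \<or> 0 \<le> p \<and> p + 2 \<le> r \<and> r \<le> b \<or> b \<le> p \<and> p + 2 \<le> r \<and> r \<le> N}"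

definition zone_down :: "int \<Rightarrow> int \<Rightarrow> (int \<times> int) set" where
  "zone_down N b = {(p, r). r = N + 2 \<and> 0 \<le> p \<and> p \<le> b \<or> 0 \<le> p \<and> p + 2 \<le> r \<and> r \<le> b \<or> b \<le> p \<and> p + 2 \<le> r \<and> r \<le> N}"

lemma first_bridge_bounds:
  assumes "triangulation N T" "first_bridge N T b"
  shows "0 < b" "b \<le> N" "(b, N + 2) \<in> T" "T - {(0, N + 2)} \<subseteq> zone_up N b"
proof -
  show b: "0 < b" "b \<le> N" "(b, N + 2) \<in> T"
    using assms triangulationD(1)[OF assms(1), of b "N + 2"] unfolding first_bridge_def by auto
  have "(p, r) \<in> zone_up N b" if "(p, r) \<in> T" "(p, r) \<noteq> (0, N + 2)" for p r
    using triangulationD(1)[OF assms(1) that(1)] triangulationD(2)[OF assms(1) that(1) b(3)] that assms(2)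
    unfolding first_bridge_def zone_up_def by auto
  then show "T - {(0, N + 2)} \<subseteq> zone_up N b" by auto
qed

lemma last_bridge_bounds:
  assumes "triangulation N T" "last_bridge N T b"
  shows "0 \<le> b" "b < N" "(b, N + 2) \<in> T" "T - {(N, N + 2)} \<subseteq> zone_down N b"
proof -
  show b: "0 \<le> b" "b < N" "(b, N + 2) \<in> T"
    using assms triangulationD(1)[OF assms(1), of b "N + 2"] unfolding last_bridge_def by auto
  have "(p, r) \<in> zone_down N b" if "(p, r) \<in> T" "(p, r) \<noteq> (N, N + 2)" for p r
    using triangulationD(1)[OF assms(1) that(1)] triangulationD(2)[OF assms(1) that(1) b(3)] that assms(2)
    unfolding last_bridge_def zone_down_def by auto
  then show "T - {(N, N + 2)} \<subseteq> zone_down N b" by auto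
qed

lemma bridge_edges:
  assumes "triangulation N T"
  shows "first_bridge N T b \<Longrightarrow> edge N T (0, b)" "last_bridge N T b \<Longrightarrow> edge N T (b, N)"
proof -
  assume b: "first_bridge N T b"
  show "edge N T (0, b)"
  proof (rule edgeI[OF assms])
    fix p r assume "(p, r) \<in> T"
    then have "(p, r) = (0, N + 2) \<or> (p, r) \<in> zone_up N b" using first_bridge_bounds(4)[OF assms b] by blast
    then show "\<not> (0 < p \<and> p < b \<and> b < r) \<and> \<not> (p < 0 \<and> 0 < r \<and> r < b)" by (auto simp: zone_up_def)
  qed (use first_bridge_bounds[OF assms b] in auto)
next
  assume b: "last_bridge N T b"
  show "edge N T (b, N)"
  proof (rule edgeI[OF assms])
    fix p r assume "(p, r) \<in> T"
    then have "(p, r) = (N, N + 2) \<or> (p, r) \<in> zone_down N b" using last_bridge_bounds(4)[OF assms b] by blast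
    then show "\<not> (b < p \<and> p < N \<and> N < r) \<and> \<not> (p < b \<and> b < r \<and> r < N)" by (auto simp: zone_down_def)
  qed (use last_bridge_bounds[OF assms b] in auto)
qed

lemma rotate_cases:
  assumes "x \<in> zone_up N b \<union> zone_down N b" "0 \<le> b" "b \<le> N"
  obtains p where "x = (p, N + 2)" "0 \<le> p" "p \<le> N" "x \<in> zone_up N b \<Longrightarrow> b \<le> p" "x \<in> zone_down N b \<Longrightarrow> p \<le> b"
      "rotate_up N b x = (p - b, N + 2)" "rotate_down N b x = (p - b + N, N + 2)"
  | p r where "x = (p, r)" "0 \<le> p" "p + 2 \<le> r" "r \<le> b"
      "rotate_up N b x = (p - b + N, r - b + N)" "rotate_down N b x = (p - b + N, r - b + N)"
  | p r where "x = (p, r)" "b \<le> p" "p + 2 \<le> r" "r \<le> N"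
      "rotate_up N b x = (p - b, r - b)" "rotate_down N b x = (p - b, r - b)"
proof -
  obtain p r where x: "x = (p, r)" by fastforce
  consider "r = N + 2" | "0 \<le> p" "p + 2 \<le> r" "r \<le> b" | "b \<le> p" "p + 2 \<le> r" "r \<le> N"
    using assms(1) unfolding x zone_up_def zone_down_def by blast
  then show ?thesis
  proof cases
    case 1
    then show ?thesis using that(1)[of p] assms unfolding x zone_up_def zone_down_def by auto
  next
    case 2
    then show ?thesis using that(2)[of p r] assms(2,3) unfolding x by simp
  next
    case 3
    then show ?thesis using that(3)[of p r] assms(2,3) unfolding x by simp
  qed
qed

lemma rotate_up_crosses:
  assumes "0 < b" "b \<le> N" and x: "x \<in> zone_up N b" and y: "y \<in> zone_up N b"
  shows "crosses (rotate_up N b x) (rotate_up N b y) \<longleftrightarrow> crosses x y"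
proof -
  have b: "0 \<le> b" using assms by simp
  from UnI1[OF x] b assms(2) show ?thesis
  proof (cases rule: rotate_cases)
    case (1 p)
    from UnI1[OF y] b assms(2) show ?thesis by (cases rule: rotate_cases) (use 1 x y b assms(2) in auto)
  next
    case (2 p r)
    from UnI1[OF y] b assms(2) show ?thesis by (cases rule: rotate_cases) (use 2 y b assms(2) in auto)
  next
    case (3 p r)
    from UnI1[OF y] b assms(2) show ?thesis by (cases rule: rotate_cases) (use 3 y b assms(2) in auto)
  qed
qed

lemma rotate_down_crosses:
  assumes "0 \<le> b" "b < N" and x: "x \<in> zone_down N b" and y: "y \<in> zone_down N b"
  shows "crosses (rotate_down N b x) (rotate_down N b y) \<longleftrightarrow> crosses x y"
proof -
  have b: "b \<le> N" using assms by simp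
  from UnI2[OF x] assms(1) b show ?thesis
  proof (cases rule: rotate_cases)
    case (1 p)
    from UnI2[OF y] assms(1) b show ?thesis by (cases rule: rotate_cases) (use 1 x y b assms(1) in auto)
  next
    case (2 p r)
    from UnI2[OF y] assms(1) b show ?thesis by (cases rule: rotate_cases) (use 2 y b assms(1) in auto)
  next
    case (3 p r)
    from UnI2[OF y] assms(1) b show ?thesis by (cases rule: rotate_cases) (use 3 y b assms(1) in auto)
  qed
qed

lemma inj_on_rotate:
  assumes "0 \<le> b" "b \<le> N"
  shows "inj_on (rotate_up N b) (zone_up N b)" "inj_on (rotate_down N b) (zone_down N b)"
proof -
  have "x = y" if xy: "x \<in> zone_up N b \<union> zone_down N b" "y \<in> zone_up N b \<union> zone_down N b"
    and eq: "rotate_up N b x = rotate_up N b y \<or> rotate_down N b x = rotate_down N b y" for x y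
    using xy(1) assms
  proof (cases rule: rotate_cases)
    case (1 p)
    from xy(2) assms show ?thesis by (cases rule: rotate_cases) (use 1 eq assms in auto)
  next
    case (2 p r)
    from xy(2) assms show ?thesis by (cases rule: rotate_cases) (use 2 eq assms in auto)
  next
    case (3 p r)
    from xy(2) assms show ?thesis by (cases rule: rotate_cases) (use 3 eq assms in auto)
  qed
  then show "inj_on (rotate_up N b) (zone_up N b)" "inj_on (rotate_down N b) (zone_down N b)"
    unfolding inj_on_def by blast+
qed

lemma triangulation_rotate_up:
  assumes T: "triangulation N T" and N: "N \<ge> 2" and b: "first_bridge N T b"
  shows "triangulation N (insert (N, N + 2) (rotate_up N b ` (T - {(0, N + 2)})))"
proof (rule triangulation_transport[OF T first_bridge_bounds(4)[OF T b]])
  note bb = first_bridge_bounds[OF T b]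
  show "(0, N + 2) \<notin> zone_up N b" "zone_up N b \<subseteq> arcs N" "(N, N + 2) \<in> arcs N"
    "\<And>a. a \<in> arcs N \<Longrightarrow> \<not> crosses a (0, N + 2)" "\<And>a. a \<in> arcs N \<Longrightarrow> \<not> crosses a (N, N + 2)"
    "\<And>a. a \<in> zone_up N b \<Longrightarrow> rotate_up N b a \<in> arcs N"
    using bb(1,2) by (auto simp: zone_up_def arcs_def)
  show "\<And>x y. \<lbrakk>x \<in> zone_up N b; y \<in> zone_up N b\<rbrakk> \<Longrightarrow> crosses (rotate_up N b x) (rotate_up N b y) \<longleftrightarrow> crosses x y"
    by (rule rotate_up_crosses[OF bb(1,2)])
  fix a assume a: "a \<in> arcs N" "a \<noteq> (N, N + 2)"
    and nc: "\<And>c. c \<in> T - {(0, N + 2)} \<Longrightarrow> \<not> crosses a (rotate_up N b c)"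
  obtain p r where [simp]: "a = (p, r)" by fastforce
  \<comment> \<open>The old side (N, N + 2) has become the bridge at N - b, which separates the
    images of [b, N] and [0, b].\<close>
  have 1: "\<not> crosses a (N - b, N + 2)" using nc[of "(N, N + 2)"] bb N sides_in_triangulation[OF T N] by simp
  \<comment> \<open>A bridge beyond N - b would have to cross the image of the edge (0, b), unless
    it is the new side.\<close>
  have 2: "r = N + 2 \<Longrightarrow> p \<le> N - b"
  proof (rule ccontr)
    assume r: "r = N + 2" "\<not> p \<le> N - b"
    from bridge_edges(1)[OF T b] show False
      unfolding edge_def using nc[of "(0, b)"] r a bb by (auto simp: arcs_def)
  qed
  show "a \<in> rotate_up N b ` zone_up N b"
  proof (rule image_eqI)
    let ?c = "if r = N + 2 then (p + b, r) else if N - b \<le> p then (p + b - N, r + b - N) else (p + b, r + b)"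
    show "a = rotate_up N b ?c" "?c \<in> zone_up N b"
      using 1 2 a bb(1,2) by (auto simp: arcs_def zone_up_def)
  qed
qed

lemma triangulation_rotate_down:
  assumes T: "triangulation N T" and N: "N \<ge> 2" and b: "last_bridge N T b"
  shows "triangulation N (insert (0, N + 2) (rotate_down N b ` (T - {(N, N + 2)})))"
proof (rule triangulation_transport[OF T last_bridge_bounds(4)[OF T b]])
  note bb = last_bridge_bounds[OF T b]
  show "(N, N + 2) \<notin> zone_down N b" "zone_down N b \<subseteq> arcs N" "(0, N + 2) \<in> arcs N"
    "\<And>a. a \<in> arcs N \<Longrightarrow> \<not> crosses a (N, N + 2)" "\<And>a. a \<in> arcs N \<Longrightarrow> \<not> crosses a (0, N + 2)"
    "\<And>a. a \<in> zone_down N b \<Longrightarrow> rotate_down N b a \<in> arcs N"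
    using bb(1,2) by (auto simp: zone_down_def arcs_def)
  show "\<And>x y. \<lbrakk>x \<in> zone_down N b; y \<in> zone_down N b\<rbrakk> \<Longrightarrow> crosses (rotate_down N b x) (rotate_down N b y) \<longleftrightarrow> crosses x y"
    by (rule rotate_down_crosses[OF bb(1,2)])
  fix a assume a: "a \<in> arcs N" "a \<noteq> (0, N + 2)"
    and nc: "\<And>c. c \<in> T - {(N, N + 2)} \<Longrightarrow> \<not> crosses a (rotate_down N b c)"
  obtain p r where [simp]: "a = (p, r)" by fastforce
  have 1: "\<not> crosses a (N - b, N + 2)" using nc[of "(0, N + 2)"] bb N sides_in_triangulation[OF T N] by simp
  have 2: "r = N + 2 \<Longrightarrow> N - b \<le> p"
  proof (rule ccontr)
    assume r: "r = N + 2" "\<not> N - b \<le> p"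
    from bridge_edges(2)[OF T b] show False
      unfolding edge_def using nc[of "(b, N)"] r a bb by (auto simp: arcs_def)
  qed
  show "a \<in> rotate_down N b ` zone_down N b"
  proof (rule image_eqI)
    let ?c = "if r = N + 2 then (p + b - N, r) else if N - b \<le> p then (p + b - N, r + b - N) else (p + b, r + b)"
    show "a = rotate_down N b ?c" "?c \<in> zone_down N b"
      using 1 2 a bb(1,2) by (auto simp: arcs_def zone_down_def)
  qed
qed

section \<open>Seeds labelled by arcs\<close>

context quantum_seeds
begin

text \<open>Kept generic in labels and form: the same exchange lemma then serves ordinary
  quadrilaterals and the one at the inner boundary.\<close>

definition labelled ::
    "('a \<Rightarrow> 'd) \<Rightarrow> ('a \<Rightarrow> 'a \<Rightarrow> int) \<Rightarrow> (nat \<Rightarrow> 'a) \<Rightarrow> 'd quantum_seed \<Rightarrow> bool" where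
  "labelled E lam \<sigma> S \<longleftrightarrow> compatible S \<and> inj_on \<sigma> {..n} \<and>
     (\<forall>i\<le>n. cluster S i = E (\<sigma> i)) \<and> (\<forall>i\<le>n. \<forall>j\<le>n. quasi S i j = lam (\<sigma> i) (\<sigma> j))"

lemma labelledD:
  assumes "labelled E lam \<sigma> S"
  shows "compatible S" "inj_on \<sigma> {..n}" "i \<le> n \<Longrightarrow> cluster S i = E (\<sigma> i)"
    "\<lbrakk>i \<le> n; j \<le> n\<rbrakk> \<Longrightarrow> quasi S i j = lam (\<sigma> i) (\<sigma> j)"
  using assms unfolding labelled_def by blast+

text \<open>Models boundary edges, which may occur as sides of a quadrilateral without being cluster
  variables.\<close>

definition inessential :: "('a \<Rightarrow> 'd) \<Rightarrow> ('a \<Rightarrow> 'a \<Rightarrow> int) \<Rightarrow> 'a \<Rightarrow> bool" where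
  "inessential E lam a \<longleftrightarrow> E a = 1 \<and> (\<forall>b. lam a b = 0 \<and> lam b a = 0)"

text \<open>A label that occurs in no position gets the zero vector, so boundary edges need no
  separate treatment in monomials and pairings.\<close>

definition label_vec :: "(nat \<Rightarrow> 'a) \<Rightarrow> 'a \<Rightarrow> nat \<Rightarrow> int" where
  "label_vec \<sigma> a i = of_bool (\<sigma> i = a)"

lemma sum_label_vec:
  assumes "inj_on \<sigma> {..n}"
  shows "(\<Sum>i\<le>n. label_vec \<sigma> a i * g (\<sigma> i)) = (if a \<in> \<sigma> ` {..n} then g a else 0)"
proof (cases "a \<in> \<sigma> ` {..n}")
  case True
  then obtain k where k: "k \<le> n" "a = \<sigma> k" by auto
  have "(\<Sum>i\<le>n. label_vec \<sigma> a i * g (\<sigma> i)) = (\<Sum>i\<le>n. if i = k then g a else 0)"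
    using assms k by (intro sum.cong refl) (auto simp: label_vec_def inj_on_eq_iff)
  then show ?thesis using k True by simp
next
  case False
  have "(\<Sum>i\<le>n. label_vec \<sigma> a i * g (\<sigma> i)) = 0"
    using False by (intro sum.neutral) (auto simp: label_vec_def)
  then show ?thesis using False by simp
qed

lemma pairing_label_vec:
  assumes S: "labelled E lam \<sigma> S"
    and b: "b \<in> \<sigma> ` {..n} \<or> inessential E lam b"
  shows "a \<in> \<sigma> ` {..n} \<or> inessential E lam a \<Longrightarrow> pairing S (label_vec \<sigma> a) (label_vec \<sigma> b) = lam a b"
    and "k \<le> n \<Longrightarrow> pairing S (unit_vec k) (label_vec \<sigma> b) = lam (\<sigma> k) b"
proof -
  have inner: "(\<Sum>j\<le>n. label_vec \<sigma> b j * quasi S i j) = lam (\<sigma> i) b" if "i \<le> n" for i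
  proof -
    have "(\<Sum>j\<le>n. label_vec \<sigma> b j * quasi S i j) = (\<Sum>j\<le>n. label_vec \<sigma> b j * lam (\<sigma> i) (\<sigma> j))"
      using labelledD(4)[OF S that] by (intro sum.cong refl) auto
    then show ?thesis using sum_label_vec[OF labelledD(2)[OF S], of b "lam (\<sigma> i)"] b
      by (auto simp: inessential_def)
  qed
  show "k \<le> n \<Longrightarrow> pairing S (unit_vec k) (label_vec \<sigma> b) = lam (\<sigma> k) b"
    using inner by (simp add: pairing_unit_left)
  assume a: "a \<in> \<sigma> ` {..n} \<or> inessential E lam a"
  have "pairing S (label_vec \<sigma> a) (label_vec \<sigma> b) = (\<Sum>i\<le>n. label_vec \<sigma> a i * (\<Sum>j\<le>n. label_vec \<sigma> b j * quasi S i j))"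
    by (simp add: pairing_def sum_distrib_left mult.assoc)
  also have "\<dots> = (\<Sum>i\<le>n. label_vec \<sigma> a i * lam (\<sigma> i) b)"
    using inner by (intro sum.cong refl) auto
  also have "\<dots> = lam a b"
    using sum_label_vec[OF labelledD(2)[OF S], of a "\<lambda>x. lam x b"] a by (auto simp: inessential_def)
  finally show "pairing S (label_vec \<sigma> a) (label_vec \<sigma> b) = lam a b" .
qed

lemma monomial_label_vec:
  assumes S: "labelled E lam \<sigma> S" and a: "a \<in> \<sigma> ` {..n} \<or> inessential E lam a"
  shows "monomial S (label_vec \<sigma> a) = E a"
proof (cases "a \<in> \<sigma> ` {..n}")
  case True
  then obtain k where k: "k \<le> n" "a = \<sigma> k" by auto
  have "monomial S (label_vec \<sigma> a) = monomial S (unit_vec k)"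
    using labelledD(2)[OF S] k by (intro monomial_cong) (auto simp: label_vec_def unit_vec_def inj_on_eq_iff)
  then show ?thesis using k labelledD(3)[OF S] by (simp add: monomial_unit)
next
  case False
  have "monomial S (label_vec \<sigma> a) = monomial S (\<lambda>_. 0)"
    using False by (intro monomial_cong) (auto simp: label_vec_def)
  then show ?thesis using a False by (simp add: inessential_def)
qed

lemma pairing_cong:
  "(\<And>i. i \<le> n \<Longrightarrow> c i = c' i) \<Longrightarrow> (\<And>i. i \<le> n \<Longrightarrow> d i = d' i) \<Longrightarrow> pairing S c d = pairing S c' d'"
  unfolding pairing_def by (intro sum.cong refl) auto

text \<open>The balance condition says that a + b - c - d pairs with the cluster as column k of B
  does, so \<open>exch_column_unique\<close> identifies the two. Disjointness rules out
  cancellation, hence a + b and c + d are the positive and negative parts, and the exchange relation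
  becomes explicit on either side of the old variable.\<close>

lemma labelled_exchange:
  assumes S: "labelled E lam \<sigma> S" and k: "k \<le> n"
    and ess': "\<forall>x\<in>{a, b, c, d}. x \<in> \<sigma> ` {..n} \<or> inessential E lam x"
    and disj: "{a, b} \<inter> {c, d} \<inter> \<sigma> ` {..n} = {}"
    and bal': "\<forall>z\<in>\<sigma> ` {..n}. lam a z + lam b z - lam c z - lam d z = (if z = \<sigma> k then 2 else 0)"
  defines "x \<equiv> \<sigma> k" and "S' \<equiv> mutate n \<iota> s k S"
  shows "E x * cluster S' k = sp (lam x a + lam x b - lam a b) * (E a * E b) + sp (lam x c + lam x d - lam c d) * (E c * E d)"
    and "cluster S' k * E x = sp (- lam x a - lam x b - lam a b) * (E a * E b) + sp (- lam x c - lam x d - lam c d) * (E c * E d)"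
    and "\<lbrakk>j \<le> n; j \<noteq> k\<rbrakk> \<Longrightarrow> quasi S' k j = - lam x (\<sigma> j) + lam c (\<sigma> j) + lam d (\<sigma> j)"
proof -
  let ?v = "label_vec \<sigma>"
  note cS = labelledD(1)[OF S] and inj = labelledD(2)[OF S]
  note ess = bspec[OF ess'] and bal = bspec[OF bal']
  have sumv: "(\<Sum>i\<le>n. ?v y i * quasi S i j) = lam y (\<sigma> j)" if "y \<in> {a, b, c, d}" "j \<le> n" for y j
  proof -
    have "(\<Sum>i\<le>n. ?v y i * quasi S i j) = (\<Sum>i\<le>n. ?v y i * lam (\<sigma> i) (\<sigma> j))"
      using labelledD(4)[OF S _ that(2)] by (intro sum.cong refl) auto
    then show ?thesis
      using sum_label_vec[OF inj, of y "\<lambda>z. lam z (\<sigma> j)"] ess[OF that(1)] by (auto simp: inessential_def)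
  qed
  have col: "exch S m k = ?v a m + ?v b m - ?v c m - ?v d m" if "m \<le> n" for m
  proof (rule exch_column_unique[OF cS k that])
    fix j assume j: "j \<le> n"
    have "(\<Sum>i\<le>n. (?v a i + ?v b i - ?v c i - ?v d i) * quasi S i j) =
        lam a (\<sigma> j) + lam b (\<sigma> j) - lam c (\<sigma> j) - lam d (\<sigma> j)"
      using sumv j by (simp add: left_diff_distrib distrib_right sum.distrib sum_subtractf)
    also have "\<dots> = (if j = k then 2 else 0)"
      using bal[of "\<sigma> j"] j k inj by (auto simp: inj_on_eq_iff)
    finally show "(\<Sum>i\<le>n. (?v a i + ?v b i - ?v c i - ?v d i) * quasi S i j) = (if j = k then 2 else 0)" .
  qed
  have nonneg: "?v y i \<ge> 0" for y i by (simp add: label_vec_def)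
  have dis: "?v a m + ?v b m = 0 \<or> ?v c m + ?v d m = 0" if "m \<le> n" for m
    using disj that by (auto simp: label_vec_def)
  have pos: "pos_part S k m = ?v a m + ?v b m" and neg: "neg_part S k m = ?v c m + ?v d m" if "m \<le> n" for m
    using col[OF that] dis[OF that] nonneg[of a m] nonneg[of b m] nonneg[of c m] nonneg[of d m]
    unfolding pos_part_def neg_part_def by linarith+
  have mono2: "monomial S (\<lambda>i. ?v y i + ?v z i) = sp (- lam y z) * (E y * E z)"
    if "y \<in> {a, b, c, d}" "z \<in> {a, b, c, d}" for y z
    using monomial_mult[OF compatibleD(1)[OF cS], of "?v y" "?v z"] ess[OF that(1)] ess[OF that(2)]
    by (simp add: monomial_label_vec[OF S] pairing_label_vec[OF S] sp_mult_left)
  have pair2: "pairing S (unit_vec k) (\<lambda>i. ?v y i + ?v z i) = lam x y + lam x z"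
    if "y \<in> {a, b, c, d}" "z \<in> {a, b, c, d}" for y z
    using ess[OF that(1)] ess[OF that(2)] k by (simp add: pairing_add pairing_label_vec[OF S] x_def)
  have mp: "monomial S (pos_part S k) = sp (- lam a b) * (E a * E b)"
    "monomial S (neg_part S k) = sp (- lam c d) * (E c * E d)"
    using mono2[of a b] mono2[of c d] monomial_cong[of "pos_part S k" "\<lambda>i. ?v a i + ?v b i", OF pos]
      monomial_cong[of "neg_part S k" "\<lambda>i. ?v c i + ?v d i", OF neg] by simp_all
  have pp: "pairing S (unit_vec k) (pos_part S k) = lam x a + lam x b"
    "pairing S (unit_vec k) (neg_part S k) = lam x c + lam x d"
    using pair2[of a b] pair2[of c d] pairing_cong[of "unit_vec k" "unit_vec k" "pos_part S k" "\<lambda>i. ?v a i + ?v b i", OF refl pos]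
      pairing_cong[of "unit_vec k" "unit_vec k" "neg_part S k" "\<lambda>i. ?v c i + ?v d i", OF refl neg] by simp_all
  have X: "cluster S k = E x" using labelledD(3)[OF S k] by (simp add: x_def)
  show "E x * cluster S' k = sp (lam x a + lam x b - lam a b) * (E a * E b) + sp (lam x c + lam x d - lam c d) * (E c * E d)"
    using exchange_relation(1)[OF cS k] by (simp add: mp pp X S'_def sp_mult_left)
  show "cluster S' k * E x = sp (- lam x a - lam x b - lam a b) * (E a * E b) + sp (- lam x c - lam x d - lam c d) * (E c * E d)"
    using exchange_relation(2)[OF cS k] by (simp add: mp pp X S'_def sp_mult_left)
  assume j: "j \<le> n" "j \<noteq> k"
  have "(\<Sum>i\<le>n. neg_part S k i * quasi S i j) = (\<Sum>i\<le>n. (?v c i + ?v d i) * quasi S i j)"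
    using neg by (intro sum.cong refl) auto
  also have "\<dots> = lam c (\<sigma> j) + lam d (\<sigma> j)"
    using sumv j by (simp add: distrib_right sum.distrib)
  finally show "quasi S' k j = - lam x (\<sigma> j) + lam c (\<sigma> j) + lam d (\<sigma> j)"
    using mutate_quasi_row[OF cS k j] labelledD(4)[OF S k j(1)] by (simp add: x_def S'_def)
qed

lemma labelled_mutate:
  assumes S: "labelled E lam \<sigma> S" and k: "k \<le> n" and inj: "inj_on \<sigma>' {..n}"
    and skew: "\<And>x y. lam x y = - lam y x"
    and var: "cluster (mutate n \<iota> s k S) k = E' (\<sigma>' k)"
    and row: "\<And>j. \<lbrakk>j \<le> n; j \<noteq> k\<rbrakk> \<Longrightarrow> quasi (mutate n \<iota> s k S) k j = lam (\<sigma>' k) (\<sigma>' j)"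
    and old: "\<And>i. \<lbrakk>i \<le> n; i \<noteq> k\<rbrakk> \<Longrightarrow> E' (\<sigma>' i) = E (\<sigma> i)"
    and old_lam: "\<And>i j. \<lbrakk>i \<le> n; i \<noteq> k; j \<le> n; j \<noteq> k\<rbrakk> \<Longrightarrow> lam (\<sigma>' i) (\<sigma>' j) = lam (\<sigma> i) (\<sigma> j)"
  shows "labelled E' lam \<sigma>' (mutate n \<iota> s k S)"
proof -
  let ?S = "mutate n \<iota> s k S"
  have comp: "compatible ?S" by (rule compatible_mutate[OF labelledD(1)[OF S] k])
  have sk: "quasi ?S i j = - quasi ?S j i" for i j
    by (rule mutate_quasi_skew[OF compatibleD(1)[OF labelledD(1)[OF S]]])
  have "cluster ?S i = E' (\<sigma>' i)" if "i \<le> n" for i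
    using that var old labelledD(3)[OF S that] by (cases "i = k") (auto simp: mutate_other)
  moreover have "quasi ?S i j = lam (\<sigma>' i) (\<sigma>' j)" if ij: "i \<le> n" "j \<le> n" for i j
  proof -
    consider "i = k" "j = k" | "i = k" "j \<noteq> k" | "i \<noteq> k" "j = k" | "i \<noteq> k" "j \<noteq> k" by blast
    then show ?thesis
    proof cases
      case 1
      then show ?thesis using sk[of k k] skew[of "\<sigma>' k" "\<sigma>' k"] by simp
    next
      case 2
      then show ?thesis using row ij by simp
    next
      case 3
      then show ?thesis using row[of i] ij sk[of i j] skew[of "\<sigma>' i" "\<sigma>' j"] by simp
    next
      case 4
      then show ?thesis
        using old_lam ij mutate_quasi_unchanged[OF k ij, of S] labelledD(4)[OF S ij] by simp
    qed
  qed
  ultimately show ?thesis using comp inj unfolding labelled_def by blast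
qed

end

text \<open>The quasi-commutation exponent of two arcs that do not cross is the value of the form given by
  \<open>P_quasi\<close> on the vectors \<open>e\<^sub>p - e\<^sub>r\<^sub>-\<^sub>1\<close> of the arcs \<open>(p, r)\<close>, where \<open>e\<^sub>N\<^sub>+\<^sub>1 = 0\<close>.\<close>

definition ell :: "int \<Rightarrow> int \<Rightarrow> int \<Rightarrow> int" where
  "ell N p t = (if p = N + 1 \<or> t = N + 1 \<or> even (p + t) then 0 else if p < t then 1 else - 1)"

fun lam :: "int \<Rightarrow> int \<times> int \<Rightarrow> int \<times> int \<Rightarrow> int" where
  "lam N (p, r) (p', r') = ell N p p' - ell N p (r' - 1) - ell N (r - 1) p' + ell N (r - 1) (r' - 1)"

lemma ell_skew: "ell N p t = - ell N t p"
  by (auto simp: ell_def)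

lemma lam_skew: "lam N x y = - lam N y x"
proof -
  obtain p r p' r' where [simp]: "x = (p, r)" "y = (p', r')" by fastforce
  show ?thesis
    using ell_skew[of N p p'] ell_skew[of N p "r' - 1"] ell_skew[of N "r - 1" p'] ell_skew[of N "r - 1" "r' - 1"]
    by simp
qed

lemma ell_le: "p \<le> t \<Longrightarrow> t \<le> N \<Longrightarrow> ell N p t = (p + t) mod 2"
  by (cases "p = t") (auto simp: ell_def mod_2_eq_odd)

lemma ell_ge: "t \<le> p \<Longrightarrow> p \<le> N \<Longrightarrow> ell N p t = - ((p + t) mod 2)"
  using ell_le[of t p N] ell_skew[of N p t] by (simp add: add.commute)

lemma ell_outside [simp]: "ell N (N + 1) t = 0" "ell N p (N + 1) = 0"
  by (simp_all add: ell_def)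

text \<open>Exactly one of j and j - 1 has odd distance to t, and its position relative to t gives
  the sign.\<close>

lemma ell_step:
  assumes "j \<le> N" "t \<le> N"
  shows "ell N j t + ell N (j - 1) t = (if j \<le> t then 1 else - 1)"
proof (cases "j \<le> t")
  case True
  moreover have "(j + t) mod 2 + (j - 1 + t) mod 2 = 1" by presburger
  ultimately show ?thesis using assms ell_le[of j t N] ell_le[of "j - 1" t N] by simp
next
  case False
  moreover have "(j + t) mod 2 + (j - 1 + t) mod 2 = 1" by presburger
  ultimately show ?thesis using assms ell_ge[of t j N] ell_ge[of t "j - 1" N] by simp
qed

text \<open>The four vectors combine to e_j + e_(j-1) - e_k - e_(k-1), whose value on e_t is 2 for t
  in [j, k) and 0 otherwise. An arc (p, r) crossing no side with exactly one of p, r - 1 in that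
  interval must be a diagonal.\<close>

lemma quad_balance:
  assumes T: "triangulation N T" and z: "z \<in> T" and ijkl: "i < j" "j < k" "k < l" "k \<le> N"
    and e: "edge N T (i, j)" "edge N T (j, k)" "edge N T (k, l)" "edge N T (i, l)"
  shows "lam N (i, l) z + lam N (j, k) z - lam N (i, j) z - lam N (k, l) z =
    2 * of_bool (z = (j, l)) - 2 * of_bool (z = (i, k))"
proof -
  obtain p r where zz: "z = (p, r)" by fastforce
  have i: "0 \<le> i" using edge_bounds[OF T e(1)] by simp
  have b: "0 \<le> p" "p \<le> N" "r = N + 2 \<or> p + 2 \<le> r \<and> r \<le> N" using triangulationD(1)[OF T] z zz by auto
  have f: "ell N j t + ell N (j - 1) t - ell N k t - ell N (k - 1) t = 2 * of_bool (j \<le> t \<and> t < k)"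
    if "t \<le> N \<or> t = N + 1" for t
  proof (cases "t = N + 1")
    case False
    then show ?thesis using ell_step[of j N t] ell_step[of k N t] that ijkl by auto
  qed (use ijkl in simp)
  note nc = edge_not_crossing[OF T e(1) z[unfolded zz]] edge_not_crossing[OF T e(2) z[unfolded zz]]
      edge_not_crossing[OF T e(3) z[unfolded zz]] edge_not_crossing[OF T e(4) z[unfolded zz]]
  have "lam N (i, l) z + lam N (j, k) z - lam N (i, j) z - lam N (k, l) z =
      2 * of_bool (j \<le> p \<and> p < k) - 2 * of_bool (j \<le> r - 1 \<and> r - 1 < k)"
    using f[of p] f[of "r - 1"] b unfolding zz by auto
  also have "\<dots> = 2 * of_bool (z = (j, l)) - 2 * of_bool (z = (i, k))"
  proof -
    have h1: "(p, r) = (j, l)" if "j \<le> p" "p < k" "\<not> r - 1 < k"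
    proof -
      have "p = j" using nc(3) that by simp
      moreover have "l \<le> r" using nc(6) that by simp
      moreover have "r \<le> l" using nc(7) that ijkl by simp
      ultimately show ?thesis by simp
    qed
    have h2: "(p, r) = (i, k)" if "\<not> (j \<le> p \<and> p < k)" "j \<le> r - 1" "r - 1 < k"
    proof -
      have pj: "p < j" using that b by auto
      have "r = k" using nc(4) that pj by simp
      moreover have "p \<le> i" using nc(1) that pj by simp
      moreover have "i \<le> p" using nc(8) that ijkl by simp
      ultimately show ?thesis by simp
    qed
    have h3: "(p, r) \<noteq> (j, l) \<and> (p, r) \<noteq> (i, k)"
      if "(j \<le> p \<and> p < k) = (j \<le> r - 1 \<and> r - 1 < k)"
      using that ijkl by auto
    have h4: "j \<le> p \<and> p < k \<Longrightarrow> j \<le> r - 1" using b(2,3) ijkl(4) by linarith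
    have *: "2 * of_bool A - 2 * of_bool B = (2 * of_bool C - 2 * of_bool D :: int)"
      if "A \<Longrightarrow> \<not> B \<Longrightarrow> C" "\<not> A \<Longrightarrow> B \<Longrightarrow> D" "A = B \<Longrightarrow> \<not> C \<and> \<not> D" "\<not> (C \<and> D)" for A B C D
      using that by (cases A; cases B) auto
    show ?thesis
      unfolding zz
    proof (rule *)
      show "(p, r) = (j, l)" if "j \<le> p \<and> p < k" "\<not> (j \<le> r - 1 \<and> r - 1 < k)"
        using h1 h4 that by blast
      show "(p, r) = (i, k)" if "\<not> (j \<le> p \<and> p < k)" "j \<le> r - 1 \<and> r - 1 < k"
        using h2 that by blast
      show "\<not> ((p, r) = (j, l) \<and> (p, r) = (i, k))" using ijkl by simp
    qed (rule h3)
  qed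
  finally show ?thesis .
qed

lemma ell_par:
  "p \<le> t \<Longrightarrow> t \<le> N \<Longrightarrow> ell N p t = par p t"
  "t \<le> p \<Longrightarrow> p \<le> N \<Longrightarrow> ell N p t = - par t p"
  by (simp_all add: ell_le ell_ge par_def add.commute)

lemma lam_par:
  "\<lbrakk>i < j; j < k; k \<le> N\<rbrakk> \<Longrightarrow> lam N (i, k) (i, j) = par i j - par i k - par j k"
  "\<lbrakk>i < j; j < k; k \<le> N\<rbrakk> \<Longrightarrow> lam N (i, k) (j, k) = par i j + par i k - par j k"
  "\<lbrakk>i < j; j < k; k \<le> N\<rbrakk> \<Longrightarrow> lam N (i, j) (j, k) = par i j + par i k + par j k - 2"
  "\<lbrakk>i < j; j < k; k < l; l \<le> N\<rbrakk> \<Longrightarrow> lam N (i, j) (k, l) = par i k + par i l + par j k + par j l - 2"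
  "\<lbrakk>i < j; j < k; k < l; l \<le> N\<rbrakk> \<Longrightarrow> lam N (i, l) (j, k) = par i j + par i k - par j l - par k l"
  by (simp_all add: ell_par par_step)

lemma lam_bridge_par:
  "\<lbrakk>i < k; k \<le> j; j \<le> N\<rbrakk> \<Longrightarrow> lam N (i, k) (j, N + 2) = par i j + par k j - 1"
  "\<lbrakk>i < k; j \<le> i; k \<le> N\<rbrakk> \<Longrightarrow> lam N (i, k) (j, N + 2) = 1 - par j i - par j k"
  "\<lbrakk>i \<le> j; j \<le> N\<rbrakk> \<Longrightarrow> lam N (i, N + 2) (j, N + 2) = par i j"
  by (simp_all add: ell_par par_step add.commute[of 1 N])

text \<open>The left sides are the exponents that \<open>labelled_exchange\<close> delivers: the
  first two for the flip of (i, k) with the new variable on the right, the last two for the flip of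
  (j, l) with the new variable on the left. The right sides are those of
  \<open>ptolemy_arcs\<close>.\<close>

lemma ptolemy_exponents:
  assumes "i < j" "j < k" "k < l" "l \<le> N"
  shows "lam N (i, k) (i, j) + lam N (i, k) (k, l) - lam N (i, j) (k, l) = par i j + par k l - par i k - par j l - 2 * par j k"
    and "lam N (i, k) (i, l) + lam N (i, k) (j, k) - lam N (i, l) (j, k) = par i l + par j l + 2 * par k l - par i k - par j k"
    and "- lam N (j, l) (i, j) - lam N (j, l) (k, l) - lam N (i, j) (k, l) = par i j + par k l - par i k - par j l - 2 * par j k"
    and "- lam N (j, l) (i, l) - lam N (j, l) (j, k) - lam N (i, l) (j, k) = par i l + par j l + 2 * par k l - par i k - par j k"
proof -
  have o: "i < k" "i < l" "j < l" "k \<le> N" using assms by auto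
  note a = assms
  note ijk = lam_par(1-3)[OF a(1,2) o(4)] and ijl = lam_par(1-3)[OF a(1) o(3) a(4)]
    and ikl = lam_par(1-3)[OF o(1) a(3,4)] and jkl = lam_par(1-3)[OF a(2,3,4)]
  note sk = lam_skew[of N "(i, k)" "(i, l)"] lam_skew[of N "(j, l)" "(i, j)"] lam_skew[of N "(j, l)" "(i, l)"]
  show "lam N (i, k) (i, j) + lam N (i, k) (k, l) - lam N (i, j) (k, l) = par i j + par k l - par i k - par j l - 2 * par j k"
    unfolding ijk ikl lam_par(4)[OF a] by simp
  show "lam N (i, k) (i, l) + lam N (i, k) (j, k) - lam N (i, l) (j, k) = par i l + par j l + 2 * par k l - par i k - par j k"
    unfolding sk(1) ijk ikl lam_par(5)[OF a] by simp
  show "- lam N (j, l) (i, j) - lam N (j, l) (k, l) - lam N (i, j) (k, l) = par i j + par k l - par i k - par j l - 2 * par j k"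
    unfolding sk(2) ijl jkl lam_par(4)[OF a] by simp
  show "- lam N (j, l) (i, l) - lam N (j, l) (j, k) - lam N (i, l) (j, k) = par i l + par j l + 2 * par k l - par i k - par j k"
    unfolding sk(3) ijl jkl lam_par(5)[OF a] by simp
qed

lemma ptolemy_exponents_bridge:
  assumes "i < j" "j < k" "k \<le> N"
  shows "lam N (i, k) (i, j) + lam N (i, k) (k, N + 2) - lam N (i, j) (k, N + 2) = par i j - par i k - 2 * par j k"
    and "lam N (i, k) (i, N + 2) + lam N (i, k) (j, k) - lam N (i, N + 2) (j, k) = 2 - par i k - par j k"
    and "- lam N (j, N + 2) (i, j) - lam N (j, N + 2) (k, N + 2) - lam N (i, j) (k, N + 2) = par i j - par i k - 2 * par j k"
    and "- lam N (j, N + 2) (i, N + 2) - lam N (j, N + 2) (j, k) - lam N (i, N + 2) (j, k) = 2 - par i k - par j k"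
proof -
  have o: "i < k" "j \<le> N" "j \<le> k" "i \<le> j" using assms by auto
  note a = assms
  note ijk = lam_par(1-3)[OF a]
  note b = lam_bridge_par(1)[OF o(1) order.refl a(3)] lam_bridge_par(1)[OF a(1) o(3) a(3)]
    lam_bridge_par(2)[OF o(1) order.refl a(3)] lam_bridge_par(2)[OF a(2) o(4) a(3)]
    lam_bridge_par(1)[OF a(1) order.refl o(2)] lam_bridge_par(3)[OF o(3) a(3)] lam_bridge_par(3)[OF o(4,2)]
    lam_bridge_par(2)[OF a(2) order.refl a(3)]
  note sk = lam_skew[of N "(i, N + 2)" "(j, k)"] lam_skew[of N "(j, N + 2)" "(i, j)"]
    lam_skew[of N "(j, N + 2)" "(i, N + 2)"] lam_skew[of N "(j, N + 2)" "(j, k)"]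
  show "lam N (i, k) (i, j) + lam N (i, k) (k, N + 2) - lam N (i, j) (k, N + 2) = par i j - par i k - 2 * par j k"
    unfolding ijk b by simp
  show "lam N (i, k) (i, N + 2) + lam N (i, k) (j, k) - lam N (i, N + 2) (j, k) = 2 - par i k - par j k"
    unfolding sk(1) ijk b by simp
  show "- lam N (j, N + 2) (i, j) - lam N (j, N + 2) (k, N + 2) - lam N (i, j) (k, N + 2) = par i j - par i k - 2 * par j k"
    unfolding sk(2) ijk b by simp
  show "- lam N (j, N + 2) (i, N + 2) - lam N (j, N + 2) (j, k) - lam N (i, N + 2) (j, k) = 2 - par i k - par j k"
    unfolding sk(1,3,4) ijk b by simp
qed

sublocale annulus \<subseteq> quantum_seeds \<iota> s n
  by unfold_locales

context annulus
begin

text \<open>The argument a is the position of the cut in the universal cover; labels are relative to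
  it.\<close>

fun arc :: "int \<Rightarrow> int \<times> int \<Rightarrow> 'd" where
  "arc a (p, r) = (if r = int n + 2 then w (a + p) else P (a + p) (a + r))"

definition triangulated :: "int \<Rightarrow> (nat \<Rightarrow> int \<times> int) \<Rightarrow> 'd quantum_seed \<Rightarrow> bool" where
  "triangulated a \<sigma> S \<longleftrightarrow> labelled (arc a) (lam (int n)) \<sigma> S \<and> triangulation (int n) (\<sigma> ` {..n})"

lemma par_translate: "par (a + i) (a + j) = par i j"
  unfolding par_def by presburger

lemma boundary_inessential:
  "p < int n \<Longrightarrow> inessential (arc a) (lam (int n)) (p, p + 1)"
  using P_edge[of "a + p"] unfolding inessential_def by (auto simp: add.assoc)

lemma edge_essential:
  "edge (int n) T z \<Longrightarrow> z \<in> T \<or> inessential (arc a) (lam (int n)) z"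
  using boundary_inessential unfolding edge_def by blast

text \<open>One product serves both flips: the old variable is its left factor when (i, k) is
  flipped and its right factor when (j, l) is. The two forms differ only in how the exponents are
  written.\<close>

lemma arc_ptolemy:
  fixes N defines "N \<equiv> int n"
  assumes "0 \<le> i" "i < j" "j < k" "k < l" "k \<le> N" "l \<le> N \<or> l = N + 2"
  shows "arc a (i, k) * arc a (j, l) =
      sp (lam N (i, k) (i, j) + lam N (i, k) (k, l) - lam N (i, j) (k, l)) * (arc a (i, j) * arc a (k, l)) +
      sp (lam N (i, k) (i, l) + lam N (i, k) (j, k) - lam N (i, l) (j, k)) * (arc a (i, l) * arc a (j, k))" (is ?A)
    and "arc a (i, k) * arc a (j, l) =
      sp (- lam N (j, l) (i, j) - lam N (j, l) (k, l) - lam N (i, j) (k, l)) * (arc a (i, j) * arc a (k, l)) +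
      sp (- lam N (j, l) (i, l) - lam N (j, l) (j, k) - lam N (i, l) (j, k)) * (arc a (i, l) * arc a (j, k))" (is ?B)
proof -
  have "?A \<and> ?B"
  proof (cases "l = N + 2")
    case True
    then show ?thesis
      using ptolemy_bridge[of "a + i" "a + j" "a + k"] assms
      unfolding True ptolemy_exponents_bridge[OF assms(3,4,6)] by (simp add: par_translate N_def)
  next
    case False
    then have "l \<le> N" using assms by simp
    then show ?thesis
      using ptolemy_arcs[of "a + i" "a + j" "a + k" "a + l"] assms
      unfolding ptolemy_exponents[OF assms(3-5) \<open>l \<le> N\<close>] by (simp add: par_translate N_def)
  qed
  then show ?A ?B by blast+
qed

lemma mutate_quadrilateral:
  fixes N defines "N \<equiv> int n"
  assumes S: "triangulated a \<sigma> S" and m: "m \<le> n" and ijkl: "i < j" "j < k" "k < l" "k \<le> N"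
    and e: "edge N (\<sigma> ` {..n}) (i, j)" "edge N (\<sigma> ` {..n}) (j, k)" "edge N (\<sigma> ` {..n}) (k, l)" "edge N (\<sigma> ` {..n}) (i, l)"
    and xy: "\<sigma> m = (i, k) \<and> y = (j, l) \<or> \<sigma> m = (j, l) \<and> y = (i, k)"
  shows "triangulated a (\<sigma>(m := y)) (mutate n \<iota> s m S)"
proof -
  let ?T = "\<sigma> ` {..n}" and ?S = "mutate n \<iota> s m S" and ?x = "\<sigma> m"
  have L: "labelled (arc a) (lam N) \<sigma> S" and T: "triangulation N ?T"
    using S unfolding triangulated_def N_def by auto
  note inj = labelledD(2)[OF L]
  have bounds: "0 \<le> i" "l \<le> N \<or> l = N + 2" using edge_bounds[OF T e(4)] by auto
  have x: "?x \<in> ?T" using m by simp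
  have cross: "crosses ?x y" using xy ijkl by auto
  then have y: "y \<notin> ?T" using T x unfolding triangulation_def by blast
  have nz: "arc a ?x \<noteq> 0"
    using quasi_commutingD(1)[OF compatibleD(1)[OF labelledD(1)[OF L]] m] labelledD(3)[OF L m] by simp
  have ess: "z \<in> ?T \<or> inessential (arc a) (lam N) z" if "z \<in> {(i, j), (j, k), (k, l), (i, l)}" for z
    using that e edge_essential unfolding N_def by blast
  note bal = quad_balance[OF T _ ijkl e]
  note pt = arc_ptolemy[OF bounds(1) ijkl(1-3) ijkl(4)[unfolded N_def] bounds(2)[unfolded N_def], of a, folded N_def]
  have var: "cluster ?S m = arc a y" and row: "\<And>j. \<lbrakk>j \<le> n; j \<noteq> m\<rbrakk> \<Longrightarrow> quasi ?S m j = lam N y (\<sigma> j)"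
  proof -
    consider "?x = (i, k)" "y = (j, l)" | "?x = (j, l)" "y = (i, k)" using xy by blast
    then have "cluster ?S m = arc a y \<and> (\<forall>j. j \<le> n \<longrightarrow> j \<noteq> m \<longrightarrow> quasi ?S m j = lam N y (\<sigma> j))"
    proof cases
      case 1
      have b: "\<forall>z\<in>?T. lam N (i, j) z + lam N (k, l) z - lam N (i, l) z - lam N (j, k) z = (if z = ?x then 2 else 0)"
      proof
        fix z assume z: "z \<in> ?T"
        then have "z \<noteq> (j, l)" using y 1 by blast
        then show "lam N (i, j) z + lam N (k, l) z - lam N (i, l) z - lam N (j, k) z = (if z = ?x then 2 else 0)"
          using bal[OF z] 1 by auto
      qed
      have d: "{(i, j), (k, l)} \<inter> {(i, l), (j, k)} \<inter> ?T = {}" using ijkl by auto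
      have s: "\<forall>z\<in>{(i, j), (k, l), (i, l), (j, k)}. z \<in> ?T \<or> inessential (arc a) (lam N) z"
        using ess by blast
      note ex = labelled_exchange[OF L m s d b]
      have "arc a ?x * cluster ?S m = arc a ?x * arc a y"
        unfolding 1 by (rule trans[OF ex(1)[unfolded 1] pt(1)[symmetric]])
      moreover have "quasi ?S m j' = lam N y (\<sigma> j')" if "j' \<le> n" "j' \<noteq> m" for j'
        using ex(3)[OF that] unfolding 1 by (cases "\<sigma> j'") simp
      ultimately show ?thesis using nz by simp
    next
      case 2
      have b: "\<forall>z\<in>?T. lam N (i, l) z + lam N (j, k) z - lam N (i, j) z - lam N (k, l) z = (if z = ?x then 2 else 0)"
      proof
        fix z assume z: "z \<in> ?T"
        then have "z \<noteq> (i, k)" using y 2 by blast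
        then show "lam N (i, l) z + lam N (j, k) z - lam N (i, j) z - lam N (k, l) z = (if z = ?x then 2 else 0)"
          using bal[OF z] 2 by auto
      qed
      have d: "{(i, l), (j, k)} \<inter> {(i, j), (k, l)} \<inter> ?T = {}" using ijkl by auto
      have s: "\<forall>z\<in>{(i, l), (j, k), (i, j), (k, l)}. z \<in> ?T \<or> inessential (arc a) (lam N) z"
        using ess by blast
      note ex = labelled_exchange[OF L m s d b]
      have "cluster ?S m * arc a ?x = arc a y * arc a ?x"
        unfolding 2 using ex(2)[unfolded 2] pt(2) by (simp only: add.commute)
      \<comment> \<open>The row formula yields the vector e_i + e_k - e_j - e_(j-1) instead of e_i -
        e_(k-1). Their difference is the balance vector, which vanishes on every arc except the
        flipped one.\<close>
      moreover have "quasi ?S m j' = lam N y (\<sigma> j')" if "j' \<le> n" "j' \<noteq> m" for j'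
      proof -
        have "\<sigma> j' \<noteq> ?x" using inj that m by (simp add: inj_on_eq_iff)
        moreover have "\<sigma> j' \<in> ?T" using that by simp
        ultimately show ?thesis using ex(3)[OF that] bspec[OF b] unfolding 2 by (cases "\<sigma> j'") fastforce
      qed
      ultimately show ?thesis using nz by simp
    qed
    then show "cluster ?S m = arc a y" "\<And>j. \<lbrakk>j \<le> n; j \<noteq> m\<rbrakk> \<Longrightarrow> quasi ?S m j = lam N y (\<sigma> j)" by blast+
  qed
  have inj': "inj_on (\<sigma>(m := y)) {..n}" using inj y unfolding inj_on_def by (auto simp: image_iff)
  have "labelled (arc a) (lam N) (\<sigma>(m := y)) ?S"
    using var row by (intro labelled_mutate[OF L m inj' lam_skew]) auto
  moreover have "(\<sigma>(m := y)) ` {..n} = insert y (?T - {?x})"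
    using inj m by (auto simp: inj_on_def)
  ultimately show ?thesis
    unfolding triangulated_def using triangulation_flip[OF T x ijkl e xy] by (simp add: N_def)
qed

end

section \<open>Invariance of the exponents when the cut moves\<close>

lemma par_diff: "par (p - b) (t - b) = par p t" "par (p + N) (t + N) = par p t"
  unfolding par_def by presburger+

lemma ell_outside' [simp]: "ell N (1 + N) t = 0" "ell N p (1 + N) = 0"
  by (simp_all add: ell_def)

text \<open>Pairs on the same side of b are merely translated. For a pair on different sides the
  order is reversed and, N being odd, the parity changes; the value then moves by exactly 1.\<close>

lemma ell_rotate:
  assumes "b \<le> N"
  shows "\<lbrakk>b \<le> p; b \<le> t; p \<le> N; t \<le> N; 0 \<le> b\<rbrakk> \<Longrightarrow> ell N (p - b) (t - b) = ell N p t"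
    and "\<lbrakk>p \<le> b; t \<le> b\<rbrakk> \<Longrightarrow> ell N (p - b + N) (t - b + N) = ell N p t"
    and "\<lbrakk>0 \<le> p; p \<le> b; b \<le> t; t \<le> N; odd N\<rbrakk> \<Longrightarrow> ell N (p - b + N) (t - b) = ell N p t - 1"
    and "\<lbrakk>0 \<le> p; p \<le> b; b \<le> t; t \<le> N; odd N\<rbrakk> \<Longrightarrow> ell N (t - b) (p - b + N) = ell N t p + 1"
proof -
  show "ell N (p - b) (t - b) = ell N p t" if "b \<le> p" "b \<le> t" "p \<le> N" "t \<le> N" "0 \<le> b"
    using that by (cases "p \<le> t") (simp_all add: ell_par par_diff)
  show "ell N (p - b + N) (t - b + N) = ell N p t" if "p \<le> b" "t \<le> b"
    using that assms by (cases "p \<le> t") (simp_all add: ell_par par_diff)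
  show *: "ell N (p - b + N) (t - b) = ell N p t - 1" if "0 \<le> p" "p \<le> b" "b \<le> t" "t \<le> N" "odd N"
  proof -
    have "par (t - b) (p - b + N) = 1 - par p t" using \<open>odd N\<close> unfolding par_def by presburger
    then show ?thesis using that assms by (simp add: ell_par)
  qed
  show "ell N (t - b) (p - b + N) = ell N t p + 1" if "0 \<le> p" "p \<le> b" "b \<le> t" "t \<le> N" "odd N"
    using *[OF that] ell_skew[of N "t - b"] ell_skew[of N t p] by simp
qed

text \<open>The corrections in \<open>ell_rotate\<close> are constants, so they cancel between the
  two ends p and r - 1 of an arc inside [0, b]. Bridges of the zone start at b or later and need no
  correction of their own.\<close>

lemma lam_rotate_up:
  assumes b: "0 < b" "b \<le> N" and odd: "odd N" and x: "x \<in> zone_up N b" and y: "y \<in> zone_up N b"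
  shows "lam N (rotate_up N b x) (rotate_up N b y) = lam N x y"
proof -
  have b0: "0 \<le> b" using b by simp
  note hh = ell_rotate(1)[OF b(2) _ _ _ _ b0] and ll = ell_rotate(2)[OF b(2)]
    and lh = ell_rotate(3)[OF b(2) _ _ _ _ odd] and hl = ell_rotate(4)[OF b(2) _ _ _ _ odd]
  from UnI1[OF x] b0 b(2) show ?thesis
  proof (cases rule: rotate_cases)
    case (1 p)
    note px = 1(2,3) 1(4)[OF x]
    from UnI1[OF y] b0 b(2) show ?thesis
    proof (cases rule: rotate_cases)
      case (1 p')
      then show ?thesis using px \<open>x = _\<close> \<open>rotate_up N b x = _\<close> y hh[of p p'] by simp
    next
      case (2 p' r')
      then show ?thesis using px \<open>x = _\<close> \<open>rotate_up N b x = _\<close> hl[of p' p] hl[of "r' - 1" p]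
        by (simp add: algebra_simps)
    next
      case (3 p' r')
      then show ?thesis using px \<open>x = _\<close> \<open>rotate_up N b x = _\<close> hh[of p p'] hh[of p "r' - 1"]
        by (simp add: algebra_simps)
    qed
  next
    case (2 p r)
    note px = 2
    from UnI1[OF y] b0 b(2) show ?thesis
    proof (cases rule: rotate_cases)
      case (1 p')
      then show ?thesis using px y lh[of p p'] lh[of "r - 1" p'] by (simp add: algebra_simps)
    next
      case (2 p' r')
      then show ?thesis using px ll[of p p'] ll[of p "r' - 1"] ll[of "r - 1" p'] ll[of "r - 1" "r' - 1"]
        by (simp add: algebra_simps)
    next
      case (3 p' r')
      then show ?thesis using px lh[of p p'] lh[of p "r' - 1"] lh[of "r - 1" p'] lh[of "r - 1" "r' - 1"]
        by (simp add: algebra_simps)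
    qed
  next
    case (3 p r)
    note px = 3
    from UnI1[OF y] b0 b(2) show ?thesis
    proof (cases rule: rotate_cases)
      case (1 p')
      then show ?thesis using px y hh[of p p'] hh[of "r - 1" p'] by (simp add: algebra_simps)
    next
      case (2 p' r')
      then show ?thesis using px hl[of p' p] hl[of "r' - 1" p] hl[of p' "r - 1"] hl[of "r' - 1" "r - 1"]
        by (simp add: algebra_simps)
    next
      case (3 p' r')
      then show ?thesis using px hh[of p p'] hh[of p "r' - 1"] hh[of "r - 1" p'] hh[of "r - 1" "r' - 1"]
        by (simp add: algebra_simps)
    qed
  qed
qed

lemma lam_rotate_down:
  assumes b: "0 \<le> b" "b < N" and odd: "odd N" and x: "x \<in> zone_down N b" and y: "y \<in> zone_down N b"
  shows "lam N (rotate_down N b x) (rotate_down N b y) = lam N x y"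
proof -
  have b0: "b \<le> N" using b by simp
  note hh = ell_rotate(1)[OF b0 _ _ _ _ b(1)] and ll = ell_rotate(2)[OF b0]
    and lh = ell_rotate(3)[OF b0 _ _ _ _ odd] and hl = ell_rotate(4)[OF b0 _ _ _ _ odd]
  from UnI2[OF x] b(1) b0 show ?thesis
  proof (cases rule: rotate_cases)
    case (1 p)
    note px = 1(2,3) 1(5)[OF x]
    from UnI2[OF y] b(1) b0 show ?thesis
    proof (cases rule: rotate_cases)
      case (1 p')
      then show ?thesis using px \<open>x = _\<close> \<open>rotate_down N b x = _\<close> y ll[of p p'] by simp
    next
      case (2 p' r')
      then show ?thesis using px \<open>x = _\<close> \<open>rotate_down N b x = _\<close> ll[of p p'] ll[of p "r' - 1"]
        by (simp add: algebra_simps)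
    next
      case (3 p' r')
      then show ?thesis using px \<open>x = _\<close> \<open>rotate_down N b x = _\<close> lh[of p p'] lh[of p "r' - 1"]
        by (simp add: algebra_simps)
    qed
  next
    case (2 p r)
    note px = 2
    from UnI2[OF y] b(1) b0 show ?thesis
    proof (cases rule: rotate_cases)
      case (1 p')
      then show ?thesis using px y ll[of p p'] ll[of "r - 1" p'] by (simp add: algebra_simps)
    next
      case (2 p' r')
      then show ?thesis using px ll[of p p'] ll[of p "r' - 1"] ll[of "r - 1" p'] ll[of "r - 1" "r' - 1"]
        by (simp add: algebra_simps)
    next
      case (3 p' r')
      then show ?thesis using px lh[of p p'] lh[of p "r' - 1"] lh[of "r - 1" p'] lh[of "r - 1" "r' - 1"]
        by (simp add: algebra_simps)
    qed
  next
    case (3 p r)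
    note px = 3
    from UnI2[OF y] b(1) b0 show ?thesis
    proof (cases rule: rotate_cases)
      case (1 p')
      then show ?thesis using px y hl[of p' p] hl[of p' "r - 1"] by (simp add: algebra_simps)
    next
      case (2 p' r')
      then show ?thesis using px hl[of p' p] hl[of "r' - 1" p] hl[of p' "r - 1"] hl[of "r' - 1" "r - 1"]
        by (simp add: algebra_simps)
    next
      case (3 p' r')
      then show ?thesis using px hh[of p p'] hh[of p "r' - 1"] hh[of "r - 1" p'] hh[of "r - 1" "r' - 1"]
        by (simp add: algebra_simps)
    qed
  qed
qed

text \<open>The flipped side (0, N + 2) has the neighbours (0, b), the bridges at b and N, and the
  inner boundary. The boundary edge (0, 1) stands in for the latter: its vector e_0 - e_0 is zero
  and its variable is 1.\<close>

lemma balance_up: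
  assumes "0 < b" "b \<le> N" "odd N" and z: "z = (0, N + 2) \<or> z \<in> zone_up N b"
  shows "lam N (0, b) z + lam N (0, 1) z - lam N (b, N + 2) z - lam N (N, N + 2) z = (if z = (0, N + 2) then 2 else 0)"
proof -
  obtain p r where zz: "z = (p, r)" by fastforce
  have f: "ell N 0 t - ell N (b - 1) t - ell N b t - ell N N t = (if t < b then 2 else 0)" if "0 \<le> t" "t \<le> N" for t
  proof -
    have "par t N = 1 - par 0 t" using \<open>odd N\<close> unfolding par_def by presburger
    then show ?thesis using ell_step[of b N t] that assms(1,2) by (auto simp: ell_par)
  qed
  have "lam N (0, b) z + lam N (0, 1) z - lam N (b, N + 2) z - lam N (N, N + 2) z =
      (ell N 0 p - ell N (b - 1) p - ell N b p - ell N N p) -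
      (ell N 0 (r - 1) - ell N (b - 1) (r - 1) - ell N b (r - 1) - ell N N (r - 1))"
    unfolding zz by simp
  also have "\<dots> = (if z = (0, N + 2) then 2 else 0)"
    using z f[of p] f[of "r - 1"] assms(1,2) unfolding zz zone_up_def by auto
  finally show ?thesis .
qed

text \<open>The left side is the new row of Lambda as computed by \<open>labelled_exchange\<close>,
  with the bridges at b and N as negative sides. The right side is the row of the bridge that serves
  as (N, N + 2) after the move.\<close>

lemma row_up:
  assumes "0 < b" "b \<le> N" "odd N" and z: "z \<in> zone_up N b"
  shows "- lam N (0, N + 2) z + lam N (b, N + 2) z + lam N (N, N + 2) z = lam N (N, N + 2) (rotate_up N b z)"
proof -
  have high: "- ell N 0 t + ell N b t + ell N N t = ell N N (t - b)" if "b \<le> t" "t \<le> N" for t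
  proof -
    have "par t N = 1 - par 0 t" "par (t - b) N = 1 - par b t" using \<open>odd N\<close> unfolding par_def by presburger+
    then show ?thesis using that assms(1,2) by (simp add: ell_par)
  qed
  have low: "- ell N 0 t + ell N b t + ell N N t = ell N N (t - b + N) - 1" if "0 \<le> t" "t \<le> b" for t
  proof -
    have "par t N = 1 - par 0 t" "par (t - b + N) N = par t b" using \<open>odd N\<close> unfolding par_def by presburger+
    then show ?thesis using that assms(1,2) by (simp add: ell_par)
  qed
  have "0 \<le> b" using assms by simp
  from UnI1[OF z] this assms(2) show ?thesis
  proof (cases rule: rotate_cases)
    case (1 p)
    then show ?thesis using high[of p] z by simp
  next
    case (2 p r)
    then show ?thesis using low[of p] low[of "r - 1"] by (simp add: algebra_simps)
  next
    case (3 p r)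
    then show ?thesis using high[of p] high[of "r - 1"] by (simp add: algebra_simps)
  qed
qed

text \<open>Mirror image of \<open>balance_up\<close> with opposite signs: the two bridges are now
  the positive sides, (b, N) and the stand-in (0, 1) for the inner boundary the negative
  ones.\<close>

lemma balance_down:
  assumes "0 \<le> b" "b < N" "odd N" and z: "z = (N, N + 2) \<or> z \<in> zone_down N b"
  shows "lam N (0, N + 2) z + lam N (b, N + 2) z - lam N (b, N) z - lam N (0, 1) z = (if z = (N, N + 2) then 2 else 0)"
proof -
  obtain p r where zz: "z = (p, r)" by fastforce
  have f: "ell N 0 t + ell N (N - 1) t = (if t = N then 2 else 0)" if "0 \<le> t" "t \<le> N" for t
  proof -
    have "par t (N - 1) = par 0 t" "par 0 N = 1" "par (N - 1) N = 1" using \<open>odd N\<close> unfolding par_def by presburger+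
    then show ?thesis using that by (auto simp: ell_par)
  qed
  have "lam N (0, N + 2) z + lam N (b, N + 2) z - lam N (b, N) z - lam N (0, 1) z =
      (ell N 0 p + ell N (N - 1) p) - (ell N 0 (r - 1) + ell N (N - 1) (r - 1))"
    unfolding zz by simp
  also have "\<dots> = (if z = (N, N + 2) then 2 else 0)"
    using z f[of p] f[of "r - 1"] assms(1,2) unfolding zz zone_down_def by auto
  finally show ?thesis .
qed

lemma row_down:
  assumes "0 \<le> b" "b < N" "odd N" and z: "z \<in> zone_down N b"
  shows "- lam N (N, N + 2) z + lam N (b, N) z + lam N (0, 1) z = lam N (0, N + 2) (rotate_down N b z)"
proof -
  have high: "- ell N N t + ell N b t - ell N (N - 1) t = ell N 0 (t - b) + 1" if "b \<le> t" "t < N" for t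
  proof -
    have "par 0 (t - b) = par b t" unfolding par_def by presburger
    then have "ell N 0 (t - b) = ell N b t" using that assms(1,2) by (simp add: ell_par)
    then show ?thesis using ell_step[of N N t] that by simp
  qed
  have low: "- ell N N t + ell N b t - ell N (N - 1) t = ell N 0 (t - b + N)" if "0 \<le> t" "t \<le> b" for t
  proof -
    have "par 0 (t - b + N) = 1 - par t b" using \<open>odd N\<close> unfolding par_def by presburger
    then have "ell N 0 (t - b + N) = 1 + ell N b t" using that assms(1,2) by (simp add: ell_par)
    then show ?thesis using ell_step[of N N t] that assms(1,2) by simp
  qed
  have "b \<le> N" using assms by simp
  from UnI2[OF z] assms(1) this show ?thesis
  proof (cases rule: rotate_cases)
    case (1 p)
    then show ?thesis using low[of p] z by simp
  next
    case (2 p r)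
    then show ?thesis using low[of p] low[of "r - 1"] by (simp add: algebra_simps)
  next
    case (3 p r)
    then show ?thesis using high[of p] high[of "r - 1"] by (simp add: algebra_simps)
  qed
qed

context annulus
begin

lemma N_odd: "odd (int n)"
  using n_odd by simp

text \<open>Only arcs inside [0, b] are read one period later, by \<open>P_periodic\<close>; all
  others stay where they are in the universal cover.\<close>

lemma arc_rotate_up:
  assumes "0 \<le> b" "b \<le> int n" "z \<in> zone_up (int n) b"
  shows "arc (a + b) (rotate_up (int n) b z) = arc a z"
  using UnI1[OF assms(3)] assms(1,2)
proof (cases rule: rotate_cases)
  case (2 p r)
  then show ?thesis
    using P_periodic[of "a + p" "a + r"] assms by (simp add: algebra_simps)
qed (use assms in simp_all)

lemma arc_rotate_down:
  assumes "0 \<le> b" "b \<le> int n" "z \<in> zone_down (int n) b"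
  shows "arc (a + b - int n) (rotate_down (int n) b z) = arc a z"
  using UnI2[OF assms(3)] assms(1,2)
proof (cases rule: rotate_cases)
  case (3 p r)
  then show ?thesis
    using P_periodic[of "a + p - int n" "a + r - int n"] assms by (simp add: algebra_simps)
qed (use assms in simp_all)

lemma image_replace:
  assumes "inj_on \<sigma> {..n}" "m \<le> n"
  shows "(\<lambda>i. if i = m then t' else f (\<sigma> i)) ` {..n} = insert t' (f ` (\<sigma> ` {..n} - {\<sigma> m}))"
proof -
  have "\<sigma> ` {..n} - {\<sigma> m} = \<sigma> ` ({..n} - {m})"
    using assms by (simp add: inj_on_image_set_diff[of _ "{..n}"])
  then show ?thesis using assms(2) by auto
qed

lemma inj_on_replace:
  assumes "inj_on \<sigma> {..n}" "m \<le> n" "\<sigma> ` {..n} - {\<sigma> m} \<subseteq> Z" "inj_on f Z" "t' \<notin> f ` Z"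
  shows "inj_on (\<lambda>i. if i = m then t' else f (\<sigma> i)) {..n}"
proof (rule inj_onI)
  fix i j assume ij: "i \<in> {..n}" "j \<in> {..n}"
    and eq: "(if i = m then t' else f (\<sigma> i)) = (if j = m then t' else f (\<sigma> j))"
  have Z: "\<sigma> l \<in> Z" if "l \<in> {..n}" "l \<noteq> m" for l
  proof -
    have "\<sigma> l \<noteq> \<sigma> m" using assms(1,2) that by (simp add: inj_on_eq_iff)
    then show ?thesis using assms(3) that(1) by blast
  qed
  consider "i = m" "j = m" | "i = m" "j \<noteq> m" | "i \<noteq> m" "j = m" | "i \<noteq> m" "j \<noteq> m" by blast
  then show "i = j"
  proof cases
    case 2
    then show ?thesis using eq Z[OF ij(2)] assms(5) by auto
  next
    case 3
    then show ?thesis using eq Z[OF ij(1)] assms(5) by (metis imageI)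
  next
    case 4
    then have "\<sigma> i = \<sigma> j" using eq Z[OF ij(1)] Z[OF ij(2)] assms(4) by (simp add: inj_on_eq_iff)
    then show ?thesis using assms(1) ij by (simp add: inj_on_eq_iff)
  qed simp
qed

lemma mutate_first_bridge:
  fixes N defines "N \<equiv> int n"
  assumes S: "triangulated a \<sigma> S" and m: "m \<le> n" "\<sigma> m = (0, N + 2)"
    and b: "first_bridge N (\<sigma> ` {..n}) b"
  shows "triangulated (a + b) (\<lambda>i. if i = m then (N, N + 2) else rotate_up N b (\<sigma> i)) (mutate n \<iota> s m S)"
proof -
  let ?T = "\<sigma> ` {..n}" and ?S = "mutate n \<iota> s m S" and ?x = "\<sigma> m"
  let ?\<sigma> = "\<lambda>i. if i = m then (N, N + 2) else rotate_up N b (\<sigma> i)"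
  have L: "labelled (arc a) (lam N) \<sigma> S" and T: "triangulation N ?T"
    using S unfolding triangulated_def N_def by auto
  have N: "N \<ge> 2" "odd N" using n_ge N_odd by (auto simp: N_def)
  note inj = labelledD(2)[OF L] and bb = first_bridge_bounds[OF T b]
  have zone: "\<sigma> i \<in> zone_up N b" if "i \<le> n" "i \<noteq> m" for i
  proof -
    have "\<sigma> i \<noteq> \<sigma> m" using inj_on_eq_iff[OF inj, of i m] m(1) that by simp
    then show ?thesis using bb(4) m(2) that(1) by auto
  qed
  have nz: "arc a ?x \<noteq> 0"
    using quasi_commutingD(1)[OF compatibleD(1)[OF labelledD(1)[OF L]] m(1)] labelledD(3)[OF L m(1)] by simp
  have s: "\<forall>z\<in>{(0, b), (0, 1), (b, N + 2), (N, N + 2)}. z \<in> ?T \<or> inessential (arc a) (lam N) z"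
    using edge_essential[of ?T "(0, b)" a] bridge_edges(1)[OF T b] boundary_inessential[of 0 a] bb(3)
      sides_in_triangulation(2)[OF T N(1)] N(1) unfolding N_def by auto
  have d: "{(0, b), (0, 1)} \<inter> {(b, N + 2), (N, N + 2)} \<inter> ?T = {}"
    using bb N by auto
  have bal: "\<forall>z\<in>?T. lam N (0, b) z + lam N (0, 1) z - lam N (b, N + 2) z - lam N (N, N + 2) z = (if z = ?x then 2 else 0)"
    using balance_up[OF bb(1,2) N(2)] bb(4) unfolding m(2) by blast
  note ex = labelled_exchange[OF L m(1) s d bal]
  \<comment> \<open>These are the exponents of \<open>ptolemy_inner\<close> for a and a + b, which
    identifies the new variable as the bridging arc w_(a+b+n).\<close>
  have exps: "lam N (0, N + 2) (0, b) + lam N (0, N + 2) (0, 1) - lam N (0, b) (0, 1) = par 0 b - 1"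
    "lam N (0, N + 2) (b, N + 2) + lam N (0, N + 2) (N, N + 2) - lam N (b, N + 2) (N, N + 2) = 2 * par 0 b"
  proof -
    have "par b N = 1 - par 0 b" "par 0 N = 1" using N(2) unfolding par_def by presburger+
    then show "lam N (0, N + 2) (0, b) + lam N (0, N + 2) (0, 1) - lam N (0, b) (0, 1) = par 0 b - 1"
      "lam N (0, N + 2) (b, N + 2) + lam N (0, N + 2) (N, N + 2) - lam N (b, N + 2) (N, N + 2) = 2 * par 0 b"
      using bb(1,2) by (simp_all add: ell_par par_step)
  qed
  have e01: "arc a (0, 1) = 1" using boundary_inessential[of 0 a] N by (simp add: inessential_def N_def)
  have "arc a ?x * cluster ?S m = sp (par 0 b - 1) * P a (a + b) + sp (2 * par 0 b) * (w (a + b) * w (a + N))"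
    using ex(1) bb(2) unfolding m(2) exps e01 by (simp add: N_def)
  also have "\<dots> = w a * w (a + b + N)"
    using ptolemy_inner[of a "a + b"] bb(1,2) par_translate[of a 0 b] by (simp add: N_def add.commute)
  finally have "arc a ?x * cluster ?S m = arc a ?x * w (a + b + N)"
    unfolding m(2) by (simp add: N_def)
  then have var: "cluster ?S m = w (a + b + N)" using nz by simp
  have "(N, N + 2) \<notin> rotate_up N b ` zone_up N b"
    using bb(1,2) by (auto simp: zone_up_def)
  then have inj': "inj_on ?\<sigma> {..n}"
    using bb(1,2,4) m(2) by (intro inj_on_replace[OF inj m(1), of "zone_up N b"] inj_on_rotate) auto
  have "labelled (arc (a + b)) (lam N) ?\<sigma> ?S"
  proof (rule labelled_mutate[OF L m(1) inj' lam_skew])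
    show "cluster ?S m = arc (a + b) (?\<sigma> m)" using var by (simp add: N_def)
  next
    fix j assume "j \<le> n" "j \<noteq> m"
    then show "quasi ?S m j = lam N (?\<sigma> m) (?\<sigma> j)"
      using ex(3)[of j] row_up[OF bb(1,2) N(2) zone] by (simp del: lam.simps rotate_up.simps add: m(2))
  next
    fix i assume "i \<le> n" "i \<noteq> m"
    then show "arc (a + b) (?\<sigma> i) = arc a (\<sigma> i)"
      using arc_rotate_up[of b "\<sigma> i" a] zone bb(1,2) by (simp add: N_def)
  next
    fix i j assume "i \<le> n" "i \<noteq> m" "j \<le> n" "j \<noteq> m"
    then show "lam N (?\<sigma> i) (?\<sigma> j) = lam N (\<sigma> i) (\<sigma> j)"
      using lam_rotate_up[OF bb(1,2) N(2) zone zone] by simp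
  qed
  moreover have "?\<sigma> ` {..n} = insert (N, N + 2) (rotate_up N b ` (?T - {(0, N + 2)}))"
    using image_replace[OF inj m(1)] m(2) by simp
  ultimately show ?thesis
    unfolding triangulated_def using triangulation_rotate_up[OF T N(1) b] by (simp only: N_def)
qed

lemma mutate_last_bridge:
  fixes N defines "N \<equiv> int n"
  assumes S: "triangulated a \<sigma> S" and m: "m \<le> n" "\<sigma> m = (N, N + 2)"
    and b: "last_bridge N (\<sigma> ` {..n}) b"
  shows "triangulated (a + b - N) (\<lambda>i. if i = m then (0, N + 2) else rotate_down N b (\<sigma> i)) (mutate n \<iota> s m S)"
proof -
  let ?T = "\<sigma> ` {..n}" and ?S = "mutate n \<iota> s m S" and ?x = "\<sigma> m"
  let ?\<sigma> = "\<lambda>i. if i = m then (0, N + 2) else rotate_down N b (\<sigma> i)"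
  have L: "labelled (arc a) (lam N) \<sigma> S" and T: "triangulation N ?T"
    using S unfolding triangulated_def N_def by auto
  have N: "N \<ge> 2" "odd N" using n_ge N_odd by (auto simp: N_def)
  note inj = labelledD(2)[OF L] and bb = last_bridge_bounds[OF T b]
  have zone: "\<sigma> i \<in> zone_down N b" if "i \<le> n" "i \<noteq> m" for i
  proof -
    have "\<sigma> i \<noteq> \<sigma> m" using inj_on_eq_iff[OF inj, of i m] m(1) that by simp
    then show ?thesis using bb(4) m(2) that(1) by auto
  qed
  have nz: "arc a ?x \<noteq> 0"
    using quasi_commutingD(1)[OF compatibleD(1)[OF labelledD(1)[OF L]] m(1)] labelledD(3)[OF L m(1)] by simp
  have s: "\<forall>z\<in>{(0, N + 2), (b, N + 2), (b, N), (0, 1)}. z \<in> ?T \<or> inessential (arc a) (lam N) z"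
    using edge_essential[of ?T "(b, N)" a] bridge_edges(2)[OF T b] boundary_inessential[of 0 a] bb(3)
      sides_in_triangulation(1)[OF T N(1)] N(1) unfolding N_def by auto
  have d: "{(0, N + 2), (b, N + 2)} \<inter> {(b, N), (0, 1)} \<inter> ?T = {}"
    using bb N by auto
  have bal: "\<forall>z\<in>?T. lam N (0, N + 2) z + lam N (b, N + 2) z - lam N (b, N) z - lam N (0, 1) z = (if z = ?x then 2 else 0)"
    using balance_down[OF bb(1,2) N(2)] bb(4) unfolding m(2) by blast
  note ex = labelled_exchange[OF L m(1) s d bal]
  have exps: "- lam N (N, N + 2) (0, N + 2) - lam N (N, N + 2) (b, N + 2) - lam N (0, N + 2) (b, N + 2) = 2 - 2 * par 0 b"
    "- lam N (N, N + 2) (b, N) - lam N (N, N + 2) (0, 1) - lam N (b, N) (0, 1) = - par 0 b"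
  proof -
    have "par b N = 1 - par 0 b" "par 0 N = 1" "par (N - 1) N = 1" using N(2) unfolding par_def by presburger+
    then show "- lam N (N, N + 2) (0, N + 2) - lam N (N, N + 2) (b, N + 2) - lam N (0, N + 2) (b, N + 2) = 2 - 2 * par 0 b"
      "- lam N (N, N + 2) (b, N) - lam N (N, N + 2) (0, 1) - lam N (b, N) (0, 1) = - par 0 b"
      using bb(1,2) by (simp_all add: ell_par)
  qed
  have e01: "arc a (0, 1) = 1" using boundary_inessential[of 0 a] N by (simp add: inessential_def N_def)
  have p: "par (a + b - N) a = 1 - par 0 b" using N(2) unfolding par_def by presburger
  \<comment> \<open>Shifted back by one period, this arc fits \<open>ptolemy_inner\<close> for a + b
    - N and a. There the old variable w_(a+N) is the right factor, so the second form of the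
    exchange relation applies.\<close>
  have per: "P (a + b) (a + N) = P (a + b - N) a"
    using P_periodic[of "a + b - N" a] bb(1,2) by (simp add: N_def)
  have "cluster ?S m * arc a ?x = sp (2 - 2 * par 0 b) * (w a * w (a + b)) + sp (- par 0 b) * P (a + b) (a + N)"
    using ex(2) unfolding m(2) exps e01 by (simp add: N_def)
  also have "\<dots> = w (a + b - N) * w (a + N)"
    using ptolemy_inner[of "a + b - N" a] bb(1,2) unfolding p per by (simp add: N_def)
  finally have "cluster ?S m * arc a ?x = w (a + b - N) * arc a ?x"
    unfolding m(2) by (simp add: N_def)
  then have var: "cluster ?S m = w (a + b - N)" using nz by simp
  have "(0, N + 2) \<notin> rotate_down N b ` zone_down N b"
    using bb(1,2) by (auto simp: zone_down_def)
  then have inj': "inj_on ?\<sigma> {..n}"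
    using bb(1,2,4) m(2) by (intro inj_on_replace[OF inj m(1), of "zone_down N b"] inj_on_rotate) auto
  have "labelled (arc (a + b - N)) (lam N) ?\<sigma> ?S"
  proof (rule labelled_mutate[OF L m(1) inj' lam_skew])
    show "cluster ?S m = arc (a + b - N) (?\<sigma> m)" using var by (simp add: N_def)
  next
    fix j assume "j \<le> n" "j \<noteq> m"
    then show "quasi ?S m j = lam N (?\<sigma> m) (?\<sigma> j)"
      using ex(3)[of j] row_down[OF bb(1,2) N(2) zone] by (simp del: lam.simps rotate_down.simps add: m(2))
  next
    fix i assume "i \<le> n" "i \<noteq> m"
    then show "arc (a + b - N) (?\<sigma> i) = arc a (\<sigma> i)"
      using arc_rotate_down[of b "\<sigma> i" a] zone bb(1,2) by (simp add: N_def)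
  next
    fix i j assume "i \<le> n" "i \<noteq> m" "j \<le> n" "j \<noteq> m"
    then show "lam N (?\<sigma> i) (?\<sigma> j) = lam N (\<sigma> i) (\<sigma> j)"
      using lam_rotate_down[OF bb(1,2) N(2) zone zone] by simp
  qed
  moreover have "?\<sigma> ` {..n} = insert (0, N + 2) (rotate_down N b ` (?T - {(N, N + 2)}))"
    using image_replace[OF inj m(1)] m(2) by simp
  ultimately show ?thesis
    unfolding triangulated_def using triangulation_rotate_down[OF T N(1) b] by (simp only: N_def)
qed

lemma triangulated_mutate:
  assumes S: "triangulated a \<sigma> S" and m: "m \<le> n"
  shows "\<exists>a' \<sigma>'. triangulated a' \<sigma>' (mutate n \<iota> s m S)"
proof -
  have T: "triangulation (int n) (\<sigma> ` {..n})" and N: "int n \<ge> 2" using S n_ge by (auto simp: triangulated_def)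
  consider "\<sigma> m = (0, int n + 2)" | "\<sigma> m = (int n, int n + 2)" |
    "\<sigma> m \<noteq> (0, int n + 2)" "\<sigma> m \<noteq> (int n, int n + 2)" by blast
  then show ?thesis
  proof cases
    case 1
    then show ?thesis using bridges_exist(1)[OF T N] mutate_first_bridge[OF S m] by blast
  next
    case 2
    then show ?thesis using bridges_exist(2)[OF T N] mutate_last_bridge[OF S m] by blast
  next
    case 3
    obtain p r where pr: "\<sigma> m = (p, r)" by fastforce
    have "(p, r) \<in> \<sigma> ` {..n}" using m pr by (metis atMost_iff imageI)
    from quadrilateral[OF T N this] 3 pr obtain i j k l where q: "i < j" "j < k" "k < l" "k \<le> int n"
      "edge (int n) (\<sigma> ` {..n}) (i, j)" "edge (int n) (\<sigma> ` {..n}) (j, k)"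
      "edge (int n) (\<sigma> ` {..n}) (k, l)" "edge (int n) (\<sigma> ` {..n}) (i, l)" "(p, r) = (i, k) \<or> (p, r) = (j, l)"
      by auto
    show ?thesis
      using q(9) mutate_quadrilateral[OF S m q(1-8), of "(j, l)"] mutate_quadrilateral[OF S m q(1-8), of "(i, k)"] pr
      by auto
  qed
qed

lemma triangulated_class:
  assumes "triangulated a \<sigma> S0" "S \<in> mutation_class n \<iota> s S0"
  shows "\<exists>a \<sigma>. triangulated a \<sigma> S"
  using assms(2)
proof induction
  case initial
  then show ?case using assms(1) by blast
next
  case (step S k)
  then show ?case using triangulated_mutate by blast
qed

section \<open>All arcs lie in the generated subalgebra\<close>

lemma subalgebraD:
  assumes "subalgebra \<iota> A"
  shows "sp e \<in> A" "\<iota> c \<in> A" "\<lbrakk>y \<in> A; z \<in> A\<rbrakk> \<Longrightarrow> y + z \<in> A" "\<lbrakk>y \<in> A; z \<in> A\<rbrakk> \<Longrightarrow> y * z \<in> A"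
    "\<lbrakk>y \<in> A; z \<in> A\<rbrakk> \<Longrightarrow> y - z \<in> A"
proof -
  show 1: "\<iota> c \<in> A" for c using assms by (auto simp: subalgebra_def)
  show "sp e \<in> A" unfolding sp_def by (rule 1)
  show 2: "y + z \<in> A" "y * z \<in> A" if "y \<in> A" "z \<in> A" for y z using assms that by (auto simp: subalgebra_def)
  have "\<iota> (- 1) = - 1" using iota_add[of "- 1" 1] by (simp add: iota_one iota_zero eq_neg_iff_add_eq_0)
  then show "y - z \<in> A" if "y \<in> A" "z \<in> A" using 2(1)[OF that(1) 2(2)[OF 1[of "- 1"] that(2)]] by simp
qed

text \<open>By periodicity every index can be replaced by its representative in 1, ..., n.\<close>

lemma x_mem:
  assumes "\<And>i. \<lbrakk>1 \<le> i; i \<le> int n\<rbrakk> \<Longrightarrow> x i \<in> A"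
  shows "x i \<in> A"
proof -
  have up: "x (i + int m * int n) = x i" for i m
  proof (induction m)
    case (Suc m)
    then show ?case using x_periodic[of "i + int m * int n"] by (simp add: algebra_simps)
  qed simp
  have periodic: "x (i + m * int n) = x i" for i m
  proof (cases "m \<ge> 0")
    case True
    then show ?thesis using up[of i "nat m"] by simp
  next
    case False
    then show ?thesis using up[of "i + m * int n" "nat (- m)"] by simp
  qed
  define r where "r = (i - 1) mod int n + 1"
  have "1 \<le> r" "r \<le> int n" 
  proof -
    have "0 < int n" using n_ge by simp
    from pos_mod_bound[OF this, of "i - 1"] pos_mod_sign[OF this, of "i - 1"]
    show "1 \<le> r" "r \<le> int n" unfolding r_def by linarith+
  qed
  then have "x r \<in> A" by (rule assms)
  moreover have "i = r + ((i - 1) div int n) * int n"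
    unfolding r_def using div_mult_mod_eq[of "i - 1" "int n"] by linarith
  ultimately show ?thesis using periodic by metis
qed

lemma P_mem:
  assumes A: "subalgebra \<iota> A" and x: "\<And>i. x i \<in> A" and "i \<le> k" "k \<le> i + int n"
  shows "P i k \<in> A"
  using assms(3,4)
proof (rule P_induct)
  show "P i i \<in> A" "P i (i + 1) \<in> A"
    using subalgebraD(2)[OF A, of 0] subalgebraD(2)[OF A, of 1] by (simp_all add: iota_zero iota_one)
next
  fix b assume "i < b" "b < i + int n" "P i b \<in> A" "P i (b - 1) \<in> A"
  then show "P i (b + 1) \<in> A"
    unfolding P_next[OF \<open>i < b\<close> \<open>b < i + int n\<close>] by (intro subalgebraD[OF A] x)
qed

lemma w_mem:
  assumes A: "subalgebra \<iota> A" and x: "\<And>i. x i \<in> A" and w1: "w 1 \<in> A"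
  shows "w i \<in> A"
proof -
  have next_w: "w (i + 1) = sp (- 1) * (w i * x i - sp (- 1) * w (i - 1))" for i
    unfolding w_x by (simp add: sp_norm)
  have prev_w: "w (i - 1) = sp 1 * (w i * x i - sp 1 * w (i + 1))" for i
    unfolding w_x by (simp add: sp_norm)
  \<comment> \<open>The factor q makes the coefficients of \<open>w 2\<close> in x_1 w_1 and w_1 x_1
    agree, so that it drops out.\<close>
  have "sp 2 * (x 1 * w 1) - w 1 * x 1 = (sp 3 - sp (- 1)) * w 0"
    unfolding x_w w_x by (simp add: distrib_left sp_norm left_diff_distrib)
  \<comment> \<open>The coefficient is written as the image of an element of the field: A need not
    be closed under inverses, but it contains all scalars.\<close>
  moreover have "sp 3 - sp (- 1) = \<iota> (s powi 3 - s powi (- 1))"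
    using iota_add[of "s powi 3 - s powi (- 1)" "s powi (- 1)"] by (simp add: sp_def)
  moreover define c where "c = s powi 3 - s powi (- 1)"
  ultimately have 1: "sp 2 * (x 1 * w 1) - w 1 * x 1 = \<iota> c * w 0" by simp
  have "sp 3 \<noteq> sp (- 1)" by (simp add: sp_inject)
  then have "c \<noteq> 0" unfolding c_def sp_def by auto
  then have "w 0 = \<iota> (inverse c) * (sp 2 * (x 1 * w 1) - w 1 * x 1)"
    unfolding 1 by (simp add: mult.assoc[symmetric] iota_mult[symmetric] iota_one)
  then have w0: "w 0 \<in> A" using w1 x by (auto intro!: subalgebraD[OF A])
  have up: "i \<ge> 0 \<Longrightarrow> w i \<in> A \<and> w (i + 1) \<in> A" for i
  proof (induction i rule: int_ge_induct)
    case (step i)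
    then show ?case using x next_w[of "i + 1"] by (auto intro!: subalgebraD[OF A])
  qed (use w0 w1 in auto)
  have down: "i \<le> 0 \<Longrightarrow> w i \<in> A \<and> w (i + 1) \<in> A" for i
  proof (induction i rule: int_le_induct)
    case (step i)
    then show ?case using x prev_w[of i] by (auto intro!: subalgebraD[OF A])
  qed (use w0 w1 in auto)
  show ?thesis using up[of i] down[of i] by linarith
qed

lemma cluster_variables_mem:
  assumes A: "subalgebra \<iota> A" and x: "\<And>i. \<lbrakk>1 \<le> i; i \<le> int n\<rbrakk> \<Longrightarrow> x i \<in> A" and w1: "w 1 \<in> A"
    and S0: "triangulated a \<sigma> S0"
  shows "cluster_variables n \<iota> s S0 \<subseteq> A"
proof
  fix y assume "y \<in> cluster_variables n \<iota> s S0"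
  then obtain S i where S: "S \<in> mutation_class n \<iota> s S0" and i: "i \<le> n" and y: "y = cluster S i"
    unfolding cluster_variables_def by blast
  obtain a' \<sigma>' where tr: "triangulated a' \<sigma>' S" using triangulated_class[OF S0 S] by blast
  obtain p r where pr: "\<sigma>' i = (p, r)" by fastforce
  have "(p, r) \<in> \<sigma>' ` {..n}" using i pr by (metis atMost_iff imageI)
  then have "0 \<le> p \<and> p \<le> int n \<and> (r = int n + 2 \<or> p + 2 \<le> r \<and> r \<le> int n)"
    using tr triangulationD(1) unfolding triangulated_def by blast
  moreover have "y = arc a' (p, r)"
    using tr labelledD(3)[of "arc a'" "lam (int n)" \<sigma>' S i] i y pr unfolding triangulated_def by simp
  ultimately show "y \<in> A"
    using w_mem[OF A x_mem[OF x] w1] P_mem[OF A x_mem[OF x], of "a' + p" "a' + r"] by auto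
qed

end

section \<open>Existence of the two-sided sequence of bridging arcs\<close>

context central_scalars
begin

text \<open>A window holds \<open>n + 1\<close> consecutive terms of the sequence \<open>w\<close>.\<close>

definition window :: "nat \<Rightarrow> (nat \<Rightarrow> 'd) \<Rightarrow> bool" where
  "window n f \<longleftrightarrow> (\<forall>i\<le>n. f i \<noteq> 0) \<and>
     (\<forall>i j. i < j \<longrightarrow> j \<le> n \<longrightarrow> f i * f j = sp (2 * par (int i) (int j)) * (f j * f i))"

definition next_window :: "nat \<Rightarrow> (nat \<Rightarrow> 'd) \<Rightarrow> (nat \<Rightarrow> 'd) \<Rightarrow> bool" where
  "next_window n f g \<longleftrightarrow> (\<forall>i<n. g i = f (i + 1)) \<and> f 0 * g n = 1 + sp 2 * (f 1 * f n)"

text \<open>If the sum vanished, c would be a scalar and commute with y, although they quasi-commute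
  with the factor q^2.\<close>

lemma exchange_sum_nonzero:
  assumes "y * c = sp 4 * (c * y)" "y \<noteq> 0"
  shows "1 + sp 2 * c \<noteq> 0"
proof
  assume "1 + sp 2 * c = 0"
  then have "sp 2 * c = - 1" by (simp add: add_eq_0_iff)
  then have "sp (- 2) * (sp 2 * c) = sp (- 2) * - 1" by simp
  then have c: "c = - sp (- 2)" by (simp add: sp_mult_left)
  have "sp (- 2) * y = sp 2 * y" using assms(1) unfolding c by (simp add: sp_norm)
  then show False using assms(2) by (simp add: sp_inject)
qed

text \<open>As n is odd, the exponents of f_1 and f_n against each shared entry cancel, so the
  binomial 1 + q f_1 f_n commutes with all shared entries. Hence the new end of the window has the
  exponents of the inverse of the old one, which are those required.\<close>

lemma window_next:
  assumes n: "odd n" "n \<ge> 2" and fg: "next_window n f g"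
  shows "window n f \<Longrightarrow> window n g" and "window n g \<Longrightarrow> window n f"
proof -
  have g: "g i = f (i + 1)" if "i < n" for i using fg that by (simp add: next_window_def)
  have ex: "f 0 * g n = 1 + sp 2 * (f 1 * f n)" using fg by (simp add: next_window_def)
  have par_suc: "par (int i + 1) (int j + 1) = par (int i) (int j)" for i j by (simp add: par_step)
  have par_n: "par (int i) (int n) = 1 - par 0 (int i)" "par (int n) (int i) = 1 - par 0 (int i)" for i
    using n unfolding par_def by presburger+
  let ?z = "1 + sp 2 * (f 1 * f n)"
  {
    assume f: "window n f"
    have nz: "f i \<noteq> 0" if "i \<le> n" for i using f that by (simp add: window_def)
    have sw: "f i * f j = sp (2 * par (int i) (int j)) * (f j * f i)" if "i < j" "j \<le> n" for i j
      using f that unfolding window_def by blast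
    have comm: "f j * ?z = ?z * f j" if j: "1 \<le> j" "j \<le> n" for j
    proof -
      have 1: "f j * f 1 = sp (- 2 * par 1 (int j)) * (f 1 * f j)"
        using sp_swap_sym[OF sw[of 1 j]] j by (cases "j = 1") auto
      have 2: "f j * f n = sp (2 * par (int j) (int n)) * (f n * f j)"
        using sw[of j n] j par_n[of n] by (cases "j = n") (auto simp: par_def)
      have "par 1 (int j) = par (int j) (int n)" using par_n par_step(3)[of 0 "int j"] by simp
      then have "f j * (f 1 * f n) = (f 1 * f n) * f j" using sp_swap_mult[OF 1 2] by simp
      then show ?thesis by (simp add: distrib_left distrib_right sp_left_commute) (simp add: mult.assoc)
    qed
    have z: "?z \<noteq> 0"
    proof (rule exchange_sum_nonzero)
      have "f 0 * f 1 = sp 2 * (f 1 * f 0)" "f 0 * f n = sp 2 * (f n * f 0)"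
        using sw[of 0 1] sw[of 0 n] n par_n(1)[of 0] by (auto simp: par_def)
      from sp_swap_mult[OF this] show "f 0 * (f 1 * f n) = sp 4 * (f 1 * f n * f 0)" by simp
      show "f 0 \<noteq> 0" by (rule nz) simp
    qed
    have last: "f j * g n = sp (2 * par 0 (int j)) * (g n * f j)" if j: "1 \<le> j" "j \<le> n" for j
    proof -
      have "f 0 * (f j * g n) = sp (2 * par 0 (int j)) * (f j * (f 0 * g n))"
        using sp_swap_left[OF sw[of 0 j]] j by simp
      also have "\<dots> = f 0 * (sp (2 * par 0 (int j)) * (g n * f j))"
        unfolding ex comm[OF j] unfolding ex[symmetric] by (simp add: sp_norm)
      finally show ?thesis using nz[of 0] by simp
    qed
    show "window n g"
      unfolding window_def
    proof (intro conjI allI impI)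
      fix i assume "i \<le> n"
      then show "g i \<noteq> 0" using g[of i] nz[of "i + 1"] z ex by (cases "i = n") auto
    next
      fix i j assume ij: "i < j" "j \<le> n"
      show "g i * g j = sp (2 * par (int i) (int j)) * (g j * g i)"
      proof (cases "j = n")
        case True
        have "par 0 (int i + 1) = par (int i) (int n)" using par_n(1)[of i] by (simp add: par_step)
        then show ?thesis using last[of "i + 1"] ij g[of i] True by (simp add: add.commute)
      next
        case False
        then show ?thesis using sw[of "i + 1" "j + 1"] ij g[of i] g[of j] par_suc[of i j] by (simp add: add.commute)
      qed
    qed
  }
  {
    assume f: "window n g"
    have nz: "g i \<noteq> 0" if "i \<le> n" for i using f that by (simp add: window_def)
    have sw: "g i * g j = sp (2 * par (int i) (int j)) * (g j * g i)" if "i < j" "j \<le> n" for i j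
      using f that unfolding window_def by blast
    have z_eq: "f 1 = g 0" "f n = g (n - 1)" using g[of 0] g[of "n - 1"] n by auto
    have comm: "g j * ?z = ?z * g j" if j: "j < n" for j
    proof -
      have 1: "g j * g 0 = sp (- 2 * par 0 (int j)) * (g 0 * g j)"
        using sp_swap_sym[OF sw[of 0 j]] j by (cases "j = 0") auto
      have 2: "g j * g (n - 1) = sp (2 * par (int j) (int (n - 1))) * (g (n - 1) * g j)"
        using sw[of j "n - 1"] j by (cases "j = n - 1") auto
      have "par 0 (int j) = par (int j) (int (n - 1))" using par_n(1)[of j] n by (simp add: of_nat_diff par_step)
      then have "g j * (g 0 * g (n - 1)) = (g 0 * g (n - 1)) * g j" using sp_swap_mult[OF 1 2] by simp
      then show ?thesis unfolding z_eq by (simp add: distrib_left distrib_right sp_left_commute) (simp add: mult.assoc)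
    qed
    have z: "?z \<noteq> 0"
      unfolding z_eq
    proof (rule exchange_sum_nonzero)
      have "par (int (n - 1)) (int n) = 1" using n by (simp add: of_nat_diff)
      then have "g n * g 0 = sp (- 2) * (g 0 * g n)" "g n * g (n - 1) = sp (- 2) * (g (n - 1) * g n)"
        using sp_swap_sym[OF sw[of 0 n]] sp_swap_sym[OF sw[of "n - 1" n]] n par_n(1)[of 0] by auto
      from sp_swap_mult[OF this] have "g n * (g 0 * g (n - 1)) = sp (- 4) * (g 0 * g (n - 1) * g n)" by simp
      \<comment> \<open>\<open>g n\<close> itself has exponent -4 against the product, so its
        inverse is the witness with exponent 4.\<close>
      then have "inverse (g n) * (g 0 * g (n - 1)) = sp 4 * (g 0 * g (n - 1) * inverse (g n))"
        using sp_inverse_swap[of "g n"] nz by fastforce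
      then show "inverse (g n) * (g 0 * g (n - 1)) = sp 4 * (g 0 * g (n - 1) * inverse (g n))" .
      show "inverse (g n) \<noteq> 0" using nz by simp
    qed
    have first: "f 0 * g j = sp (2 * par (int j) (int n)) * (g j * f 0)" if j: "j < n" for j
    proof -
      have "f 0 * g j * g n = sp (2 * par (int j) (int n)) * (f 0 * g n * g j)"
        using sw[of j n] j by (simp add: mult.assoc sp_norm)
      also have "\<dots> = sp (2 * par (int j) (int n)) * (g j * f 0) * g n"
        unfolding ex comm[OF j, symmetric] unfolding ex[symmetric] by (simp add: mult.assoc)
      finally show ?thesis using nz[of n] by simp
    qed
    show "window n f"
      unfolding window_def
    proof (intro conjI allI impI)
      fix i assume "i \<le> n"
      then show "f i \<noteq> 0" using g[of "i - 1"] nz[of "i - 1"] z ex by (cases "i = 0") auto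
    next
      fix i j assume ij: "i < j" "j \<le> n"
      then have gj: "f j = g (j - 1)" using g[of "j - 1"] by simp
      show "f i * f j = sp (2 * par (int i) (int j)) * (f j * f i)"
      proof (cases "i = 0")
        case True
        have "par (int (j - 1)) (int n) = par 0 (int j)"
          using par_n(1)[of "j - 1"] ij by (simp add: of_nat_diff par_step)
        then show ?thesis using first[of "j - 1"] ij gj True by simp
      next
        case False
        then show ?thesis
          using sw[of "i - 1" "j - 1"] ij g[of "i - 1"] gj by (simp add: of_nat_diff par_step)
      qed
    qed
  }
qed

lemma next_window_exists:
  assumes "odd n" "n \<ge> 2" "window n f"
  shows "\<exists>g. next_window n f g" "\<exists>e. next_window n e f"
proof -
  have nz: "f 0 \<noteq> 0" "f n \<noteq> 0" using assms(3) by (auto simp: window_def)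
  have "next_window n f (\<lambda>i. if i = n then inverse (f 0) * (1 + sp 2 * (f 1 * f n)) else f (i + 1))"
    using nz by (simp add: next_window_def mult.assoc[symmetric])
  then show "\<exists>g. next_window n f g" by (rule exI[where P = "next_window n f"])
  have "next_window n (\<lambda>i. if i = 0 then (1 + sp 2 * (f 0 * f (n - 1))) * inverse (f n) else f (i - 1)) f"
    using nz assms(2) by (simp add: next_window_def mult.assoc)
  then show "\<exists>e. next_window n e f" by (rule exI[where P = "\<lambda>e. next_window n e f"])
qed

text \<open>The initial cluster gives only n + 1 terms. Windows are iterated in both directions;
  \<open>V k\<close> is the window starting at k, and since neighbours overlap in n entries, their
  first entries form one sequence.\<close>

lemma annulus_exists:
  assumes n: "odd n" "n \<ge> 2" and v: "window n v"
  shows "\<exists>w. annulus \<iota> s n w \<and> (\<forall>i\<le>n. w (int i) = v i)"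
proof -
  define up where "up f = (SOME g. next_window n f g)" for f
  define down where "down f = (SOME e. next_window n e f)" for f
  have up: "next_window n f (up f)" and down: "next_window n (down f) f" if "window n f" for f
    unfolding up_def down_def by (rule someI_ex[OF next_window_exists(1)[OF n that]], rule someI_ex[OF next_window_exists(2)[OF n that]])
  have win_up: "window n ((up ^^ m) v)" and win_down: "window n ((down ^^ m) v)" for m
    using v window_next[OF n] up down by (induction m) (simp, fastforce)+
  define V where "V k = (if k \<ge> 0 then (up ^^ nat k) v else (down ^^ nat (- k)) v)" for k :: int
  have win: "window n (V k)" for k using win_up win_down by (simp add: V_def)
  have next_V: "next_window n (V k) (V (k + 1))" for k
  proof (cases "k \<ge> 0")
    case True
    then show ?thesis using up[OF win_up[of "nat k"]] by (simp add: V_def nat_add_distrib)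
  next
    case False
    then have "nat (- k) = Suc (nat (- (k + 1)))" by simp
    moreover have "V (k + 1) = (down ^^ nat (- (k + 1))) v"
      using False by (cases "k = - 1") (auto simp: V_def)
    ultimately show ?thesis using down[OF win_down[of "nat (- (k + 1))"]] False by (simp add: V_def)
  qed
  define w where "w k = V k 0" for k
  have V: "V k i = w (k + int i)" if "i \<le> n" for k i
    using that
  proof (induction i arbitrary: k)
    case (Suc i)
    have "V (k + 1) i = V k (i + 1)" using next_V[of k] Suc.prems by (simp add: next_window_def)
    then show ?case using Suc by (simp add: algebra_simps)
  qed (simp add: w_def)
  have "annulus \<iota> s n w"
  proof
    show "odd n" "n \<ge> 2" by fact+
    fix i :: int
    show "w i \<noteq> 0" using win[of i] by (simp add: window_def w_def)
    have "w i * V (i + 1) n = 1 + sp 2 * (V i 1 * V i n)"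
      using next_V[of i] by (simp add: next_window_def w_def)
    then show "w i * w (i + int n + 1) = 1 + sp 2 * (w (i + 1) * w (i + int n))"
      using V[of 1 i] V[of n i] V[of n "i + 1"] n by (simp add: algebra_simps)
    fix j assume ij: "i < j" "j \<le> i + int n"
    have "V i 0 * V i (nat (j - i)) = sp (2 * par 0 (j - i)) * (V i (nat (j - i)) * V i 0)"
    proof -
      have "0 < nat (j - i)" "nat (j - i) \<le> n" using ij by auto
      then have "V i 0 * V i (nat (j - i)) = sp (2 * par (int 0) (int (nat (j - i)))) * (V i (nat (j - i)) * V i 0)"
        using win[of i] unfolding window_def by blast
      then show ?thesis using ij by simp
    qed
    moreover have "par 0 (j - i) = par i j" unfolding par_def by presburger
    ultimately show "w i * w j = sp (2 * par i j) * (w j * w i)"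
      using V[of 0 i] V[of "nat (j - i)" i] ij by simp
  qed
  moreover have "w (int i) = v i" if "i \<le> n" for i
    using V[of i 0] that by (simp add: V_def)
  ultimately show ?thesis by blast
qed

end

section \<open>The initial seed\<close>

lemma torus_mult_single:
  "torus_mult n L q (Poly_Mapping.single a x) (Poly_Mapping.single b y) =
     Poly_Mapping.single (a + b) (x * y * q powi torus_twist n L a b)"
  by (cases "x = 0"; cases "y = 0") (simp_all add: torus_mult_def)

lemma torus_twist_zero: "torus_twist n L 0 b = 0" "torus_twist n L a 0 = 0"
  by (simp_all add: torus_twist_def)

lemma torus_mult_const:
  "torus_mult n L q (torus_const c) f = torus_mult n L q f (torus_const c)"
  by (cases "c = 0") (simp_all add: torus_mult_def torus_const_def torus_twist_zero mult.commute)

lemma torus_twist_gen: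
  assumes "i \<le> n" "j \<le> n"
  shows "torus_twist n L (Poly_Mapping.single i 1) (Poly_Mapping.single j 1) = (if j < i then L i j else 0)"
proof -
  let ?e = "\<lambda>i. Poly_Mapping.single i (1 :: int)"
  have "Poly_Mapping.lookup (?e i) b * Poly_Mapping.lookup (?e j) a * L b a = (if b = i then if a = j then L b a else 0 else 0)" for a b
    by (auto simp: lookup_single when_def)
  then have "torus_twist n L (?e i) (?e j) = (\<Sum>b\<le>n. \<Sum>a<b. if b = i then if a = j then L b a else 0 else 0)"
    by (simp only: torus_twist_def)
  also have "\<dots> = (\<Sum>b\<le>n. if b = i then \<Sum>a<b. if a = j then L b a else 0 else 0)"
    by (intro sum.cong refl) simp
  also have "\<dots> = (if j < i then L i j else 0)" using assms by simp
  finally show ?thesis .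
qed

context torus_fractions
begin

lemma carriers:
  "torus_const c \<in> torus_carrier n" "i \<le> n \<Longrightarrow> torus_gen i \<in> torus_carrier n" "0 \<in> torus_carrier n"
  "\<lbrakk>i \<le> n; j \<le> n\<rbrakk> \<Longrightarrow> Poly_Mapping.single (Poly_Mapping.single i 1 + Poly_Mapping.single j 1) c \<in> torus_carrier n"
  using keys_add[of "Poly_Mapping.single i (1::int)" "Poly_Mapping.single j 1"]
  by (auto simp: torus_carrier_def torus_const_def torus_gen_def split: if_splits)

lemma h_zero: "h 0 = 0"
  using h_add[OF carriers(3) carriers(3)] by simp

text \<open>Constants have exponent 0 and hence no twist, so they commute with the torus, and then
  with inverses and fractions.\<close>

lemma scal_central: "scal h c * d = d * scal h c"
proof -
  obtain f g where f: "f \<in> torus_carrier n" and g: "g \<in> torus_carrier n" and d: "d = h f * inverse (h g)"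
    using fraction[of d] by blast
  have comm: "scal h c * h f = h f * scal h c" if "f \<in> torus_carrier n" for f
    unfolding scal_def using h_mult[OF carriers(1) that] h_mult[OF that carriers(1)] torus_mult_const by metis
  have "scal h c * inverse (h g) = inverse (h g) * scal h c"
  proof (cases "h g = 0")
    case False
    have "scal h c * inverse (h g) = inverse (h g) * (h g * scal h c) * inverse (h g)"
      using False by (simp add: mult.assoc[symmetric])
    also have "\<dots> = inverse (h g) * (scal h c * h g) * inverse (h g)"
      by (simp only: comm[OF g])
    also have "\<dots> = inverse (h g) * scal h c"
      using False by (simp add: mult.assoc)
    finally show ?thesis .
  qed simp
  then show ?thesis unfolding d using comm[OF f] by (metis mult.assoc)
qed

lemma scal_simps: "scal h 1 = 1" "scal h (c + d) = scal h c + scal h d" "scal h (c * d) = scal h c * scal h d"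
proof -
  show "scal h 1 = 1" using h_one by (simp add: scal_def torus_const_def)
  show "scal h (c + d) = scal h c + scal h d"
    unfolding scal_def using h_add[OF carriers(1) carriers(1), of c d] by (simp add: torus_const_def single_add)
  show "scal h (c * d) = scal h c * scal h d"
    unfolding scal_def using h_mult[OF carriers(1) carriers(1), of c d]
    by (simp add: torus_const_def torus_mult_single torus_twist_zero)
qed

lemma gen_nonzero: "i \<le> n \<Longrightarrow> h (torus_gen i) \<noteq> 0"
proof
  assume "i \<le> n" "h (torus_gen i) = 0"
  with inj_onD[OF h_inj _ carriers(2)[of i] carriers(3)] h_zero
  show False unfolding torus_gen_def by (metis keys_single keys_zero insert_not_empty one_neq_zero)
qed

text \<open>For i < j the product w_i w_j is already an ordered monomial; only the reversed product
  picks up a twist.\<close>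

lemma gen_swap:
  assumes "i < j" "j \<le> n" "q \<noteq> 0"
  shows "h (torus_gen i) * h (torus_gen j) = scal h (q powi (- L j i)) * (h (torus_gen j) * h (torus_gen i))"
proof -
  have i: "i \<le> n" using assms by simp
  let ?e = "Poly_Mapping.single i 1 + Poly_Mapping.single j (1::int)"
  have "h (torus_gen i) * h (torus_gen j) = h (Poly_Mapping.single ?e 1)"
    using assms h_mult[OF carriers(2)[OF i] carriers(2)[OF assms(2)]]
    by (simp add: torus_gen_def torus_mult_single torus_twist_gen)
  moreover have "h (torus_gen j) * h (torus_gen i) = h (Poly_Mapping.single ?e (q powi L j i))"
    using assms h_mult[OF carriers(2)[OF assms(2)] carriers(2)[OF i]]
    by (simp add: torus_gen_def torus_mult_single torus_twist_gen add.commute)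
  moreover have "scal h (q powi (- L j i)) * h (Poly_Mapping.single ?e (q powi L j i)) = h (Poly_Mapping.single ?e 1)"
    unfolding scal_def using assms h_mult[OF carriers(1) carriers(4)[OF i assms(2), of "q powi L j i"], of "q powi (- L j i)"]
    by (simp add: torus_const_def torus_mult_single torus_twist_zero power_int_add[symmetric])
  ultimately show ?thesis by simp
qed

end

lemma sum_P_exch:
  fixes g :: "nat \<Rightarrow> int"
  assumes "i \<le> n" "n \<ge> 3"
  shows "(\<Sum>m\<le>n. P_exch n m i * g m) =
    (if i = 0 then - g 1 - g n else if i = n then g (n - 1) + g 0 else g (i - 1) - g (i + 1))"
proof -
  have two: "(\<Sum>m\<le>n. (if m = a then \<alpha> * g m else 0) + (if m = b then \<beta> * g m else 0)) = \<alpha> * g a + \<beta> * g b"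
    if "a \<le> n" "b \<le> n" for a b \<alpha> \<beta>
    using that by (simp add: sum.distrib)
  consider "i = 0" | "i = n" | "0 < i" "i < n" using assms(1) by linarith
  then show ?thesis
  proof cases
    case 1
    have "(\<Sum>m\<le>n. P_exch n m i * g m) = (\<Sum>m\<le>n. (if m = 1 then - 1 * g m else 0) + (if m = n then - 1 * g m else 0))"
      using 1 assms by (intro sum.cong refl) (auto simp: P_exch_def)
    then show ?thesis using two[of 1 n "- 1" "- 1"] 1 assms by simp
  next
    case 2
    have "(\<Sum>m\<le>n. P_exch n m i * g m) = (\<Sum>m\<le>n. (if m = n - 1 then 1 * g m else 0) + (if m = 0 then 1 * g m else 0))"
      using 2 assms by (intro sum.cong refl) (auto simp: P_exch_def)
    then show ?thesis using two[of "n - 1" 0 1 1] 2 assms by simp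
  next
    case 3
    have "(\<Sum>m\<le>n. P_exch n m i * g m) = (\<Sum>m\<le>n. (if m = i - 1 then 1 * g m else 0) + (if m = i + 1 then - 1 * g m else 0))"
      using 3 assms by (intro sum.cong refl) (auto simp: P_exch_def)
    then show ?thesis using two[of "i - 1" "i + 1" 1 "- 1"] 3 assms by simp
  qed
qed

lemma P_exch_compatible:
  assumes "i \<le> n" "j \<le> n" "n \<ge> 3" "odd n"
  shows "(\<Sum>m\<le>n. P_exch n m i * P_quasi m j) = (if i = j then 2 else 0)"
proof -
  consider "i = 0" | "i = n" | k where "i = Suc k" "i < n" using assms(1) by (cases "i = n"; cases i) auto
  then show ?thesis
  proof cases
    case 1
    then show ?thesis unfolding sum_P_exch[OF assms(1,3)] using assms by (auto simp: P_quasi_def)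
  next
    case 2
    then show ?thesis unfolding sum_P_exch[OF assms(1,3)] using assms by (auto simp: P_quasi_def)
  next
    case 3
    then show ?thesis unfolding sum_P_exch[OF assms(1,3)] using assms by (auto simp: P_quasi_def) presburger+
  qed
qed

lemma P_quasi_ell: "\<lbrakk>i \<le> n; j \<le> n\<rbrakk> \<Longrightarrow> P_quasi i j = ell (int n) (int i) (int j)"
  by (simp add: P_quasi_def ell_def)

lemma triangulation_bridges:
  assumes "N \<ge> 0"
  shows "triangulation N {(p, N + 2) |p. 0 \<le> p \<and> p \<le> N}"
proof -
  have "(p, r) \<in> {(p, N + 2) |p. 0 \<le> p \<and> p \<le> N}"
    if "(p, r) \<in> arcs N" and nc: "\<forall>b\<in>{(p, N + 2) |p. 0 \<le> p \<and> p \<le> N}. \<not> crosses (p, r) b" for p r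
  proof (rule ccontr)
    assume "(p, r) \<notin> {(p, N + 2) |p. 0 \<le> p \<and> p \<le> N}"
    then have "0 \<le> p" "p + 2 \<le> r" "r \<le> N" using that(1) by (auto simp: arcs_def)
    \<comment> \<open>An arc between outer points always separates p + 1 from the inner
      vertex.\<close>
    moreover from this have "(p + 1, N + 2) \<in> {(p, N + 2) |p. 0 \<le> p \<and> p \<le> N}" by auto
    then have "\<not> crosses (p, r) (p + 1, N + 2)" using nc by blast
    ultimately show False by simp
  qed
  then show ?thesis unfolding triangulation_def by (auto simp: arcs_def)
qed

lemma hull_mono_gen: "(\<And>A. P A \<Longrightarrow> T \<subseteq> A \<Longrightarrow> S \<subseteq> A) \<Longrightarrow> P hull S \<subseteq> P hull T"
  unfolding hull_def by blast

context annulus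
begin

text \<open>The initial cluster is the fan of all bridges with the cut at 0.\<close>

lemma initial_triangulated:
  assumes "n \<ge> 3" and w: "\<And>i. i \<le> n \<Longrightarrow> w (int i) = v i"
  defines "S \<equiv> \<lparr>cluster = v, exch = P_exch n, quasi = P_quasi\<rparr>"
  shows "triangulated 0 (\<lambda>i. (int i, int n + 2)) S"
proof -
  have quasi: "P_quasi i j = (if i < j then par (int i) (int j) else - par (int j) (int i))" for i j
    by (auto simp: P_quasi_def par_def mod_2_eq_odd)
  have "quasi_commuting S"
    unfolding quasi_commuting_def
  proof (intro conjI allI impI)
    fix i j assume ij: "i \<le> n" "j \<le> n"
    have nz: "v i \<noteq> 0" if "i \<le> n" for i using w_nonzero[of "int i"] w[OF that] by simp
    show "quasi S i j = - quasi S j i" by (auto simp: S_def P_quasi_def)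
    have sw: "v i * v j = sp (2 * par (int i) (int j)) * (v j * v i)" if "i < j" "j \<le> n" for i j
      using w_swap[of "int i" "int j"] that w[of i] w[of j] by simp
    consider "i < j" | "i = j" | "j < i" by linarith
    then show "cluster S i * cluster S j = sp (2 * quasi S i j) * (cluster S j * cluster S i)"
    proof cases
      case 1
      then show ?thesis using sw[of i j] ij by (simp add: S_def quasi)
    next
      case 2
      then show ?thesis by (simp add: S_def P_quasi_def)
    next
      case 3
      then show ?thesis using sp_swap_sym[OF sw[of j i]] ij by (simp add: S_def quasi)
    qed
  next
    fix i assume "i \<le> n"
    then show "cluster S i \<noteq> 0" using w_nonzero[of "int i"] w[of i] by (simp add: S_def)
  qed
  moreover have "exch S i j = - exch S j i" if "i \<le> n" "j \<le> n" for i j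
    using that assms(1) by (auto simp: S_def P_exch_def)
  moreover have "(\<Sum>m\<le>n. exch S m i * quasi S m j) = (if i = j then 2 else 0)" if "i \<le> n" "j \<le> n" for i j
    using P_exch_compatible[OF that assms(1) n_odd] by (simp add: S_def)
  ultimately have "compatible S" unfolding compatible_def by blast
  moreover have "P_quasi i j = lam (int n) (int i, int n + 2) (int j, int n + 2)" if "i \<le> n" "j \<le> n" for i j
    using that by (simp add: P_quasi_ell)
  ultimately have "labelled (arc 0) (lam (int n)) (\<lambda>i. (int i, int n + 2)) S"
    unfolding labelled_def using w by (auto simp: S_def inj_on_def simp del: lam.simps)
  moreover have "(\<lambda>i. (int i, int n + 2)) ` {..n} = {(p, int n + 2) |p. 0 \<le> p \<and> p \<le> int n}"
    by (auto simp: image_iff intro!: bexI[of _ "nat _"])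
  ultimately show ?thesis
    unfolding triangulated_def using triangulation_bridges[of "int n"] by simp
qed

text \<open>For i < n, flipping the bridge at i inside i - 1, i, i + 1 and the inner vertex gives
  x_i at once. The bridge at n is a side of the polygon, so the cut is first moved by flipping the
  bridge at 0.\<close>

lemma x_cluster_variable:
  assumes n: "n \<ge> 3" and S: "triangulated 0 (\<lambda>i. (int i, int n + 2)) S" and i: "1 \<le> i" "i \<le> n"
  shows "x (int i) \<in> cluster_variables n \<iota> s S"
proof (cases "i < n")
  case True
  let ?\<sigma> = "\<lambda>i. (int i, int n + 2)"
  have e: "edge (int n) (?\<sigma> ` {..n}) (int i - 1, int i)" "edge (int n) (?\<sigma> ` {..n}) (int i, int i + 1)"
    using i True by (auto simp: edge_def)
  have mem: "(int m, int n + 2) \<in> ?\<sigma> ` {..n}" if "m \<le> n" for m using that by blast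
  have "edge (int n) (?\<sigma> ` {..n}) (int i + 1, int n + 2)" "edge (int n) (?\<sigma> ` {..n}) (int i - 1, int n + 2)"
    using mem[of "i + 1"] mem[of "i - 1"] i True by (simp_all add: edge_def of_nat_diff add.commute)
  then have "triangulated 0 (?\<sigma>(i := (int i - 1, int i + 1))) (mutate n \<iota> s i S)"
    using mutate_quadrilateral[OF S i(2), of "int i - 1" "int i" "int i + 1" "int n + 2" "(int i - 1, int i + 1)"] e True by auto
  then have "cluster (mutate n \<iota> s i S) i = x (int i)"
    using labelledD(3)[of "arc 0" "lam (int n)" "?\<sigma>(i := (int i - 1, int i + 1))" _ i] i True
    unfolding triangulated_def x_def by auto
  moreover have "mutate n \<iota> s i S \<in> mutation_class n \<iota> s S"
    by (intro mutation_class.intros i)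
  ultimately show ?thesis unfolding cluster_variables_def using i by (smt (verit) mem_Collect_eq)
next
  case False
  then have [simp]: "i = n" using i by simp
  let ?N = "int n"
  let ?\<sigma> = "\<lambda>i. (int i, ?N + 2)"
  have "first_bridge ?N (?\<sigma> ` {..n}) 1"
    unfolding first_bridge_def using n by (auto intro!: image_eqI[of _ _ 1])
  from mutate_first_bridge[OF S _ _ this, of 0]
  have S1: "triangulated 1 (\<lambda>i. if i = 0 then (?N, ?N + 2) else rotate_up ?N 1 (int i, ?N + 2)) (mutate n \<iota> s 0 S)"
    (is "triangulated 1 ?\<tau> ?S1") by simp
  have mem: "(int m - 1, ?N + 2) \<in> ?\<tau> ` {..n}" if "1 \<le> m" "m \<le> n" for m
    using that by (intro image_eqI[of _ _ m]) auto
  have top: "(?N, ?N + 2) \<in> ?\<tau> ` {..n}" by (intro image_eqI[of _ _ 0]) auto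
  have e: "edge ?N (?\<tau> ` {..n}) (?N - 2, ?N - 1)" "edge ?N (?\<tau> ` {..n}) (?N - 1, ?N)"
    "edge ?N (?\<tau> ` {..n}) (?N, ?N + 2)" "edge ?N (?\<tau> ` {..n}) (?N - 2, ?N + 2)"
    unfolding edge_def using n top mem[of "n - 1"] by (auto simp: of_nat_diff)
  \<comment> \<open>Relative to the new base point 1, position n of the seed holds the bridge at N -
    1, now interior, with outer neighbours N - 2 and N.\<close>
  have "triangulated 1 (?\<tau>(n := (?N - 2, ?N))) (mutate n \<iota> s n ?S1)"
    using mutate_quadrilateral[OF S1 order.refl _ _ _ _ e, of "(?N - 2, ?N)"] n by auto
  then have "cluster (mutate n \<iota> s n ?S1) n = x ?N"
    using labelledD(3)[of "arc 1" "lam ?N" "?\<tau>(n := (?N - 2, ?N))" _ n]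
    unfolding triangulated_def x_def by (auto simp: add.commute)
  moreover have "mutate n \<iota> s n ?S1 \<in> mutation_class n \<iota> s S"
    by (intro mutation_class.intros) auto
  ultimately show ?thesis unfolding cluster_variables_def by (smt (verit) \<open>i = n\<close> mem_Collect_eq order.refl)
qed

end

theorem theorem6p7:
  fixes n :: nat and q s :: "'k::alg_closed_field"
    and h :: "((nat \<Rightarrow>\<^sub>0 int) \<Rightarrow>\<^sub>0 'k) \<Rightarrow> 'd::division_ring"
  assumes "n \<ge> 3" and "odd n"
    and "q \<noteq> 0" and "\<forall>m::nat. m > 0 \<longrightarrow> q ^ m \<noteq> 1"
    and "s ^ 2 = q"
    and "torus_fractions n P_quasi q h"
  shows "P_cluster_algebra h n s =
           generated_subalgebra (scal h) ({w_elem h n q 0, w_elem h n q 1} \<union> x_elem h n q s ` {1..n}) \<and>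
         P_cluster_algebra h n s =
           generated_subalgebra (scal h) ({w_elem h n q 1} \<union> x_elem h n q s ` {1..n})"
proof -
  interpret torus_fractions n P_quasi q h by fact
  have s0: "s \<noteq> 0" using assms(3,5) by auto
  have q_pow: "q powi m = s powi (2 * m)" for m
    using assms(5) by (simp add: power_int_mult)
  have s_powi: "m = 0" if "s powi m = 1" for m :: int
  proof (rule ccontr)
    assume "m \<noteq> 0"
    have "q powi m = 1" using that by (simp add: q_pow power_int_mult mult.commute[of 2])
    then have "q ^ nat \<bar>m\<bar> = 1"
      by (cases "m \<ge> 0") (auto simp: power_int_def power_inverse)
    then show False using assms(4) \<open>m \<noteq> 0\<close> by simp
  qed
  interpret central_scalars "scal h" s
    by unfold_locales (rule scal_simps scal_central s0, (erule s_powi)?)+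
  define v where "v i = h (torus_gen i)" for i
  have "window n v"
    unfolding window_def
  proof (intro conjI allI impI)
    fix i j :: nat assume ij: "i < j" "j \<le> n"
    have "- P_quasi j i = par (int i) (int j)"
      using ij by (auto simp: P_quasi_def par_def) presburger+
    then show "v i * v j = sp (2 * par (int i) (int j)) * (v j * v i)"
      using gen_swap[OF ij assms(3)] by (simp add: v_def sp_def q_pow)
  qed (simp add: gen_nonzero v_def)
  then obtain w where ann: "annulus (scal h) s n w" and w: "\<And>i. i \<le> n \<Longrightarrow> w (int i) = v i"
    using annulus_exists[OF assms(2)] assms(1) by auto
  interpret annulus "scal h" s n w by (rule ann)
  have w_elem: "w_elem h n q i = w (int i)" if "i \<le> n + 1" for i
  proof (cases "i = n + 1")
    case True
    have "w 0 * w (int n + 1) = 1 + scal h q * w 1 * w (int n)"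
      using w_exchange[of 0] assms(5) by (simp add: sp_def mult.assoc)
    then have "w (int n + 1) = inverse (w 0) * (1 + scal h q * w 1 * w (int n))"
      using w_nonzero[of 0] by (metis left_inverse mult.assoc mult_1_left)
    then show ?thesis using w[of 0] w[of 1] w[of n] assms(1) True by (simp add: w_elem_def v_def add.commute)
  next
    case False
    then show ?thesis using that w[of i] by (simp add: w_elem_def v_def)
  qed
  have x_elem: "x_elem h n q s i = x (int i)" if "1 \<le> i" "i \<le> n" for i
  proof -
    \<comment> \<open>\<open>x_elem\<close> divides by w_i on the left, which matches
      \<open>w_x\<close> rather than \<open>x_w\<close>.\<close>
    have "x_elem h n q s i = inverse (w (int i)) * (sp (- 1) * w (int i - 1) + sp 1 * w (int i + 1))"
      using w_elem[of i] w_elem[of "i - 1"] w_elem[of "i + 1"] that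
      by (simp add: x_elem_def sp_def power_int_minus of_nat_diff add.commute)
    also have "\<dots> = x (int i)"
      unfolding w_x[symmetric] using w_nonzero by (simp add: mult.assoc[symmetric])
    finally show ?thesis .
  qed
  let ?S = "P_initial_seed h n"
  let ?V = "cluster_variables n (scal h) s ?S"
  let ?W = "{w_elem h n q 0, w_elem h n q 1}" and ?X = "x_elem h n q s ` {1..n}"
  have tri: "triangulated 0 (\<lambda>i. (int i, int n + 2)) ?S"
    using initial_triangulated[OF assms(1) w] by (simp add: P_initial_seed_def v_def)
  have V_sub: "?V \<subseteq> A" if A: "subalgebra (scal h) A" and gen: "{w_elem h n q 1} \<union> ?X \<subseteq> A" for A
  proof (rule cluster_variables_mem[OF A _ _ tri])
    show "w 1 \<in> A" using gen w_elem[of 1] assms(1) by simp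
    fix i :: int assume i: "1 \<le> i" "i \<le> int n"
    then have "nat i \<in> {1..n}" by auto
    then have "x_elem h n q s (nat i) \<in> A" using gen by blast
    then show "x i \<in> A" using x_elem[of "nat i"] i by simp
  qed
  have "?W \<subseteq> ?V"
  proof -
    have "cluster ?S i \<in> ?V" if "i \<le> n" for i
      unfolding cluster_variables_def using that mutation_class.initial by blast
    from this[of 0] this[of 1] show ?thesis
      using assms(1) by (simp add: P_initial_seed_def w_elem_def)
  qed
  moreover have "?X \<subseteq> ?V"
    using x_cluster_variable[OF assms(1) tri] x_elem by auto
  ultimately have gen_sub: "?W \<union> ?X \<subseteq> ?V" by blast
  \<comment> \<open>Three inclusions that close up to a cycle, so all three subalgebras
    agree.\<close>
  have "generated_subalgebra (scal h) ?V \<subseteq> generated_subalgebra (scal h) ({w_elem h n q 1} \<union> ?X)"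
    by (rule hull_mono_gen) (rule V_sub)
  moreover have "generated_subalgebra (scal h) ({w_elem h n q 1} \<union> ?X) \<subseteq> generated_subalgebra (scal h) (?W \<union> ?X)"
    by (rule hull_mono) auto
  moreover have "generated_subalgebra (scal h) (?W \<union> ?X) \<subseteq> generated_subalgebra (scal h) ?V"
    by (rule hull_mono) (rule gen_sub)
  ultimately show ?thesis
    unfolding P_cluster_algebra_def quantum_cluster_algebra_def by blast
qed

end
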